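(* Let $\Gamma_\infty\subset\partial_\infty\mathbb{H}^2\times\mathbb{R}$ be a Jordan curve homologous to zero in $\partial_\infty\mathbb{H}^2\times\mathbb{R}$. (1) Suppose that $\Gamma_\infty$ is strictly contained in a closed slab between two horizontal circles of $\partial_\infty\mathbb{H}^2\times\mathbb{R}$ with width equal to $\pi$, i.e. $\Gamma_\infty\subset\partial_\infty\mathbb{H}^2\times(t_0,t_0+\pi)$ for some $t_0\in\mathbb{R}$. Then: (a) there is no properly immersed minimal surface $M$ in $\mathbb{H}^2\times\mathbb{R}$ with asymptotic boundary $\Gamma_\infty$, possibly with finite boundary, such that $M\cup\Gamma_\infty$ is a continuous surface with boundary; (b) there is no complete properly immersed minimal surface in $\mathbb{H}^2\times\mathbb{R}$ with asymptotic boundary $\Gamma_\infty$ (without any assumption on $M\cup\Gamma_\infty$). (2) Suppose that $\Gamma_\infty$ is contained in a slab $\partial_\infty\mathbb{H}^2\times[t_0,t_0+\pi]$ of width equal to $\pi$ but is not contained in any slab of width strictly less than $\pi$. Then there is no complete minimal surface $M$ properly immersed in $\mathbb{H}^2\times\mathbb{R}$ with asymptotic boundary $\Gamma_\infty$ such that $M\cup\Gamma_\infty$ is a continuous surface with boundary.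
   Context: $\mathbb{H}^2$ is the hyperbolic plane (curvature $-1$), $\mathbb{H}^2\times\mathbb{R}$ has the product metric. In the Poincaré disk model, $\overline{\mathbb{H}^2}=\mathbb{H}^2\cup\partial_\infty\mathbb{H}^2$ is the closed unit disk with its Euclidean topology. The asymptotic boundary $\partial_\infty M$ of a surface $M\subset\mathbb{H}^2\times\mathbb{R}$ is the set of points of $\partial_\infty\mathbb{H}^2\times\mathbb{R}$ that are limits, in $\overline{\mathbb{H}^2}\times\mathbb{R}$, of sequences of points of $M$. The finite boundary of $M$ is its boundary $\partial M\subset\mathbb{H}^2\times\mathbb{R}$; complete surfaces have no finite boundary. "$M\cup\Gamma_\infty$ is a continuous surface with boundary" means that $M\cup\Gamma_\infty$, in $\overline{\mathbb{H}^2}\times\mathbb{R}$, is a topological surface with boundary, continuous up to $\Gamma_\infty$, with $\Gamma_\infty$ part of its boundary. A horizontal circle is $\partial_\infty\mathbb{H}^2\times\{t\}$; a slab of width $w$ in $\partial_\infty\mathbb{H}^2\times\mathbb{R}$ is $\partial_\infty\mathbb{H}^2\times[t_0,t_0+w]$. *)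

theory Defs
  imports "HOL-Analysis.Analysis" "HOL-Homology.Homology"
begin

section \<open>The space \<open>\<bbbH>\<^sup>2 \<times> \<real>\<close>\<close>

abbreviation H2R :: "(complex \<times> real) set" where
  "H2R \<equiv> ball 0 1 \<times> UNIV"

abbreviation H2R_closure :: "(complex \<times> real) set" where
  "H2R_closure \<equiv> cball 0 1 \<times> UNIV"

abbreviation H2R_infinity :: "(complex \<times> real) set" where
  "H2R_infinity \<equiv> sphere 0 1 \<times> UNIV"

definition conformal_factor :: "complex \<Rightarrow> real" where
  "conformal_factor z = 2 / (1 - (cmod z)\<^sup>2)"

definition metric :: "complex \<times> real \<Rightarrow> complex \<times> real \<Rightarrow> complex \<times> real \<Rightarrow> real" where
  "metric p v w = (conformal_factor (fst p))\<^sup>2 * (fst v \<bullet> fst w) + snd v * snd w"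

text \<open>The Levi-Civita connection of \<open>metric\<close> is \<open>D + christoffel\<close>, where \<open>D\<close> is the flat connection:
  for a conformal metric \<open>exp (2 \<phi>) |dz|\<^sup>2\<close> the correction to \<open>D\<close> is
  \<open>d\<phi>(v) w + d\<phi>(w) v - (v \<bullet> w) grad \<phi>\<close>, and here \<open>grad \<phi> = conformal_factor z * z\<close>.
  The two lemmas below (symmetry and compatibility with the metric) characterise it.\<close>

definition christoffel ::
    "complex \<times> real \<Rightarrow> complex \<times> real \<Rightarrow> complex \<times> real \<Rightarrow> complex \<times> real" where
  "christoffel p v w = (let z = fst p; a = fst v; b = fst w in
     (conformal_factor z *\<^sub>R ((z \<bullet> a) *\<^sub>R b + (z \<bullet> b) *\<^sub>R a - (a \<bullet> b) *\<^sub>R z), 0))"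

lemma christoffel_sym: "christoffel p v w = christoffel p w v"
  by (simp add: christoffel_def Let_def inner_commute add.commute)

lemma christoffel_metric:
  assumes "p \<in> H2R"
  shows "((\<lambda>q. metric q a b) has_derivative
           (\<lambda>v. metric p (christoffel p v a) b + metric p a (christoffel p v b))) (at p)"
proof -
  have nz: "1 - fst p \<bullet> fst p \<noteq> 0"
    using assms by (auto simp: dot_square_norm power_less_one_iff abs_square_eq_1)
  have "((\<lambda>q::complex \<times> real. (2 / (1 - fst q \<bullet> fst q))\<^sup>2 * (fst a \<bullet> fst b) + snd a * snd b) has_derivative
      (\<lambda>v. 2 * (2 / (1 - fst p \<bullet> fst p)) ^ 3 * (fst p \<bullet> fst v) * (fst a \<bullet> fst b))) (at p)"
  proof -
    have 1: "((\<lambda>q::complex \<times> real. 1 - fst q \<bullet> fst q) has_derivative (\<lambda>v. - 2 * (fst p \<bullet> fst v))) (at p)"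
      by (auto intro!: derivative_eq_intros simp: inner_commute)
    have 2: "((\<lambda>t. (2 / t)\<^sup>2 * (fst a \<bullet> fst b) + snd a * snd b) has_real_derivative
        - 8 / s ^ 3 * (fst a \<bullet> fst b)) (at s)" if "s \<noteq> 0" for s
      using that by (auto intro!: derivative_eq_intros simp: power2_eq_square power3_eq_cube)
    show ?thesis
      by (rule has_derivative_eq_rhs[OF DERIV_compose_FDERIV[OF 2[OF nz] 1]])
        (simp add: fun_eq_iff power_divide)
  qed
  moreover have "metric p (christoffel p v a) b + metric p a (christoffel p v b) =
      2 * conformal_factor (fst p) ^ 3 * (fst p \<bullet> fst v) * (fst a \<bullet> fst b)" for v
    by (simp add: metric_def christoffel_def Let_def inner_add_left inner_add_right
        inner_diff_left inner_diff_right inner_commute power2_eq_square power3_eq_cube algebra_simps)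
  moreover have "conformal_factor z = 2 / (1 - z \<bullet> z)" for z
    by (simp add: conformal_factor_def dot_square_norm)
  ultimately show ?thesis
    by (simp add: metric_def)
qed

section \<open>Surfaces with boundary\<close>

definition half_plane :: "(real \<times> real) set" where
  "half_plane = {x. 0 \<le> snd x}"

definition chart :: "'a topology \<Rightarrow> 'a set \<Rightarrow> ('a \<Rightarrow> real \<times> real) \<Rightarrow> bool" where
  "chart S U \<phi> \<longleftrightarrow> openin S U \<and>
     (\<exists>V. openin (top_of_set half_plane) V \<and> homeomorphic_map (subtopology S U) (top_of_set V) \<phi>)"

text \<open>Surfaces are neither assumed connected nor orientable, and their boundary may be empty.\<close>

definition topological_surface :: "'a topology \<Rightarrow> bool" where
  "topological_surface S \<longleftrightarrow> Hausdorff_space S \<and> second_countable S \<and>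
     (\<forall>p \<in> topspace S. \<exists>U \<phi>. chart S U \<phi> \<and> p \<in> U)"

definition surface_boundary :: "'a topology \<Rightarrow> 'a set" where
  "surface_boundary S = {p. \<exists>U \<phi>. chart S U \<phi> \<and> p \<in> U \<and> snd (\<phi> p) = 0}"

text \<open>Partial derivatives relative to a domain \<open>D\<close>. They are used only for relatively open subsets
  of \<^term>\<open>half_plane\<close>, on which derivatives within \<open>D\<close> are unique, also at points of the
  boundary line.\<close>

definition partial_u ::
    "(real \<times> real) set \<Rightarrow> (real \<times> real \<Rightarrow> 'b::real_normed_vector) \<Rightarrow> real \<times> real \<Rightarrow> 'b" where
  "partial_u D f x = frechet_derivative f (at x within D) (1, 0)"

definition partial_v ::
    "(real \<times> real) set \<Rightarrow> (real \<times> real \<Rightarrow> 'b::real_normed_vector) \<Rightarrow> real \<times> real \<Rightarrow> 'b" where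
  "partial_v D f x = frechet_derivative f (at x within D) (0, 1)"

fun Ck_on :: "nat \<Rightarrow> (real \<times> real) set \<Rightarrow> (real \<times> real \<Rightarrow> 'b::real_normed_vector) \<Rightarrow> bool" where
  "Ck_on 0 D f \<longleftrightarrow> continuous_on D f"
| "Ck_on (Suc k) D f \<longleftrightarrow>
     f differentiable_on D \<and> Ck_on k D (partial_u D f) \<and> Ck_on k D (partial_v D f)"

definition smooth_on :: "(real \<times> real) set \<Rightarrow> (real \<times> real \<Rightarrow> 'b::real_normed_vector) \<Rightarrow> bool" where
  "smooth_on D f \<longleftrightarrow> (\<forall>k. Ck_on k D f)"

definition smooth_atlas :: "'a topology \<Rightarrow> ('a set \<times> ('a \<Rightarrow> real \<times> real)) set \<Rightarrow> bool" where
  "smooth_atlas S A \<longleftrightarrow>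
     (\<forall>(U, \<phi>) \<in> A. chart S U \<phi>) \<and> (\<Union>(U, \<phi>) \<in> A. U) = topspace S \<and>
     (\<forall>(U, \<phi>) \<in> A. \<forall>(V, \<psi>) \<in> A. smooth_on (\<phi> ` (U \<inter> V)) (\<psi> \<circ> inv_into U \<phi>))"

definition smooth_surface :: "'a topology \<Rightarrow> ('a set \<times> ('a \<Rightarrow> real \<times> real)) set \<Rightarrow> bool" where
  "smooth_surface S A \<longleftrightarrow> topological_surface S \<and> smooth_atlas S A"

section \<open>Minimal immersions into \<open>\<bbbH>\<^sup>2 \<times> \<real>\<close>\<close>

definition regular_patch :: "(real \<times> real) set \<Rightarrow> (real \<times> real \<Rightarrow> complex \<times> real) \<Rightarrow> bool" where
  "regular_patch D f \<longleftrightarrow> f ` D \<subseteq> H2R \<and> smooth_on D f \<and>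
     (\<forall>x \<in> D. inj (frechet_derivative f (at x within D)))"

definition unit_normal ::
    "(real \<times> real) set \<Rightarrow> (real \<times> real \<Rightarrow> complex \<times> real) \<Rightarrow> real \<times> real \<Rightarrow> complex \<times> real \<Rightarrow> bool" where
  "unit_normal D f x N \<longleftrightarrow> metric (f x) N N = 1 \<and>
     metric (f x) N (partial_u D f x) = 0 \<and> metric (f x) N (partial_v D f x) = 0"

text \<open>Mean curvature with respect to the normal \<open>N\<close>: half the trace of the second fundamental form
  \<open>(l, m, n)\<close> relative to the first fundamental form \<open>(E, F, G)\<close>.\<close>

definition mean_curvature ::
    "(real \<times> real) set \<Rightarrow> (real \<times> real \<Rightarrow> complex \<times> real) \<Rightarrow> real \<times> real \<Rightarrow> complex \<times> real \<Rightarrow> real" where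
  "mean_curvature D f x N =
     (let p = f x; fu = partial_u D f x; fv = partial_v D f x;
          E = metric p fu fu; F = metric p fu fv; G = metric p fv fv;
          l = metric p (partial_u D (partial_u D f) x + christoffel p fu fu) N;
          m = metric p (partial_v D (partial_u D f) x + christoffel p fu fv) N;
          n = metric p (partial_v D (partial_v D f) x + christoffel p fv fv) N
      in (l * G - 2 * m * F + n * E) / (2 * (E * G - F\<^sup>2)))"

definition minimal_patch :: "(real \<times> real) set \<Rightarrow> (real \<times> real \<Rightarrow> complex \<times> real) \<Rightarrow> bool" where
  "minimal_patch D f \<longleftrightarrow> regular_patch D f \<and>
     (\<forall>x \<in> D. \<forall>N. unit_normal D f x N \<longrightarrow> mean_curvature D f x N = 0)"

definition minimal_immersion ::
    "'a topology \<Rightarrow> ('a set \<times> ('a \<Rightarrow> real \<times> real)) set \<Rightarrow> ('a \<Rightarrow> complex \<times> real) \<Rightarrow> bool" where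
  "minimal_immersion S A X \<longleftrightarrow> smooth_surface S A \<and>
     (\<forall>(U, \<phi>) \<in> A. minimal_patch (\<phi> ` U) (X \<circ> inv_into U \<phi>))"

text \<open>The surface \<open>M\<close> is the immersion \<open>X\<close> of \<open>S\<close>; its finite boundary is the
  image of \<^term>\<open>surface_boundary S\<close>, and may be nonempty.\<close>

definition properly_immersed_minimal_surface ::
    "'a topology \<Rightarrow> ('a set \<times> ('a \<Rightarrow> real \<times> real)) set \<Rightarrow> ('a \<Rightarrow> complex \<times> real) \<Rightarrow> bool" where
  "properly_immersed_minimal_surface S A X \<longleftrightarrow> minimal_immersion S A X \<and>
     continuous_map S (top_of_set H2R) X \<and> proper_map S (top_of_set H2R) X"

text \<open>\<open>C\<^sup>1\<close> curves in \<open>S\<close>: for an immersion \<open>X\<close>, a continuous curve \<open>c\<close>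
  is \<open>C\<^sup>1\<close> if and only if \<open>X \<circ> c\<close> is.\<close>

definition C1_curve :: "'a topology \<Rightarrow> ('a \<Rightarrow> complex \<times> real) \<Rightarrow> (real \<Rightarrow> 'a) \<Rightarrow> bool" where
  "C1_curve S X c \<longleftrightarrow> pathin S c \<and> (X \<circ> c) differentiable_on {0..1} \<and>
     continuous_on {0..1} (\<lambda>s. vector_derivative (X \<circ> c) (at s within {0..1}))"

definition curve_length :: "('a \<Rightarrow> complex \<times> real) \<Rightarrow> (real \<Rightarrow> 'a) \<Rightarrow> real" where
  "curve_length X c = integral {0..1} (\<lambda>s.
     let v = vector_derivative (X \<circ> c) (at s within {0..1}) in sqrt (metric (X (c s)) v v))"

text \<open>\<open>d(p, q) < e\<close> for the distance \<open>d\<close> of the induced Riemannian metric, which is the infimum of the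
  lengths of curves from \<open>p\<close> to \<open>q\<close> (infinite if there are none).\<close>

definition induced_dist_less ::
    "'a topology \<Rightarrow> ('a \<Rightarrow> complex \<times> real) \<Rightarrow> 'a \<Rightarrow> 'a \<Rightarrow> real \<Rightarrow> bool" where
  "induced_dist_less S X p q e \<longleftrightarrow>
     (\<exists>c. C1_curve S X c \<and> c 0 = p \<and> c 1 = q \<and> curve_length X c < e)"

text \<open>By convention a complete surface has no boundary.\<close>

definition complete_surface :: "'a topology \<Rightarrow> ('a \<Rightarrow> complex \<times> real) \<Rightarrow> bool" where
  "complete_surface S X \<longleftrightarrow> surface_boundary S = {} \<and>
     (\<forall>\<sigma>::nat \<Rightarrow> 'a. range \<sigma> \<subseteq> topspace S \<and>
        (\<forall>e>0. \<exists>n0. \<forall>i\<ge>n0. \<forall>j\<ge>n0. induced_dist_less S X (\<sigma> i) (\<sigma> j) e)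
        \<longrightarrow> (\<exists>p \<in> topspace S. \<forall>e>0. \<exists>n0. \<forall>i\<ge>n0. induced_dist_less S X (\<sigma> i) p e))"

section \<open>Behaviour at infinity\<close>

definition asymptotic_boundary :: "(complex \<times> real) set \<Rightarrow> (complex \<times> real) set" where
  "asymptotic_boundary M = {q \<in> H2R_infinity. \<exists>\<sigma>. range \<sigma> \<subseteq> M \<and> \<sigma> \<longlonglongrightarrow> q}"

text \<open>\<open>M \<union> \<Gamma>\<close> is a continuous surface with boundary: the disjoint union of \<open>S\<close> and
  \<open>\<Gamma>\<close> is the point set of a topological surface \<open>T\<close> with boundary, whose boundary contains
  \<open>\<Gamma>\<close>, and \<open>X\<close> extended by the identity of \<open>\<Gamma>\<close> is continuous on \<open>T\<close>.
  As \<open>M\<close> may have self-intersections, \<open>T\<close> need not be a subspace of \<^term>\<open>H2R_closure\<close>. Properness of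
  the extension expresses that \<open>M \<union> \<Gamma>\<close> is taken in \<^term>\<open>H2R_closure\<close>: if \<open>X\<close> is injective, then
  the extension is a homeomorphism of \<open>T\<close> onto \<open>M \<union> \<Gamma>\<close> with the subspace topology.\<close>

definition continuous_surface_with ::
    "'a topology \<Rightarrow> ('a \<Rightarrow> complex \<times> real) \<Rightarrow> (complex \<times> real) set \<Rightarrow> bool" where
  "continuous_surface_with S X \<Gamma> \<longleftrightarrow>
     (\<exists>T :: ('a + complex \<times> real) topology.
        topspace T = topspace S <+> \<Gamma> \<and> topological_surface T \<and>
        embedding_map S T Inl \<and> embedding_map (top_of_set \<Gamma>) T Inr \<and>
        Inr ` \<Gamma> \<subseteq> surface_boundary T \<and>
        continuous_map T (top_of_set H2R_closure) (case_sum X id) \<and>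
        proper_map T (top_of_set H2R_closure) (case_sum X id))"

text \<open>The singular 1-simplex of a path: a point of the standard 1-simplex has coordinates
  \<open>x 0 = 1 - s\<close> and \<open>x 1 = s\<close>.\<close>

definition path_simplex :: "(real \<Rightarrow> 'b) \<Rightarrow> (nat \<Rightarrow> real) \<Rightarrow> 'b" where
  "path_simplex g = restrict (\<lambda>x. g (x 1)) (standard_simplex 1)"

definition null_homologous_loop :: "'b::topological_space set \<Rightarrow> (real \<Rightarrow> 'b) \<Rightarrow> bool" where
  "null_homologous_loop W g \<longleftrightarrow> path g \<and> path_image g \<subseteq> W \<and> pathfinish g = pathstart g \<and>
     homologous_rel 1 (top_of_set W) {} (frag_of (path_simplex g)) 0"

definition null_homologous_Jordan_curve ::
    "'b::topological_space set \<Rightarrow> 'b set \<Rightarrow> bool" where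
  "null_homologous_Jordan_curve W \<Gamma> \<longleftrightarrow>
     (\<exists>g. simple_path g \<and> pathfinish g = pathstart g \<and> path_image g = \<Gamma> \<and>
          null_homologous_loop W g)"

end

theory Submission
  imports Defs
begin

text \<open>
  The proof compares the surface \<open>M\<close> with functions \<open>\<Phi> (z, t) = C z * f t\<close> on \<open>\<bbbH>\<^sup>2 \<times> \<real>\<close>, where
  \<open>C\<close> is the restriction to the hyperboloid model of a linear functional of Minkowski space. Such a
  \<open>C\<close> satisfies \<open>Hess C = C g\<close> and \<open>|grad C|\<^sup>2 = C\<^sup>2 + m\<close> for a constant \<open>m\<close>: up to scaling it is
  the hyperbolic cosine of the distance to a point (\<open>m < 0\<close>), the exponential of a Busemann function
  (\<open>m = 0\<close>) or the hyperbolic sine of the signed distance to a geodesic (\<open>m > 0\<close>). If \<open>\<Phi>\<close>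
  restricted to \<open>M\<close> has a local minimum, then its gradient is normal to \<open>M\<close> there, hence the Laplacian
  of the restriction is determined by the values of \<open>C\<close>, \<open>f\<close>, \<open>f'\<close>, \<open>f''\<close>; for \<open>f > 0\<close> and
  nonzero gradient its sign is that of \<open>C ((C\<^sup>2 + m) f (f + f'') - 2 m f'\<^sup>2)\<close>. So a minimum is impossible where this
  expression is negative (\<open>minimal_surface_minimum\<close>). Everything about minimal surfaces is used
  through this minimum principle, which only concerns the set \<open>M\<close> and its finite boundary
  (locale \<open>minimal_set\<close>).

  Width \<open>\<pi>\<close> enters through \<open>f = cos\<close>, for which \<open>f + f'' = 0\<close>. With \<open>f t = cos (a t)\<close>, \<open>a > 1\<close>, and
  \<open>C\<close> the hyperbolic cosine of the distance to a point \<open>c\<close>, no minimum is possible outside a large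
  ball about \<open>c\<close> as long as \<open>f\<close> is bounded away from zero: the level sets behave like catenoids of height less than \<open>\<pi>\<close>, and \<open>M\<close> cannot touch
  one from outside. A ball of fixed hyperbolic radius is tiny near infinity, so it
  can be slid, inside an arbitrarily small neighbourhood of a vertical line at infinity, from a place
  without points of \<open>M\<close> to any point of \<open>M\<close> that is close to that line. Therefore, in a window of height
  less than \<open>\<pi>\<close> whose two end points are not in \<open>\<Gamma>\<close>, the asymptotic boundary cannot simply end at a
  vertical line (\<open>no_free_end\<close>). Here the finite boundary has to stay away from
  \<open>\<Gamma>\<close>, which is clear for complete surfaces.

  Since \<open>\<Gamma>\<close> is null-homologous, the angle along it lifts to a closed function, which attains a maximum.
  On the vertical line over the maximum, the points of \<open>\<Gamma>\<close> at which the lifted angle is maximal form a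
  compact set \<open>E\<close>, and those lying on lower sheets of the universal cover form a disjoint compact set
  \<open>Z\<close>. Near \<open>E\<close>, the curve ends at that line. If \<open>\<Gamma>\<close> lies in an open slab of width \<open>\<pi>\<close>, or if
  \<open>Z\<close> is nonempty, there is a window of height less than \<open>\<pi>\<close> around a point of \<open>E\<close> that avoids \<open>Z\<close>, and
  \<open>no_free_end\<close> is contradicted. In the remaining case \<open>Z\<close> is empty, so \<open>\<Gamma>\<close> misses a vertical line;
  then a barrier with \<open>m > 0\<close>, built from a geodesic that cuts off the missed line, and a
  perturbation of \<open>cos\<close> that stays positive on the closed slab show that \<open>M\<close> is empty
  (\<open>empty_if_boundary_misses_vertical_line\<close>).

  When \<open>M\<close> may have finite boundary and \<open>M \<union> \<Gamma>\<close> is a continuous surface, invariance of domain shows that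
  \<open>\<Gamma>\<close> is open in the boundary of this surface, so the finite boundary does not accumulate at \<open>\<Gamma>\<close>
  (\<open>finite_boundary_avoids_ideal_boundary\<close>).
\<close>

section \<open>Second variation along a parametrized surface\<close>

text \<open>The mean value theorem in the first variable turns the second difference into a difference of
  values of \<open>ku\<close>, which differentiability of \<open>ku\<close> at the single point \<open>x\<close> controls.\<close>
lemma mixed_difference_quotient:
  fixes k ku :: "real \<times> real \<Rightarrow> real"
  assumes "r > 0"
    and ku: "\<And>a b. (a, b) \<in> ball x r \<Longrightarrow> ((\<lambda>a. k (a, b)) has_real_derivative ku (a, b)) (at a)"
    and D: "(ku has_derivative (\<lambda>d. fst d * kuu + snd d * kuv)) (at x)"
  shows "((\<lambda>s. (k (x + (s, s)) - k (x + (s, 0)) - k (x + (0, s)) + k x) / s\<^sup>2) \<longlongrightarrow> kuv) (at_right 0)"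
proof -
  obtain x1 x2 where x: "x = (x1, x2)" by (cases x)
  have "\<forall>\<^sub>F s in at_right 0. dist ((k (x + (s, s)) - k (x + (s, 0)) - k (x + (0, s)) + k x) / s\<^sup>2) kuv < e"
    if e: "e > 0" for e
  proof -
    obtain d where d: "d > 0" and dd: "\<And>y. norm (y - x) < d \<Longrightarrow>
        norm (ku y - ku x - (fst (y - x) * kuu + snd (y - x) * kuv)) \<le> e / 4 * norm (y - x)"
      using D e unfolding has_derivative_at_alt by (meson divide_pos_pos zero_less_numeral)
    define \<delta> where "\<delta> = min r d / 2"
    have "\<delta> > 0" using d \<open>r > 0\<close> by (simp add: \<delta>_def)
    have "dist ((k (x + (s, s)) - k (x + (s, 0)) - k (x + (0, s)) + k x) / s\<^sup>2) kuv < e"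
      if s: "0 < s" "s < \<delta>" for s
    proof -
      have bd: "norm ((\<xi>, \<eta>) - x) \<le> (\<xi> - x1) + (\<eta> - x2)" if "x1 \<le> \<xi>" "x2 \<le> \<eta>" for \<xi> \<eta>
        using norm_Pair_le[of "\<xi> - x1" "\<eta> - x2"] that by (simp add: x)
      have inb: "(\<xi>, \<eta>) \<in> ball x r" "norm ((\<xi>, \<eta>) - x) < d"
        if "x1 \<le> \<xi>" "\<xi> \<le> x1 + s" "x2 \<le> \<eta>" "\<eta> \<le> x2 + s" for \<xi> \<eta>
        using bd[of \<xi> \<eta>] that s unfolding \<delta>_def by (auto simp: dist_norm norm_minus_commute)
      have "\<exists>\<xi>. x1 < \<xi> \<and> \<xi> < x1 + s \<and>
          (k (x1 + s, x2 + s) - k (x1 + s, x2)) - (k (x1, x2 + s) - k (x1, x2))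
           = (x1 + s - x1) * (ku (\<xi>, x2 + s) - ku (\<xi>, x2))"
        by (rule MVT2[where f = "\<lambda>a. k (a, x2 + s) - k (a, x2)"
              and f' = "\<lambda>a. ku (a, x2 + s) - ku (a, x2)"])
          (use s in \<open>auto intro!: DERIV_diff ku inb\<close>)
      then obtain \<xi> where xi: "x1 < \<xi>" "\<xi> < x1 + s" and
        eq: "k (x1 + s, x2 + s) - k (x1 + s, x2) - k (x1, x2 + s) + k (x1, x2)
           = s * (ku (\<xi>, x2 + s) - ku (\<xi>, x2))" by auto
      have 1: "\<bar>ku (\<xi>, x2 + s) - ku x - ((\<xi> - x1) * kuu + s * kuv)\<bar> \<le> e / 4 * (2 * s)"
      proof -
        have "norm ((\<xi>, x2 + s) - x) \<le> 2 * s" using bd[of \<xi> "x2 + s"] xi s by auto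
        then have "e / 4 * norm ((\<xi>, x2 + s) - x) \<le> e / 4 * (2 * s)"
          using e by (intro mult_left_mono) auto
        with dd[OF inb(2), of \<xi> "x2 + s"] xi s show ?thesis by (simp add: x)
      qed
      have 2: "\<bar>ku (\<xi>, x2) - ku x - ((\<xi> - x1) * kuu)\<bar> \<le> e / 4 * s"
      proof -
        have "norm ((\<xi>, x2) - x) \<le> s" using bd[of \<xi> "x2"] xi s by auto
        then have "e / 4 * norm ((\<xi>, x2) - x) \<le> e / 4 * s"
          using e by (intro mult_left_mono) auto
        with dd[OF inb(2), of \<xi> "x2"] xi s show ?thesis by (simp add: x)
      qed
      have "\<bar>ku (\<xi>, x2 + s) - ku (\<xi>, x2) - s * kuv\<bar> < e * s"
      proof -
        have "e / 4 * (2 * s) = e * s / 2" "e / 4 * s = e * s / 4" by auto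
        with 1 2 show ?thesis
          using mult_pos_pos[OF e s(1)] unfolding abs_le_iff abs_less_iff by linarith
      qed
      then have "\<bar>(ku (\<xi>, x2 + s) - ku (\<xi>, x2)) / s - kuv\<bar> < e"
        using s by (simp add: abs_less_iff field_simps)
      moreover have "(k (x + (s, s)) - k (x + (s, 0)) - k (x + (0, s)) + k x) / s\<^sup>2
          = (ku (\<xi>, x2 + s) - ku (\<xi>, x2)) / s"
        using eq s by (simp add: x power2_eq_square)
      ultimately show ?thesis by (simp add: dist_real_def)
    qed
    then show ?thesis
      using \<open>\<delta> > 0\<close> by (auto simp: eventually_at_right_field)
  qed
  then show ?thesis by (simp add: tendsto_iff)
qed

text \<open>The second difference is symmetric in the two variables, so both mixed partial derivatives are
  its limit.\<close>
lemma mixed_partials_commute: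
  fixes k ku kv :: "real \<times> real \<Rightarrow> real"
  assumes "r > 0"
    and D: "\<And>y. y \<in> ball x r \<Longrightarrow> (k has_derivative (\<lambda>d. fst d * ku y + snd d * kv y)) (at y)"
    and Du: "(ku has_derivative (\<lambda>d. fst d * kuu + snd d * kuv)) (at x)"
    and Dv: "(kv has_derivative (\<lambda>d. fst d * kvu + snd d * kvv)) (at x)"
  shows "kuv = kvu"
proof -
  define sw where "sw = (\<lambda>y::real\<times>real. (snd y, fst y))"
  have sw_ball: "sw y \<in> ball x r" if "y \<in> ball (sw x) r" for y
    using that by (cases x; cases y) (auto simp: sw_def dist_Pair_Pair add.commute)
  have 1: "((\<lambda>s. (k (x + (s, s)) - k (x + (s, 0)) - k (x + (0, s)) + k x) / s\<^sup>2) \<longlongrightarrow> kuv) (at_right 0)"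
  proof (rule mixed_difference_quotient[OF \<open>r > 0\<close> _ Du])
    fix a b assume "(a, b) \<in> ball x r"
    have "((\<lambda>a. (a, b)) has_derivative (\<lambda>d. (d, 0))) (at a)"
      by (auto intro!: derivative_eq_intros)
    from has_derivative_compose[OF this D[OF \<open>(a, b) \<in> ball x r\<close>]] show "((\<lambda>a. k (a, b)) has_real_derivative ku (a, b)) (at a)"
      by (simp add: has_field_derivative_def mult_commute_abs)
  qed
  have 2: "((\<lambda>s. ((k \<circ> sw) (sw x + (s, s)) - (k \<circ> sw) (sw x + (s, 0)) - (k \<circ> sw) (sw x + (0, s)) + (k \<circ> sw) (sw x)) / s\<^sup>2) \<longlongrightarrow> kvu) (at_right 0)"
  proof (rule mixed_difference_quotient[OF \<open>r > 0\<close>, where ku = "kv \<circ> sw" and kuu = kvv])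
    fix a b assume "(a, b) \<in> ball (sw x) r"
    from sw_ball[OF this] have "(b, a) \<in> ball x r" by (simp add: sw_def)
    have "((\<lambda>a. (b, a)) has_derivative (\<lambda>d. (0, d))) (at a)"
      by (auto intro!: derivative_eq_intros)
    from has_derivative_compose[OF this D[OF \<open>(b, a) \<in> ball x r\<close>]] show "((\<lambda>a. (k \<circ> sw) (a, b)) has_real_derivative (kv \<circ> sw) (a, b)) (at a)"
      by (simp add: has_field_derivative_def sw_def mult_commute_abs)
  next
    have "(sw has_derivative sw) (at (sw x))"
      unfolding sw_def by (intro has_derivative_Pair has_derivative_fst has_derivative_snd has_derivative_ident)
    moreover have "(kv has_derivative (\<lambda>d. fst d * kvu + snd d * kvv)) (at (sw (sw x)))"
      using Dv by (simp add: sw_def)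
    ultimately have "((\<lambda>y. kv (sw y)) has_derivative (\<lambda>d. fst (sw d) * kvu + snd (sw d) * kvv)) (at (sw x))"
      by (rule has_derivative_compose)
    then show "(kv \<circ> sw has_derivative (\<lambda>d. fst d * kvv + snd d * kvu)) (at (sw x))"
      by (simp add: sw_def o_def add.commute)
  qed
  have "((\<lambda>s. (k (x + (s, s)) - k (x + (s, 0)) - k (x + (0, s)) + k x) / s\<^sup>2) \<longlongrightarrow> kvu) (at_right 0)"
    using 2 by (cases x) (simp add: sw_def algebra_simps)
  with 1 show ?thesis
    by (rule tendsto_unique[rotated]) simp
qed

lemma second_derivative_test:
  fixes h h' :: "real \<Rightarrow> real"
  assumes "\<delta> > 0"
    and h: "\<And>s. \<bar>s\<bar> < \<delta> \<Longrightarrow> (h has_real_derivative h' s) (at s)"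
    and h2: "(h' has_real_derivative l) (at 0)"
    and min: "\<And>s. \<bar>s\<bar> < \<delta> \<Longrightarrow> h 0 \<le> h s"
  shows "h' 0 = 0" "l \<ge> 0"
proof -
  show 0: "h' 0 = 0"
    by (rule DERIV_local_min[OF h \<open>\<delta> > 0\<close>]) (use min \<open>\<delta> > 0\<close> in auto)
  show "l \<ge> 0"
  proof (rule ccontr)
    assume "\<not> l \<ge> 0"
    then obtain d where d: "d > 0" "\<And>s. 0 < s \<Longrightarrow> s < d \<Longrightarrow> h' s < h' 0"
      using DERIV_neg_dec_right[OF h2] by auto
    define s where "s = min d \<delta> / 2"
    have s: "0 < s" "s < d" "s < \<delta>" using d \<open>\<delta> > 0\<close> by (auto simp: s_def)
    have "\<exists>z. 0 < z \<and> z < s \<and> h s - h 0 = (s - 0) * h' z"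
      by (rule MVT2[OF \<open>0 < s\<close>]) (use s h in auto)
    then obtain z where z: "0 < z" "z < s" "h s - h 0 = s * h' z" by auto
    have "h' z < 0" using d(2)[of z] z s 0 by auto
    then have "h s < h 0" using z s by (smt (verit) mult_pos_neg)
    then show False using min[of s] s by auto
  qed
qed


text \<open>The first- and second-order conditions for a minimum of \<open>\<Phi> \<circ> X\<close>, tested along all straight
  lines of the parameter domain; \<open>G\<close> is the gradient field of \<open>\<Phi>\<close>. The second
  partials of \<open>X\<close> enter only through their inner products with \<open>G\<close>, so the symmetry of mixed
  partials of real functions suffices.\<close>
lemma second_variation_at_minimum:
  fixes X U V :: "real \<times> real \<Rightarrow> 'b::real_inner" and \<Phi> :: "'b \<Rightarrow> real"
  assumes "r > 0" and "open Y" "X ` ball x r \<subseteq> Y"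
    and X: "\<And>y. y \<in> ball x r \<Longrightarrow> (X has_derivative (\<lambda>d. fst d *\<^sub>R U y + snd d *\<^sub>R V y)) (at y)"
    and U: "(U has_derivative (\<lambda>d. fst d *\<^sub>R uu + snd d *\<^sub>R uv)) (at x)"
    and V: "(V has_derivative (\<lambda>d. fst d *\<^sub>R vu + snd d *\<^sub>R vv)) (at x)"
    and \<Phi>: "\<And>p. p \<in> Y \<Longrightarrow> (\<Phi> has_derivative (\<lambda>q. G p \<bullet> q)) (at p)"
    and G: "(G has_derivative G') (at (X x))"
    and min: "\<And>y. y \<in> ball x r \<Longrightarrow> \<Phi> (X x) \<le> \<Phi> (X y)"
  shows "G (X x) \<bullet> U x = 0" "G (X x) \<bullet> V x = 0"
    and "0 \<le> G' (\<alpha> *\<^sub>R U x + \<beta> *\<^sub>R V x) \<bullet> (\<alpha> *\<^sub>R U x + \<beta> *\<^sub>R V x)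
         + G (X x) \<bullet> (\<alpha>\<^sup>2 *\<^sub>R uu + (2 * \<alpha> * \<beta>) *\<^sub>R uv + \<beta>\<^sup>2 *\<^sub>R vv)"
proof -
  have comm: "G (X x) \<bullet> uv = G (X x) \<bullet> vu"
  proof (rule mixed_partials_commute[OF \<open>r > 0\<close>])
    show "((\<lambda>y. G (X x) \<bullet> X y) has_derivative (\<lambda>d. fst d * (G (X x) \<bullet> U y) + snd d * (G (X x) \<bullet> V y))) (at y)"
      if "y \<in> ball x r" for y
      using has_derivative_inner_right[OF X[OF that], of "G (X x)"] by (simp add: inner_add_right)
    show "((\<lambda>y. G (X x) \<bullet> U y) has_derivative (\<lambda>d. fst d * (G (X x) \<bullet> uu) + snd d * (G (X x) \<bullet> uv))) (at x)"
      using has_derivative_inner_right[OF U, of "G (X x)"] by (simp add: inner_add_right)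
    show "((\<lambda>y. G (X x) \<bullet> V y) has_derivative (\<lambda>d. fst d * (G (X x) \<bullet> vu) + snd d * (G (X x) \<bullet> vv))) (at x)"
      using has_derivative_inner_right[OF V, of "G (X x)"] by (simp add: inner_add_right)
  qed
  have main: "G (X x) \<bullet> (\<alpha> *\<^sub>R U x + \<beta> *\<^sub>R V x) = 0 \<and>
      0 \<le> G' (\<alpha> *\<^sub>R U x + \<beta> *\<^sub>R V x) \<bullet> (\<alpha> *\<^sub>R U x + \<beta> *\<^sub>R V x)
         + G (X x) \<bullet> (\<alpha>\<^sup>2 *\<^sub>R uu + (2 * \<alpha> * \<beta>) *\<^sub>R uv + \<beta>\<^sup>2 *\<^sub>R vv)" for \<alpha> \<beta>
  proof -
    define l where "l = (\<lambda>s::real. x + s *\<^sub>R (\<alpha>, \<beta>))"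
    define W where "W = (\<lambda>y. \<alpha> *\<^sub>R U y + \<beta> *\<^sub>R V y)"
    define n where "n = norm (\<alpha>, \<beta>) + 1"
    have n: "n > 0" by (simp add: n_def add_nonneg_pos)
    define \<delta> where "\<delta> = r / n"
    have "\<delta> > 0" using n \<open>r > 0\<close> by (simp add: \<delta>_def)
    have l_ball: "l s \<in> ball x r" if "\<bar>s\<bar> < \<delta>" for s
    proof -
      have "\<bar>s\<bar> * norm (\<alpha>, \<beta>) \<le> \<bar>s\<bar> * n" by (intro mult_left_mono) (auto simp: n_def)
      also have "\<dots> < r" using that n by (simp add: \<delta>_def field_simps)
      finally show ?thesis by (simp add: l_def dist_norm del: scaleR_Pair)
    qed
    have l0: "l 0 = x" by (simp add: l_def prod_eq_iff)
    have l: "(l has_derivative (\<lambda>s. s *\<^sub>R (\<alpha>, \<beta>))) (at s)" for s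
      unfolding l_def by (auto intro!: derivative_eq_intros)
    have Xl: "((\<lambda>s. X (l s)) has_derivative (\<lambda>s. s *\<^sub>R W (l s0))) (at s0)" if "\<bar>s0\<bar> < \<delta>" for s0
      using has_derivative_compose[OF l X[OF l_ball[OF that]]] by (simp add: W_def algebra_simps)
    have h: "((\<lambda>s. \<Phi> (X (l s))) has_real_derivative G (X (l s0)) \<bullet> W (l s0)) (at s0)" if "\<bar>s0\<bar> < \<delta>" for s0
    proof -
      have "X (l s0) \<in> Y" using l_ball[OF that] assms(3) by blast
      from has_derivative_compose[OF Xl[OF that] \<Phi>[OF this]] show ?thesis
        by (simp add: has_field_derivative_def mult_commute_abs)
    qed
    have Gl: "((\<lambda>s. G (X (l s))) has_derivative (\<lambda>s. G' (s *\<^sub>R W x))) (at 0)"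
      using has_derivative_compose[OF Xl[of 0], unfolded l0, OF _ G] \<open>\<delta> > 0\<close> by simp
    have lin: "G' (s *\<^sub>R v) = s *\<^sub>R G' v" for s v
      using has_derivative_linear[OF G] by (rule linear_scale)
    have Ul: "((\<lambda>s. U (l s)) has_derivative (\<lambda>s. s *\<^sub>R (\<alpha> *\<^sub>R uu + \<beta> *\<^sub>R uv))) (at 0)"
      using has_derivative_compose[OF l[of 0], unfolded l0, OF U] by (simp add: algebra_simps)
    have Vl: "((\<lambda>s. V (l s)) has_derivative (\<lambda>s. s *\<^sub>R (\<alpha> *\<^sub>R vu + \<beta> *\<^sub>R vv))) (at 0)"
      using has_derivative_compose[OF l[of 0], unfolded l0, OF V] by (simp add: algebra_simps)
    define W2 where "W2 = \<alpha> *\<^sub>R (\<alpha> *\<^sub>R uu + \<beta> *\<^sub>R uv) + \<beta> *\<^sub>R (\<alpha> *\<^sub>R vu + \<beta> *\<^sub>R vv)"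
    have Wl: "((\<lambda>s. W (l s)) has_derivative (\<lambda>s. s *\<^sub>R W2)) (at 0)"
      unfolding W_def W2_def
      by (rule has_derivative_eq_rhs, rule has_derivative_add[OF has_derivative_scaleR_right[OF Ul] has_derivative_scaleR_right[OF Vl]])
         (simp add: algebra_simps)
    have h2: "((\<lambda>s. G (X (l s)) \<bullet> W (l s)) has_real_derivative (G (X x) \<bullet> W2 + G' (W x) \<bullet> W x)) (at 0)"
      using has_derivative_inner[OF Gl Wl]
      by (simp add: has_field_derivative_def l0 lin mult_commute_abs flip: distrib_left)
    have m: "\<Phi> (X (l 0)) \<le> \<Phi> (X (l s))" if "\<bar>s\<bar> < \<delta>" for s
      using min[OF l_ball[OF that]] by (simp add: l0)
    note t = second_derivative_test[OF \<open>\<delta> > 0\<close> h h2 m]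
    have "G (X x) \<bullet> W2 = G (X x) \<bullet> (\<alpha>\<^sup>2 *\<^sub>R uu + (2 * \<alpha> * \<beta>) *\<^sub>R uv + \<beta>\<^sup>2 *\<^sub>R vv)"
      by (simp add: W2_def inner_add_right comm power2_eq_square algebra_simps)
    with t show ?thesis by (simp add: W_def l0 add.commute)
  qed
  show "G (X x) \<bullet> U x = 0" using main[of 1 0] by simp
  show "G (X x) \<bullet> V x = 0" using main[of 0 1] by simp
  show "0 \<le> G' (\<alpha> *\<^sub>R U x + \<beta> *\<^sub>R V x) \<bullet> (\<alpha> *\<^sub>R U x + \<beta> *\<^sub>R V x)
         + G (X x) \<bullet> (\<alpha>\<^sup>2 *\<^sub>R uu + (2 * \<alpha> * \<beta>) *\<^sub>R uv + \<beta>\<^sup>2 *\<^sub>R vv)"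
    using main by blast
qed

section \<open>Linear functions on the hyperboloid\<close>

text \<open>With \<open>x z = (1 + |z|\<^sup>2, 2 z) / (1 - |z|\<^sup>2)\<close> the point of the hyperboloid that corresponds to
  \<open>z\<close> in the disk, this is the linear functional \<open>x \<mapsto> w \<bullet> (x\<^sub>1, x\<^sub>2) - h x\<^sub>0\<close>.\<close>
definition hyp_linear :: "complex \<Rightarrow> real \<Rightarrow> complex \<Rightarrow> real" where
  "hyp_linear w h z = (2 * (z \<bullet> w) - h * (1 + z \<bullet> z)) / (1 - z \<bullet> z)"

text \<open>The gradient for the Euclidean metric of the disk, not for the hyperbolic one.\<close>
definition hyp_linear_grad :: "complex \<Rightarrow> real \<Rightarrow> complex \<Rightarrow> complex" where
  "hyp_linear_grad w h z = conformal_factor z *\<^sub>R (w + (hyp_linear w h z - h) *\<^sub>R z)"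

lemma conformal_factor_inner: "conformal_factor z = 2 / (1 - z \<bullet> z)"
  by (simp add: conformal_factor_def dot_square_norm)

lemma inner_less_1: "z \<in> ball 0 1 \<Longrightarrow> z \<bullet> z < 1" for z :: complex
  by (simp add: dot_square_norm power_less_one_iff abs_square_less_1)

lemma conformal_factor_pos: "z \<in> ball 0 1 \<Longrightarrow> 0 < conformal_factor z"
  using inner_less_1[of z] by (simp add: conformal_factor_inner)

lemma hyp_linear_has_derivative:
  assumes "z \<in> ball 0 1"
  shows "(hyp_linear w h has_derivative (\<lambda>a. hyp_linear_grad w h z \<bullet> a)) (at z)"
proof -
  define u where "u = 1 - z \<bullet> z"
  have u: "u > 0" using inner_less_1[OF assms] by (simp add: u_def)
  have "(hyp_linear w h has_derivative
      (\<lambda>a. ((2 * (a \<bullet> w) - h * (2 * (z \<bullet> a))) * u + (2 * (z \<bullet> w) - h * (1 + z \<bullet> z)) * (2 * (z \<bullet> a))) / (u * u))) (at z)"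
    unfolding hyp_linear_def[abs_def]
    using u by (auto intro!: derivative_eq_intros simp: u_def inner_commute)
  moreover have "((2 * (a \<bullet> w) - h * (2 * (z \<bullet> a))) * u + (2 * (z \<bullet> w) - h * (1 + z \<bullet> z)) * (2 * (z \<bullet> a))) / (u * u)
      = hyp_linear_grad w h z \<bullet> a" for a
  proof -
    have eq: "((2 * aw - h * (2 * za)) * u + n * (2 * za)) / (u * u) = 2 / u * (aw + (n / u - h) * za)"
      for aw za n :: real
      using u by (simp add: divide_simps) (simp add: algebra_simps)
    show ?thesis
      unfolding eq by (simp add: hyp_linear_grad_def hyp_linear_def conformal_factor_inner inner_add_left
        inner_commute[of w a] flip: u_def)
  qed
  ultimately show ?thesis by simp
qed

lemma conformal_factor_has_derivative:
  assumes "z \<in> ball 0 1"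
  shows "(conformal_factor has_derivative (\<lambda>a. (conformal_factor z)\<^sup>2 * (z \<bullet> a))) (at z)"
proof -
  have u: "z \<bullet> z \<noteq> 1" using inner_less_1[OF assms] by simp
  have "((\<lambda>z. 2 / (1 - z \<bullet> z)) has_derivative (\<lambda>a. (2 * (2 * (z \<bullet> a))) / ((1 - z \<bullet> z) * (1 - z \<bullet> z)))) (at z)"
    using u by (auto intro!: derivative_eq_intros simp: inner_commute)
  then show ?thesis
    by (simp add: conformal_factor_inner[abs_def] power2_eq_square mult_ac)
qed

definition hyp_linear_grad_deriv :: "complex \<Rightarrow> real \<Rightarrow> complex \<Rightarrow> complex \<Rightarrow> complex" where
  "hyp_linear_grad_deriv w h z a =
     ((conformal_factor z)\<^sup>2 * (z \<bullet> a)) *\<^sub>R (w + (hyp_linear w h z - h) *\<^sub>R z)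
     + conformal_factor z *\<^sub>R ((hyp_linear_grad w h z \<bullet> a) *\<^sub>R z + (hyp_linear w h z - h) *\<^sub>R a)"

lemma hyp_linear_grad_has_derivative:
  assumes "z \<in> ball 0 1"
  shows "(hyp_linear_grad w h has_derivative hyp_linear_grad_deriv w h z) (at z)"
proof -
  note [derivative_intros] = has_derivative_compose[OF _ hyp_linear_has_derivative]
    has_derivative_compose[OF _ conformal_factor_has_derivative]
  show ?thesis
    unfolding hyp_linear_grad_def[abs_def] hyp_linear_grad_deriv_def[abs_def]
    using assms
    by (auto intro!: derivative_eq_intros simp: algebra_simps hyp_linear_grad_def)
qed

text \<open>The right-hand side is \<open>C\<^sup>2 + m\<close> up to the conformal factor: the norm of the tangential part
  of the vector \<open>(h, w)\<close> of Minkowski space, whose Lorentz square is \<open>m\<close>.\<close>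
lemma hyp_linear_grad_norm:
  assumes "z \<in> ball 0 1"
  shows "hyp_linear_grad w h z \<bullet> hyp_linear_grad w h z
    = (conformal_factor z)\<^sup>2 * ((hyp_linear w h z)\<^sup>2 + (w \<bullet> w - h\<^sup>2))"
proof -
  define u where "u = 1 - z \<bullet> z"
  define C where "C = hyp_linear w h z"
  have u: "u > 0" using inner_less_1[OF assms] by (simp add: u_def)
  have zz: "z \<bullet> z = 1 - u" by (simp add: u_def)
  have zw: "z \<bullet> w = (C * u + h * (2 - u)) / 2"
    using u unfolding C_def hyp_linear_def zz by simp
  have "(w + (C - h) *\<^sub>R z) \<bullet> (w + (C - h) *\<^sub>R z) = w \<bullet> w + 2 * (C - h) * (z \<bullet> w) + (C - h)\<^sup>2 * (z \<bullet> z)"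
    by (simp add: inner_add_left inner_add_right inner_commute power2_eq_square algebra_simps)
  also have "\<dots> = C\<^sup>2 + (w \<bullet> w - h\<^sup>2)"
    unfolding zz zw by (simp add: field_simps power2_eq_square)
  finally show ?thesis
    by (simp add: hyp_linear_grad_def power2_eq_square flip: C_def)
qed

text \<open>The last term is the correction by the Christoffel symbols, so this says that the covariant
  Hessian of a linear function is the function times the hyperbolic metric.\<close>
lemma hyp_linear_hessian:
  assumes "z \<in> ball 0 1"
  shows "hyp_linear_grad_deriv w h z a \<bullet> a =
    hyp_linear w h z * (conformal_factor z)\<^sup>2 * (a \<bullet> a)
    + hyp_linear_grad w h z \<bullet> fst (christoffel (z, t) (a, r) (a, r))"
proof -
  define u where "u = 1 - z \<bullet> z"
  define C where "C = hyp_linear w h z"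
  have u: "u > 0" using inner_less_1[OF assms] by (simp add: u_def)
  have zz: "z \<bullet> z = 1 - u" by (simp add: u_def)
  have zw: "z \<bullet> w = (C * u + h * (2 - u)) / 2"
    using u unfolding C_def hyp_linear_def zz by simp
  have l: "conformal_factor z = 2 / u" by (simp add: conformal_factor_inner u_def)
  have g: "hyp_linear_grad w h z = (2 / u) *\<^sub>R (w + (C - h) *\<^sub>R z)"
    by (simp add: hyp_linear_grad_def l C_def)
  have wz: "w \<bullet> z = z \<bullet> w" "w \<bullet> a = a \<bullet> w" "z \<bullet> a = a \<bullet> z" by (simp_all add: inner_commute)
  show ?thesis
  proof -
    \<comment> \<open>Keeping \<open>k = 2 / u\<close> abstract leaves a polynomial identity modulo \<open>k u = 2\<close>.\<close>
    define k where "k = 2 / u"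
    have ku: "k * u = 2" using u by (simp add: k_def)
    have eq: "k * k * az * (aw + (C - h) * az) + k * (k * (aw + (C - h) * az) * az + (C - h) * aa)
      = C * (k * k) * aa + k * (az * (k * (aw + (C - h) * az)) + az * (k * (aw + (C - h) * az))
          - aa * (k * (z \<bullet> w + (C - h) * (1 - u))))" (is "?l = ?r") for az aw aa
    proof -
      have "?l - ?r = k * (C - h) * aa - k * k * aa * (C - z \<bullet> w - (C - h) * (1 - u))"
        by (simp add: algebra_simps)
      also have "C - z \<bullet> w - (C - h) * (1 - u) = (C - h) * u / 2"
        unfolding zw by (simp add: field_simps)
      also have "k * (C - h) * aa - k * k * aa * ((C - h) * u / 2) = k * (C - h) * aa - k * aa * (C - h) * (k * u) / 2"
        by simp
      also have "\<dots> = 0" unfolding ku by simp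
      finally show ?thesis by simp
    qed
    show ?thesis
      unfolding hyp_linear_grad_deriv_def g l christoffel_def Let_def fst_conv
      unfolding C_def[symmetric] k_def[symmetric] inner_add_left inner_add_right inner_scaleR_left
        inner_scaleR_right inner_diff_right wz power2_eq_square zz
      by (rule eq)
  qed
qed

section \<open>The minimum principle on minimal surfaces\<close>

text \<open>The squared length of the projection of the vertical unit vector to the plane with basis \<open>u, v\<close>
  and normal \<open>p\<close>, computed from the basis and from the normal. The proof uses that \<open>u \<times> v\<close> is parallel
  to \<open>p\<close>.\<close>
lemma normal_direction_identity:
  fixes u1 u2 u3 v1 v2 v3 p1 p2 p3 :: real
  assumes "p1 * u1 + p2 * u2 + p3 * u3 = 0" "p1 * v1 + p2 * v2 + p3 * v3 = 0"
  defines "E \<equiv> u1\<^sup>2 + u2\<^sup>2 + u3\<^sup>2" and "F \<equiv> u1 * v1 + u2 * v2 + u3 * v3" and "G \<equiv> v1\<^sup>2 + v2\<^sup>2 + v3\<^sup>2"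
  shows "(p1\<^sup>2 + p2\<^sup>2 + p3\<^sup>2) * (G * u3\<^sup>2 - 2 * F * u3 * v3 + E * v3\<^sup>2) = (p1\<^sup>2 + p2\<^sup>2) * (E * G - F\<^sup>2)"
proof -
  define c1 c2 c3 where "c1 = u2 * v3 - u3 * v2" and "c2 = u3 * v1 - u1 * v3" and "c3 = u1 * v2 - u2 * v1"
  have "p2 * c3 - p3 * c2 = u1 * (p1 * v1 + p2 * v2 + p3 * v3) - v1 * (p1 * u1 + p2 * u2 + p3 * u3)"
    "p3 * c1 - p1 * c3 = u2 * (p1 * v1 + p2 * v2 + p3 * v3) - v2 * (p1 * u1 + p2 * u2 + p3 * u3)"
    by (simp_all add: c1_def c2_def c3_def algebra_simps)
  then have c: "p3 * c2 = p2 * c3" "p3 * c1 = p1 * c3" using assms(1,2) by simp_all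
  have T: "G * u3\<^sup>2 - 2 * F * u3 * v3 + E * v3\<^sup>2 = c1\<^sup>2 + c2\<^sup>2"
    by (simp add: E_def F_def G_def c1_def c2_def power2_eq_square algebra_simps)
  have D: "E * G - F\<^sup>2 = c1\<^sup>2 + c2\<^sup>2 + c3\<^sup>2"
    by (simp add: E_def F_def G_def c1_def c2_def c3_def power2_eq_square algebra_simps)
  have "p3\<^sup>2 * (c1\<^sup>2 + c2\<^sup>2) = (p3 * c1)\<^sup>2 + (p3 * c2)\<^sup>2" by (simp add: algebra_simps power2_eq_square)
  also have "\<dots> = (p1\<^sup>2 + p2\<^sup>2) * c3\<^sup>2" unfolding c by (simp add: algebra_simps power2_eq_square)
  finally show ?thesis unfolding T D by (simp add: algebra_simps)
qed

text \<open>The algebra of the minimum principle in an orthonormal frame of \<open>\<bbbH>\<^sup>2 \<times> \<real>\<close>. Here \<open>u, v\<close> span the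
  tangent plane, \<open>(g1, g2)\<close> is the gradient of \<open>C\<close>, \<open>H\<close> is the covariant Hessian of \<open>C f\<close>, and \<open>L, M, N\<close>
  are, up to the length of the gradient of \<open>C f\<close>, the second fundamental form of the surface. Tracing the
  second variation over the tangent plane removes \<open>L, M, N\<close> by minimality. On tangent vectors
  the mixed term of \<open>H\<close> is a multiple of the squared vertical component, because the differential of
  \<open>C f\<close> vanishes there; the trace is then known from \<open>normal_direction_identity\<close>.\<close>
lemma trace_of_second_variation:
  fixes u1 u2 u3 v1 v2 v3 g1 g2 C f f1 f2 L M N m :: real
  defines "E \<equiv> u1\<^sup>2 + u2\<^sup>2 + u3\<^sup>2" and "F \<equiv> u1 * v1 + u2 * v2 + u3 * v3" and "G \<equiv> v1\<^sup>2 + v2\<^sup>2 + v3\<^sup>2"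
  defines "H \<equiv> (\<lambda>V1 V2 V3. f * C * (V1\<^sup>2 + V2\<^sup>2) + 2 * f1 * (g1 * V1 + g2 * V2) * V3 + C * f2 * V3\<^sup>2)"
  assumes tu: "f * g1 * u1 + f * g2 * u2 + C * f1 * u3 = 0"
    and tv: "f * g1 * v1 + f * g2 * v2 + C * f1 * v3 = 0"
    and f: "f > 0" and D: "E * G - F\<^sup>2 > 0"
    and K: "g1\<^sup>2 + g2\<^sup>2 = C\<^sup>2 + m" 
    and min: "L * G - 2 * M * F + N * E = 0"
    and Q: "\<And>\<alpha> \<beta>. 0 \<le> H (\<alpha> * u1 + \<beta> * v1) (\<alpha> * u2 + \<beta> * v2) (\<alpha> * u3 + \<beta> * v3)
              + (\<alpha>\<^sup>2 * L + 2 * \<alpha> * \<beta> * M + \<beta>\<^sup>2 * N)"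
  shows "0 \<le> C * ((C\<^sup>2 + m) * f * (f + f2) - 2 * m * f1\<^sup>2)"
proof -
  define T where "T = G * u3\<^sup>2 - 2 * F * u3 * v3 + E * v3\<^sup>2"
  \<comment> \<open>On tangent vectors, \<open>f H = f\<^sup>2 C |V|\<^sup>2 + C \<Theta> V3\<^sup>2\<close>.\<close>
  define \<Theta> where "\<Theta> = f * f2 - f\<^sup>2 - 2 * f1\<^sup>2"
  have tg: "f * H V1 V2 V3 = f\<^sup>2 * C * (V1\<^sup>2 + V2\<^sup>2 + V3\<^sup>2) + C * \<Theta> * V3\<^sup>2"
    if "f * g1 * V1 + f * g2 * V2 + C * f1 * V3 = 0" for V1 V2 V3
  proof -
    have "f * (2 * f1 * (g1 * V1 + g2 * V2) * V3) = 2 * f1 * V3 * (- (C * f1 * V3))"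
    proof -
      have "f * (g1 * V1 + g2 * V2) = - (C * f1 * V3)" using that by (simp add: algebra_simps)
      moreover have "f * (2 * f1 * (g1 * V1 + g2 * V2) * V3) = 2 * f1 * V3 * (f * (g1 * V1 + g2 * V2))"
        by simp
      ultimately show ?thesis by simp
    qed
    then show ?thesis unfolding H_def \<Theta>_def by (simp add: algebra_simps power2_eq_square)
  qed
  have E: "E > 0"
  proof (rule ccontr)
    assume "\<not> E > 0"
    moreover have "E \<ge> 0" unfolding E_def by simp
    ultimately have "E = 0" by simp
    with D show False by simp
  qed
  \<comment> \<open>The directions \<open>u\<close> and \<open>- F u + E v\<close> are orthogonal; weighting the first by \<open>E G - F\<^sup>2\<close>
    makes their sum a multiple of the trace.\<close>
  have q1: "0 \<le> f * H u1 u2 u3 + f * L"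
    using Q[of 1 0] f by (simp add: distrib_left[symmetric])
  have q2: "0 \<le> f * H (- F * u1 + E * v1) (- F * u2 + E * v2) (- F * u3 + E * v3) + f * (F\<^sup>2 * L - 2 * F * E * M + E\<^sup>2 * N)"
    using Q[of "-F" E] f by (simp add: distrib_left[symmetric])
  have t2: "f * g1 * (- F * u1 + E * v1) + f * g2 * (- F * u2 + E * v2) + C * f1 * (- F * u3 + E * v3) = 0"
  proof -
    have "f * g1 * (- F * u1 + E * v1) + f * g2 * (- F * u2 + E * v2) + C * f1 * (- F * u3 + E * v3)
      = - F * (f * g1 * u1 + f * g2 * u2 + C * f1 * u3) + E * (f * g1 * v1 + f * g2 * v2 + C * f1 * v3)"
      by (simp add: algebra_simps)
    then show ?thesis unfolding tu tv by simp
  qed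
  have n2: "(- F * u1 + E * v1)\<^sup>2 + (- F * u2 + E * v2)\<^sup>2 + (- F * u3 + E * v3)\<^sup>2 = E * (E * G - F\<^sup>2)"
  proof -
    have "(- F * u1 + E * v1)\<^sup>2 + (- F * u2 + E * v2)\<^sup>2 + (- F * u3 + E * v3)\<^sup>2
      = F\<^sup>2 * (u1\<^sup>2 + u2\<^sup>2 + u3\<^sup>2) - 2 * F * E * (u1 * v1 + u2 * v2 + u3 * v3) + E\<^sup>2 * (v1\<^sup>2 + v2\<^sup>2 + v3\<^sup>2)"
      by (simp add: algebra_simps power2_eq_square)
    also have "\<dots> = F\<^sup>2 * E - 2 * F * E * F + E\<^sup>2 * G" by (simp only: E_def F_def G_def)
    finally show ?thesis by (simp add: algebra_simps power2_eq_square)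
  qed
  have "0 \<le> (E * G - F\<^sup>2) * (f * H u1 u2 u3 + f * L)
      + (f * H (- F * u1 + E * v1) (- F * u2 + E * v2) (- F * u3 + E * v3) + f * (F\<^sup>2 * L - 2 * F * E * M + E\<^sup>2 * N))"
    using D by (intro add_nonneg_nonneg[OF mult_nonneg_nonneg[OF _ q1] q2]) auto
  also have "\<dots> = (E * G - F\<^sup>2) * (f\<^sup>2 * C * E + C * \<Theta> * u3\<^sup>2)
      + (f\<^sup>2 * C * (E * (E * G - F\<^sup>2)) + C * \<Theta> * (- F * u3 + E * v3)\<^sup>2) + f * E * (L * G - 2 * M * F + N * E)"
    unfolding tg[OF tu] tg[OF t2] n2 using E_def by (simp add: algebra_simps power2_eq_square)
  also have "\<dots> = E * (C * (2 * f\<^sup>2 * (E * G - F\<^sup>2) + \<Theta> * T))"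
    unfolding min T_def by (simp add: algebra_simps power2_eq_square)
  finally have 1: "0 \<le> C * (2 * f\<^sup>2 * (E * G - F\<^sup>2) + \<Theta> * T)"
    using E by (simp add: zero_le_mult_iff)
  define W where "W = f\<^sup>2 * (C\<^sup>2 + m) + C\<^sup>2 * f1\<^sup>2"
  have W: "W * T = f\<^sup>2 * (C\<^sup>2 + m) * (E * G - F\<^sup>2)"
    using normal_direction_identity[OF tu tv] unfolding T_def W_def K[symmetric] E_def F_def G_def
    by (simp add: algebra_simps power2_eq_square)
  have "W \<ge> 0" unfolding W_def K[symmetric] by simp
  then have "0 \<le> W * (C * (2 * f\<^sup>2 * (E * G - F\<^sup>2) + \<Theta> * T))" using 1 by simp
  also have "\<dots> = C * (2 * f\<^sup>2 * (E * G - F\<^sup>2) * W + \<Theta> * (W * T))" by (simp add: algebra_simps)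
  also have "\<dots> = (E * G - F\<^sup>2) * f\<^sup>2 * (C * (2 * W + \<Theta> * (C\<^sup>2 + m)))"
    unfolding W by (simp add: algebra_simps)
  also have "2 * W + \<Theta> * (C\<^sup>2 + m) = (C\<^sup>2 + m) * f * (f + f2) - 2 * m * f1\<^sup>2"
    unfolding W_def \<Theta>_def by (simp add: algebra_simps power2_eq_square)
  finally have "(E * G - F\<^sup>2) * f\<^sup>2 * 0 \<le> (E * G - F\<^sup>2) * f\<^sup>2 * (C * ((C\<^sup>2 + m) * f * (f + f2) - 2 * m * f1\<^sup>2))"
    by simp
  moreover have "0 < (E * G - F\<^sup>2) * f\<^sup>2" using D f by simp
  ultimately show ?thesis by (simp only: mult_le_cancel_left_pos)
qed

lemma has_derivative_partials:
  fixes f :: "real \<times> real \<Rightarrow> 'b::real_normed_vector"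
  assumes "f differentiable_on D" "y \<in> interior D"
  shows "(f has_derivative (\<lambda>d. fst d *\<^sub>R partial_u D f y + snd d *\<^sub>R partial_v D f y)) (at y)"
    and "frechet_derivative f (at y within D) = (\<lambda>d. fst d *\<^sub>R partial_u D f y + snd d *\<^sub>R partial_v D f y)"
proof -
  have D: "(f has_derivative frechet_derivative f (at y within D)) (at y within D)"
    using assms interior_subset[of D] frechet_derivative_works unfolding differentiable_on_def by blast
  have "frechet_derivative f (at y within D) d = fst d *\<^sub>R partial_u D f y + snd d *\<^sub>R partial_v D f y" for d
  proof -
    have lin: "linear (frechet_derivative f (at y within D))" using D by (rule has_derivative_linear)
    have "frechet_derivative f (at y within D) (fst d *\<^sub>R (1, 0) + snd d *\<^sub>R (0, 1))
        = fst d *\<^sub>R partial_u D f y + snd d *\<^sub>R partial_v D f y"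
      unfolding partial_u_def partial_v_def linear_add[OF lin] linear_scale[OF lin] ..
    moreover have "fst d *\<^sub>R (1, 0) + snd d *\<^sub>R (0, 1) = d" by (simp add: prod_eq_iff)
    ultimately show ?thesis by (simp only:)
  qed
  then show *: "frechet_derivative f (at y within D) = (\<lambda>d. fst d *\<^sub>R partial_u D f y + snd d *\<^sub>R partial_v D f y)"
    by (rule ext)
  show "(f has_derivative (\<lambda>d. fst d *\<^sub>R partial_u D f y + snd d *\<^sub>R partial_v D f y)) (at y)"
    using D unfolding * unfolding at_within_interior[OF assms(2)] .
qed

lemma christoffel_quadratic:
  "christoffel p (\<alpha> *\<^sub>R v + \<beta> *\<^sub>R w) (\<alpha> *\<^sub>R v + \<beta> *\<^sub>R w)
   = \<alpha>\<^sup>2 *\<^sub>R christoffel p v v + (2 * \<alpha> * \<beta>) *\<^sub>R christoffel p v w + \<beta>\<^sup>2 *\<^sub>R christoffel p w w"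
proof (rule prod_eqI)
  define z a b where "z = fst p" and "a = fst v" and "b = fst w"
  define k pa pb aa ab bb where "k = conformal_factor z" and "pa = z \<bullet> a" and "pb = z \<bullet> b"
    and "aa = a \<bullet> a" and "ab = a \<bullet> b" and "bb = b \<bullet> b"
  have inner_z: "z \<bullet> (\<alpha> *\<^sub>R a + \<beta> *\<^sub>R b) = \<alpha> * pa + \<beta> * pb"
    unfolding pa_def pb_def by (simp add: inner_add_right)
  have inner_self: "(\<alpha> *\<^sub>R a + \<beta> *\<^sub>R b) \<bullet> (\<alpha> *\<^sub>R a + \<beta> *\<^sub>R b) = \<alpha>\<^sup>2 * aa + 2 * \<alpha> * \<beta> * ab + \<beta>\<^sup>2 * bb"
    unfolding aa_def ab_def bb_def
    by (simp add: inner_add_left inner_add_right inner_commute[of b a] power2_eq_square algebra_simps)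
  have "k *\<^sub>R ((\<alpha> * pa + \<beta> * pb) *\<^sub>R (\<alpha> *\<^sub>R a + \<beta> *\<^sub>R b) + (\<alpha> * pa + \<beta> * pb) *\<^sub>R (\<alpha> *\<^sub>R a + \<beta> *\<^sub>R b)
        - (\<alpha>\<^sup>2 * aa + 2 * \<alpha> * \<beta> * ab + \<beta>\<^sup>2 * bb) *\<^sub>R z)
    = \<alpha>\<^sup>2 *\<^sub>R k *\<^sub>R (pa *\<^sub>R a + pa *\<^sub>R a - aa *\<^sub>R z) + (2 * \<alpha> * \<beta>) *\<^sub>R k *\<^sub>R (pa *\<^sub>R b + pb *\<^sub>R a - ab *\<^sub>R z)
      + \<beta>\<^sup>2 *\<^sub>R k *\<^sub>R (pb *\<^sub>R b + pb *\<^sub>R b - bb *\<^sub>R z)"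
    by (rule complex_eqI; simp only: plus_complex.sel minus_complex.sel scaleR_complex.sel) (simp_all add: power2_eq_square algebra_simps)
  then show "fst (christoffel p (\<alpha> *\<^sub>R v + \<beta> *\<^sub>R w) (\<alpha> *\<^sub>R v + \<beta> *\<^sub>R w))
   = fst (\<alpha>\<^sup>2 *\<^sub>R christoffel p v v + (2 * \<alpha> * \<beta>) *\<^sub>R christoffel p v w + \<beta>\<^sup>2 *\<^sub>R christoffel p w w)"
    unfolding christoffel_def Let_def fst_conv fst_add fst_scaleR
      z_def[symmetric] a_def[symmetric] b_def[symmetric] inner_z inner_self
    unfolding k_def pa_def pb_def aa_def ab_def bb_def .
  show "snd (christoffel p (\<alpha> *\<^sub>R v + \<beta> *\<^sub>R w) (\<alpha> *\<^sub>R v + \<beta> *\<^sub>R w))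
   = snd (\<alpha>\<^sup>2 *\<^sub>R christoffel p v v + (2 * \<alpha> * \<beta>) *\<^sub>R christoffel p v w + \<beta>\<^sup>2 *\<^sub>R christoffel p w w)"
    unfolding christoffel_def Let_def snd_conv snd_add snd_scaleR by simp
qed

lemma mean_curvature_zero_trace:
  assumes "mean_curvature D X x N = 0"
    and "metric (X x) (partial_u D X x) (partial_u D X x) * metric (X x) (partial_v D X x) (partial_v D X x)
           - (metric (X x) (partial_u D X x) (partial_v D X x))\<^sup>2 \<noteq> 0"
  shows "metric (X x) (partial_u D (partial_u D X) x + christoffel (X x) (partial_u D X x) (partial_u D X x)) N
             * metric (X x) (partial_v D X x) (partial_v D X x)
           - 2 * metric (X x) (partial_v D (partial_u D X) x + christoffel (X x) (partial_u D X x) (partial_v D X x)) N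
             * metric (X x) (partial_u D X x) (partial_v D X x)
           + metric (X x) (partial_v D (partial_v D X) x + christoffel (X x) (partial_v D X x) (partial_v D X x)) N
             * metric (X x) (partial_u D X x) (partial_u D X x) = 0"
proof -
  have two: "(2::real) \<noteq> 0" by simp
  show ?thesis
    by (rule disjE[OF assms(1)[unfolded mean_curvature_def Let_def divide_eq_0_iff mult_eq_0_iff[of 2]]],
        assumption, erule disjE, erule notE[OF two], erule notE[OF assms(2)])
qed

text \<open>A critical point of the restriction of \<open>\<Phi>\<close> to a surface is a point where the surface is
  orthogonal to the gradient of \<open>\<Phi>\<close>. If this gradient is nonzero, its normalization is a unit normal, and
  vanishing mean curvature in this direction is what \<open>trace_of_second_variation\<close> needs; if it is
  zero, the terms with the second fundamental form vanish anyway.\<close>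
lemma minimal_patch_minimum:
  fixes X :: "real \<times> real \<Rightarrow> complex \<times> real"
  assumes patch: "minimal_patch D X"
    and "r > 0" and ball: "ball x r \<subseteq> D"
    and f1: "\<And>t. (f has_real_derivative f1 t) (at t)"
    and f2: "\<And>t. (f1 has_real_derivative f2 t) (at t)"
    and pos: "f (snd (X x)) > 0"
    and min: "\<And>y. y \<in> ball x r \<Longrightarrow>
      hyp_linear w h (fst (X x)) * f (snd (X x)) \<le> hyp_linear w h (fst (X y)) * f (snd (X y))"
  defines "C \<equiv> hyp_linear w h (fst (X x))" and "t \<equiv> snd (X x)" and "m \<equiv> w \<bullet> w - h\<^sup>2"
  shows "0 \<le> C * ((C\<^sup>2 + m) * f t * (f t + f2 t) - 2 * m * (f1 t)\<^sup>2)"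
proof -
  define z where "z = fst (X x)"
  have P: "X x = (z, t)" by (simp add: z_def t_def)
  define U V where "U = partial_u D X" and "V = partial_v D X"
  define uu uv vu vv where "uu = partial_u D U x" and "uv = partial_v D U x"
    and "vu = partial_u D V x" and "vv = partial_v D V x"
  have img: "X ` D \<subseteq> H2R" and "Ck_on (Suc (Suc 0)) D X" and inj: "\<And>y. y \<in> D \<Longrightarrow> inj (frechet_derivative X (at y within D))"
    using patch unfolding minimal_patch_def regular_patch_def smooth_on_def by auto
  then have diff: "X differentiable_on D" "U differentiable_on D" "V differentiable_on D"
    by (auto simp: U_def V_def)
  have int: "y \<in> interior D" if "y \<in> ball x r" for y
    using ball that by (meson interior_maximal open_ball subsetD)
  have x: "x \<in> ball x r" "x \<in> D" using \<open>r > 0\<close> ball by auto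
  have z: "z \<in> ball 0 1" using img x P by (auto simp: image_subset_iff)
  define G where "G = (\<lambda>p::complex \<times> real. (f (snd p) *\<^sub>R hyp_linear_grad w h (fst p), hyp_linear w h (fst p) * f1 (snd p)))"
  define G' where "G' = (\<lambda>q::complex \<times> real.
    ((f1 t * snd q) *\<^sub>R hyp_linear_grad w h z + f t *\<^sub>R hyp_linear_grad_deriv w h z (fst q),
     (hyp_linear_grad w h z \<bullet> fst q) * f1 t + C * (f2 t * snd q)))"
  have C: "C = hyp_linear w h z" by (simp add: C_def z_def)
  have XD: "(X has_derivative (\<lambda>d. fst d *\<^sub>R U y + snd d *\<^sub>R V y)) (at y)" if "y \<in> ball x r" for y
    using has_derivative_partials(1)[OF diff(1) int[OF that]] by (simp add: U_def V_def)
  have UD: "(U has_derivative (\<lambda>d. fst d *\<^sub>R uu + snd d *\<^sub>R uv)) (at x)"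
    using has_derivative_partials(1)[OF diff(2) int[OF x(1)]] by (simp add: uu_def uv_def)
  have VD: "(V has_derivative (\<lambda>d. fst d *\<^sub>R vu + snd d *\<^sub>R vv)) (at x)"
    using has_derivative_partials(1)[OF diff(3) int[OF x(1)]] by (simp add: vu_def vv_def)
  have fst': "(fst has_derivative fst) (at p)" and snd': "(snd has_derivative snd) (at p)" for p :: "complex \<times> real"
    by (auto intro!: has_derivative_fst has_derivative_snd has_derivative_ident)
  have df: "((\<lambda>p::complex \<times> real. f (snd p)) has_derivative (\<lambda>q. f1 (snd p) * snd q)) (at p)"
    and df1: "((\<lambda>p::complex \<times> real. f1 (snd p)) has_derivative (\<lambda>q. f2 (snd p) * snd q)) (at p)" for p
    using has_derivative_compose[OF snd' f1[unfolded has_field_derivative_def]]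
      has_derivative_compose[OF snd' f2[unfolded has_field_derivative_def]] by auto
  have \<Phi>D: "((\<lambda>p. hyp_linear w h (fst p) * f (snd p)) has_derivative (\<lambda>q. G p \<bullet> q)) (at p)" if "p \<in> H2R" for p
  proof -
    have "fst p \<in> ball 0 1" using that by (auto simp: mem_Times_iff)
    from has_derivative_mult[OF has_derivative_compose[OF fst' hyp_linear_has_derivative[OF this]] df]
    show ?thesis
      by (rule has_derivative_eq_rhs) (auto simp: G_def inner_prod_def algebra_simps)
  qed
  have GD: "(G has_derivative G') (at (X x))"
  proof -
    have z': "fst (X x) \<in> ball 0 1" using z by (simp add: P)
    show ?thesis unfolding G_def G'_def
      by (rule has_derivative_eq_rhs, rule has_derivative_Pair[OF
         has_derivative_scaleR[OF df has_derivative_compose[OF fst' hyp_linear_grad_has_derivative[OF z']]]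
         has_derivative_mult[OF has_derivative_compose[OF fst' hyp_linear_has_derivative[OF z']] df1]])
       (auto simp: P C fun_eq_iff)
  qed
  have YX: "X ` ball x r \<subseteq> H2R" using img ball by blast
  have oH: "open H2R" by (intro open_Times) auto
  note sv = second_variation_at_minimum[OF \<open>r > 0\<close> oH YX XD UD VD \<Phi>D GD min]
  define a b \<tau> \<sigma> where "a = fst (U x)" and "b = fst (V x)" and "\<tau> = snd (U x)" and "\<sigma> = snd (V x)"
  have Ux: "U x = (a, \<tau>)" and Vx: "V x = (b, \<sigma>)" by (simp_all add: a_def b_def \<tau>_def \<sigma>_def)
  define l where "l = conformal_factor z"
  have l: "l > 0" using conformal_factor_pos[OF z] by (simp add: l_def)
  define g where "g = hyp_linear_grad w h z"
  define L where "L = G (X x) \<bullet> (uu + christoffel (X x) (U x) (U x))"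
  define M where "M = G (X x) \<bullet> (uv + christoffel (X x) (U x) (V x))"
  define N where "N = G (X x) \<bullet> (vv + christoffel (X x) (V x) (V x))"
  have GX: "G (X x) = (f t *\<^sub>R g, C * f1 t)" by (simp add: G_def P g_def C)
  have met: "metric (X x) p q = l * Re (fst p) * (l * Re (fst q)) + l * Im (fst p) * (l * Im (fst q)) + snd p * snd q" for p q
    by (simp add: metric_def P l_def inner_complex_def power2_eq_square algebra_simps)
  define E where "E = (l * Re a)\<^sup>2 + (l * Im a)\<^sup>2 + \<tau>\<^sup>2"
  define F where "F = (l * Re a) * (l * Re b) + (l * Im a) * (l * Im b) + \<tau> * \<sigma>"
  define H where "H = (l * Re b)\<^sup>2 + (l * Im b)\<^sup>2 + \<sigma>\<^sup>2"
  have mE: "metric (X x) (U x) (U x) = E" and mF: "metric (X x) (U x) (V x) = F" and mH: "metric (X x) (V x) (V x) = H"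
    unfolding met by (simp_all add: E_def F_def H_def Ux Vx power2_eq_square algebra_simps)
  have disc: "E * H - F\<^sup>2 > 0"
  proof -
    \<comment> \<open>\<open>Y\<close> is \<open>E\<close> times the part of \<open>V x\<close> orthogonal to \<open>U x\<close>; its length gives the discriminant.\<close>
    define Y where "Y = (-F) *\<^sub>R U x + E *\<^sub>R V x"
    have YY: "metric (X x) Y Y = E * (E * H - F\<^sup>2)"
    proof -
      have "metric (X x) Y Y = F\<^sup>2 * metric (X x) (U x) (U x) - 2 * F * E * metric (X x) (U x) (V x) + E\<^sup>2 * metric (X x) (V x) (V x)"
        by (simp add: metric_def Y_def inner_add_left inner_add_right inner_diff_left inner_diff_right power2_eq_square
            inner_commute[of "fst (V x)" "fst (U x)"] algebra_simps)
      then show ?thesis unfolding mE mF mH by (simp add: power2_eq_square algebra_simps)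
    qed
    have pd: "q = 0" if "metric (X x) q q = 0" for q
    proof -
      have "(l * Re (fst q))\<^sup>2 + (l * Im (fst q))\<^sup>2 + (snd q)\<^sup>2 = 0"
        using that unfolding met by (simp add: power2_eq_square)
      then have "l * Re (fst q) = 0 \<and> l * Im (fst q) = 0 \<and> snd q = 0"
        by (smt (verit) zero_le_power2 power_eq_0_iff)
      then show ?thesis using l by (simp add: prod_eq_iff complex_eq_iff)
    qed
    have inj': "\<alpha> = 0 \<and> \<beta> = 0" if "\<alpha> *\<^sub>R U x + \<beta> *\<^sub>R V x = 0" for \<alpha> \<beta>
    proof -
      have "frechet_derivative X (at x within D) (\<alpha>, \<beta>) = frechet_derivative X (at x within D) (0, 0)"
        using that unfolding has_derivative_partials(2)[OF diff(1) int[OF x(1)]] by (simp add: U_def V_def)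
      from injD[OF inj[OF x(2)] this] show ?thesis by simp
    qed
    have "E \<noteq> 0" using pd[of "U x"] inj'[of 1 0] mE by auto
    moreover have "E \<ge> 0" by (simp add: E_def)
    ultimately have "E > 0" by simp
    have "metric (X x) Y Y \<ge> 0" unfolding met by simp
    moreover have "metric (X x) Y Y \<noteq> 0" using pd[of Y] inj'[of "-F" E] \<open>E > 0\<close> by (auto simp: Y_def)
    ultimately have "metric (X x) Y Y > 0" by simp
    then have "E * (E * H - F\<^sup>2) > 0" unfolding YY .
    then show ?thesis using \<open>E > 0\<close> by (rule zero_less_mult_pos)
  qed
  have trace0: "L * H - 2 * M * F + N * E = 0"
  proof (cases "G (X x) = 0")
    case True
    then show ?thesis by (simp add: L_def M_def N_def)
  next
    case False
    \<comment> \<open>The Riemannian gradient of \<open>\<Phi>\<close>; \<open>G\<close> is the Euclidean one.\<close>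
    define n where "n = ((f t / l\<^sup>2) *\<^sub>R g, C * f1 t)"
    have mn: "metric (X x) q n = G (X x) \<bullet> q" for q
      using l by (simp add: metric_def P n_def GX[unfolded P] inner_prod_def inner_commute flip: l_def)
    have "metric (X x) n n = (f t)\<^sup>2 / l\<^sup>2 * (g \<bullet> g) + (C * f1 t)\<^sup>2"
      unfolding mn by (simp add: GX n_def inner_prod_def power2_eq_square)
    moreover have "\<dots> > 0"
    proof (cases "g = 0")
      case True
      with False show ?thesis by (simp add: GX prod_eq_iff)
    next
      case g: False
      have "(f t)\<^sup>2 / l\<^sup>2 * (g \<bullet> g) > 0" using pos l g by (simp add: t_def)
      then show ?thesis by (simp add: add_pos_nonneg)
    qed
    ultimately have W: "metric (X x) n n > 0" by simp
    define k where "k = 1 / sqrt (metric (X x) n n)"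
    have k: "k > 0" "k\<^sup>2 * metric (X x) n n = 1" using W by (simp_all add: k_def power_divide)
    have sc: "metric (X x) q (k *\<^sub>R n) = k * (G (X x) \<bullet> q)" for q
    proof -
      have "metric (X x) q (k *\<^sub>R n) = k * metric (X x) q n" by (simp add: metric_def algebra_simps)
      then show ?thesis by (simp only: mn)
    qed
    have sc': "metric (X x) (k *\<^sub>R n) q = k * (G (X x) \<bullet> q)" for q
      using sc[of q] by (simp add: metric_def inner_commute mult.commute)
    have "unit_normal D X x (k *\<^sub>R n)"
      unfolding unit_normal_def sc' U_def[symmetric] V_def[symmetric]
      using sv(1,2) k(2) mn[of n] by (simp add: power2_eq_square algebra_simps)
    then have "mean_curvature D X x (k *\<^sub>R n) = 0"
      using patch x(2) unfolding minimal_patch_def by blast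
    from mean_curvature_zero_trace[OF this] disc
    have "k * L * H - 2 * (k * M) * F + k * N * E = 0"
      unfolding U_def[symmetric] V_def[symmetric] uu_def[symmetric] uv_def[symmetric] vv_def[symmetric]
        mE mF mH sc L_def M_def N_def by simp
    then have "k * (L * H - 2 * M * F + N * E) = 0" by (simp add: algebra_simps)
    then show ?thesis using k by simp
  qed
  have gl: "g \<bullet> c = Re g / l * (l * Re c) + Im g / l * (l * Im c)" for c
    using l by (simp add: inner_complex_def)
  have tangent: "f t * (Re g / l) * (l * Re c) + f t * (Im g / l) * (l * Im c) + C * f1 t * s = G (X x) \<bullet> (c, s)" for c s
    unfolding GX by (simp add: gl algebra_simps)
  have K: "(Re g / l)\<^sup>2 + (Im g / l)\<^sup>2 = C\<^sup>2 + m"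
  proof -
    have "(Re g)\<^sup>2 + (Im g)\<^sup>2 = l\<^sup>2 * (C\<^sup>2 + m)"
      using hyp_linear_grad_norm[OF z, of w h]
      by (simp add: g_def l_def C m_def inner_complex_def power2_eq_square)
    then show ?thesis using l by (simp add: power_divide add_divide_distrib[symmetric])
  qed
  show ?thesis
  proof (rule trace_of_second_variation[where ?u1.0 = "l * Re a" and ?u2.0 = "l * Im a" and ?u3.0 = \<tau>
        and ?v1.0 = "l * Re b" and ?v2.0 = "l * Im b" and ?v3.0 = \<sigma>
        and ?g1.0 = "Re g / l" and ?g2.0 = "Im g / l" and L = L and M = M and N = N])
    show "f t * (Re g / l) * (l * Re a) + f t * (Im g / l) * (l * Im a) + C * f1 t * \<tau> = 0"
      using sv(1) unfolding tangent Ux by simp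
    show "f t * (Re g / l) * (l * Re b) + f t * (Im g / l) * (l * Im b) + C * f1 t * \<sigma> = 0"
      using sv(2) unfolding tangent Vx by simp
    show "f t > 0" using pos by (simp add: t_def)
    show "((l * Re a)\<^sup>2 + (l * Im a)\<^sup>2 + \<tau>\<^sup>2) * ((l * Re b)\<^sup>2 + (l * Im b)\<^sup>2 + \<sigma>\<^sup>2)
       - (l * Re a * (l * Re b) + l * Im a * (l * Im b) + \<tau> * \<sigma>)\<^sup>2 > 0"
      using disc by (simp add: E_def F_def H_def)
    show "(Re g / l)\<^sup>2 + (Im g / l)\<^sup>2 = C\<^sup>2 + m" by (rule K)
    show "L * ((l * Re b)\<^sup>2 + (l * Im b)\<^sup>2 + \<sigma>\<^sup>2) - 2 * M * (l * Re a * (l * Re b) + l * Im a * (l * Im b) + \<tau> * \<sigma>)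
        + N * ((l * Re a)\<^sup>2 + (l * Im a)\<^sup>2 + \<tau>\<^sup>2) = 0"
      using trace0 by (simp add: E_def F_def H_def)
    fix \<alpha> \<beta> :: real
    define Y where "Y = \<alpha> *\<^sub>R U x + \<beta> *\<^sub>R V x"
    have Y: "fst Y = \<alpha> *\<^sub>R a + \<beta> *\<^sub>R b" "snd Y = \<alpha> * \<tau> + \<beta> * \<sigma>" by (simp_all add: Y_def Ux Vx)
    have "0 \<le> G' Y \<bullet> Y + G (X x) \<bullet> (\<alpha>\<^sup>2 *\<^sub>R uu + (2 * \<alpha> * \<beta>) *\<^sub>R uv + \<beta>\<^sup>2 *\<^sub>R vv)"
      unfolding Y_def by (rule sv(3))
    moreover have "G' Y \<bullet> Y = f t * C * ((l * Re (fst Y))\<^sup>2 + (l * Im (fst Y))\<^sup>2)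
         + 2 * f1 t * (g \<bullet> fst Y) * snd Y + C * f2 t * (snd Y)\<^sup>2 + G (X x) \<bullet> christoffel (X x) Y Y"
    proof -
      have 1: "hyp_linear_grad_deriv w h z (fst Y) \<bullet> fst Y
         = C * ((l * Re (fst Y))\<^sup>2 + (l * Im (fst Y))\<^sup>2) + g \<bullet> fst (christoffel (X x) Y Y)"
        using hyp_linear_hessian[OF z, of w h "fst Y" t "snd Y"]
        by (simp add: P g_def l_def C inner_complex_def power2_eq_square algebra_simps)
      have 2: "snd (christoffel (X x) Y Y) = 0" by (simp add: christoffel_def Let_def)
      have "G' Y \<bullet> Y = 2 * f1 t * (g \<bullet> fst Y) * snd Y + f t * (hyp_linear_grad_deriv w h z (fst Y) \<bullet> fst Y) + C * f2 t * (snd Y)\<^sup>2"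
        by (simp add: G'_def inner_prod_def inner_add_left g_def power2_eq_square algebra_simps)
      then show ?thesis unfolding 1 GX by (simp add: inner_prod_def 2 algebra_simps)
    qed
    moreover have "G (X x) \<bullet> christoffel (X x) Y Y + G (X x) \<bullet> (\<alpha>\<^sup>2 *\<^sub>R uu + (2 * \<alpha> * \<beta>) *\<^sub>R uv + \<beta>\<^sup>2 *\<^sub>R vv)
        = \<alpha>\<^sup>2 * L + 2 * \<alpha> * \<beta> * M + \<beta>\<^sup>2 * N"
      unfolding Y_def christoffel_quadratic L_def M_def N_def by (simp add: inner_add_right algebra_simps)
    moreover have "l * Re (fst Y) = \<alpha> * (l * Re a) + \<beta> * (l * Re b)" "l * Im (fst Y) = \<alpha> * (l * Im a) + \<beta> * (l * Im b)"
      by (simp_all add: Y algebra_simps)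
    ultimately show "0 \<le> f t * C * ((\<alpha> * (l * Re a) + \<beta> * (l * Re b))\<^sup>2 + (\<alpha> * (l * Im a) + \<beta> * (l * Im b))\<^sup>2)
        + 2 * f1 t * (Re g / l * (\<alpha> * (l * Re a) + \<beta> * (l * Re b)) + Im g / l * (\<alpha> * (l * Im a) + \<beta> * (l * Im b))) * (\<alpha> * \<tau> + \<beta> * \<sigma>)
        + C * f2 t * (\<alpha> * \<tau> + \<beta> * \<sigma>)\<^sup>2 + (\<alpha>\<^sup>2 * L + 2 * \<alpha> * \<beta> * M + \<beta>\<^sup>2 * N)"
      by (simp only: gl Y(2))
  qed
qed

text \<open>The neighbourhood \<open>W\<close> is taken in the ambient space: if the immersion passes several times
  through \<open>X p\<close>, the minimum is required on all the sheets. A point outside \<open>surface_boundary S\<close> has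
  in every chart a full disk as neighbourhood.\<close>
lemma minimal_surface_minimum:
  fixes X :: "'a \<Rightarrow> complex \<times> real"
  assumes "minimal_immersion S A X"
    and p: "p \<in> topspace S" "p \<notin> surface_boundary S"
    and f1: "\<And>t. (f has_real_derivative f1 t) (at t)"
    and f2: "\<And>t. (f1 has_real_derivative f2 t) (at t)"
    and pos: "f (snd (X p)) > 0"
    and "open W" "X p \<in> W"
    and min: "\<And>q. q \<in> topspace S \<Longrightarrow> X q \<in> W \<Longrightarrow>
      hyp_linear w h (fst (X p)) * f (snd (X p)) \<le> hyp_linear w h (fst (X q)) * f (snd (X q))"
  defines "C \<equiv> hyp_linear w h (fst (X p))" and "t \<equiv> snd (X p)" and "m \<equiv> w \<bullet> w - h\<^sup>2"
  shows "0 \<le> C * ((C\<^sup>2 + m) * f t * (f t + f2 t) - 2 * m * (f1 t)\<^sup>2)"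
proof -
  have "smooth_atlas S A" using assms(1) by (simp add: minimal_immersion_def smooth_surface_def)
  then obtain U \<phi> where U: "(U, \<phi>) \<in> A" "p \<in> U" and ch: "chart S U \<phi>"
    using p(1) unfolding smooth_atlas_def by blast
  define D where "D = \<phi> ` U"
  define Y where "Y = X \<circ> inv_into U \<phi>"
  have patch: "minimal_patch D Y"
    using assms(1) U(1) unfolding minimal_immersion_def D_def Y_def by blast
  obtain V where V: "openin (top_of_set half_plane) V" and hom: "homeomorphic_map (subtopology S U) (top_of_set V) \<phi>"
    and US: "openin S U" using ch unfolding chart_def by blast
  have UU: "U \<subseteq> topspace S" using openin_subset[OF US] .
  have inj: "inj_on \<phi> U" and DV: "D = V"
    using homeomorphic_imp_injective_map[OF hom] homeomorphic_imp_surjective_map[OF hom] UU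
    by (auto simp: D_def inf_absorb2)
  have Yx: "Y (\<phi> q) = X q" if "q \<in> U" for q using inj that by (simp add: Y_def)
  obtain T where T: "open T" "D = half_plane \<inter> T" using V by (auto simp: DV openin_open)
  have xD: "\<phi> p \<in> D" using U by (simp add: D_def)
  have "snd (\<phi> p) \<noteq> 0" using p(2) U ch unfolding surface_boundary_def by blast
  then have "snd (\<phi> p) > 0" using xD T(2) by (auto simp: half_plane_def)
  have "open ({x. 0 < snd x} \<inter> T)" 
    using T(1) by (intro open_Int open_Collect_less continuous_intros) auto
  moreover have "\<phi> p \<in> {x. 0 < snd x} \<inter> T" using \<open>snd (\<phi> p) > 0\<close> xD T(2) by auto
  ultimately obtain r1 where r1: "r1 > 0" "ball (\<phi> p) r1 \<subseteq> {x. 0 < snd x} \<inter> T"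
    by (meson open_contains_ball)
  then have b1: "ball (\<phi> p) r1 \<subseteq> D" using T(2) by (force simp: half_plane_def)
  have "continuous_on D Y"
    using patch unfolding minimal_patch_def regular_patch_def smooth_on_def by (metis Ck_on.simps(1))
  then have "continuous_on (ball (\<phi> p) r1) Y" using b1 continuous_on_subset by blast
  then have "open (ball (\<phi> p) r1 \<inter> Y -` W)" using \<open>open W\<close> by (simp add: continuous_open_preimage)
  moreover have "\<phi> p \<in> ball (\<phi> p) r1 \<inter> Y -` W" using r1 Yx[OF U(2)] \<open>X p \<in> W\<close> by simp
  ultimately obtain r where r: "r > 0" "ball (\<phi> p) r \<subseteq> ball (\<phi> p) r1 \<inter> Y -` W"
    by (meson open_contains_ball)
  have "0 \<le> hyp_linear w h (fst (Y (\<phi> p))) * (((hyp_linear w h (fst (Y (\<phi> p))))\<^sup>2 + (w \<bullet> w - h\<^sup>2)) * f (snd (Y (\<phi> p)))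
     * (f (snd (Y (\<phi> p))) + f2 (snd (Y (\<phi> p)))) - 2 * (w \<bullet> w - h\<^sup>2) * (f1 (snd (Y (\<phi> p))))\<^sup>2)"
  proof (rule minimal_patch_minimum[OF patch r(1) _ f1 f2])
    show "ball (\<phi> p) r \<subseteq> D" using r b1 by blast
    show "f (snd (Y (\<phi> p))) > 0" using pos Yx[OF U(2)] by simp
    fix y assume y: "y \<in> ball (\<phi> p) r"
    then have "y \<in> D" "Y y \<in> W" using r b1 by blast+
    then obtain q where q: "q \<in> U" "y = \<phi> q" by (auto simp: D_def)
    then have "X q \<in> W" using \<open>Y y \<in> W\<close> Yx by simp
    with min[of q] q UU show "hyp_linear w h (fst (Y (\<phi> p))) * f (snd (Y (\<phi> p))) \<le> hyp_linear w h (fst (Y y)) * f (snd (Y y))"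
      by (simp add: Yx U(2) subset_iff)
  qed
  then show ?thesis by (simp add: Yx U(2) C_def t_def m_def)
qed

section \<open>Barriers over a closed slab\<close>

lemma hyp_linear_continuous: "continuous_on (ball 0 1) (hyp_linear w h)"
  using hyp_linear_has_derivative
  by (meson continuous_at_imp_continuous_on has_derivative_continuous)

lemma hyp_linear_le_iff:
  assumes "z \<in> ball 0 1"
  shows "hyp_linear w h z \<le> c \<longleftrightarrow> 2 * (z \<bullet> w) - h * (1 + z \<bullet> z) \<le> c * (1 - z \<bullet> z)"
  using inner_less_1[OF assms] by (simp add: hyp_linear_def divide_simps)

text \<open>What the comparison arguments use about a minimal surface with image \<open>M\<close>, image \<open>K\<close> of
  the boundary and asymptotic boundary \<open>\<Gamma>\<close>.\<close>
locale minimal_set =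
  fixes M K \<Gamma> :: "(complex \<times> real) set"
  assumes M: "M \<subseteq> H2R" and \<Gamma>: "\<Gamma> \<subseteq> H2R_infinity" and closure_M: "closure M \<subseteq> M \<union> \<Gamma>"
    and minimum_principle: "\<And>P w h f f1 f2 W.
      \<lbrakk>P \<in> M; P \<notin> K; \<And>t. (f has_real_derivative f1 t) (at t); \<And>t. (f1 has_real_derivative f2 t) (at t);
       f (snd P) > 0; open W; P \<in> W;
       \<And>Q. Q \<in> M \<Longrightarrow> Q \<in> W \<Longrightarrow> hyp_linear w h (fst P) * f (snd P) \<le> hyp_linear w h (fst Q) * f (snd Q)\<rbrakk>
      \<Longrightarrow> 0 \<le> hyp_linear w h (fst P) *
        (((hyp_linear w h (fst P))\<^sup>2 + (w \<bullet> w - h\<^sup>2)) * f (snd P) * (f (snd P) + f2 (snd P))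
          - 2 * (w \<bullet> w - h\<^sup>2) * (f1 (snd P))\<^sup>2)"
begin

lemma fst_in_ball: "P \<in> M \<Longrightarrow> fst P \<in> ball 0 1"
  using M by (auto simp: mem_Times_iff)

lemma fst_on_circle: "P \<in> \<Gamma> \<Longrightarrow> fst P \<in> sphere 0 1"
  using \<Gamma> by (auto simp: mem_Times_iff)

lemma continuous_barrier:
  assumes "continuous_on UNIV f" "N \<subseteq> M"
  shows "continuous_on N (\<lambda>P. hyp_linear w h (fst P) * f (snd P))"
proof -
  have "continuous_on N (\<lambda>P. hyp_linear w h (fst P))"
    by (rule continuous_on_compose2[OF hyp_linear_continuous])
      (use assms fst_in_ball in \<open>auto intro!: continuous_intros\<close>)
  moreover have "continuous_on N (\<lambda>P. f (snd P))"
    by (rule continuous_on_compose2[OF assms(1)]) (auto intro!: continuous_intros)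
  ultimately show ?thesis by (rule continuous_on_mult)
qed

lemma compact_slab:
  assumes "\<Gamma> \<inter> (UNIV \<times> {\<alpha>..\<beta>}) = {}"
  shows "compact (M \<inter> (UNIV \<times> {\<alpha>..\<beta>}))"
proof -
  have "M \<inter> (UNIV \<times> {\<alpha>..\<beta>}) = closure M \<inter> (cball 0 1 \<times> {\<alpha>..\<beta>})"
    using closure_M closure_subset[of M] assms M by fastforce
  then show ?thesis by (simp add: closed_Int_compact compact_Times)
qed

text \<open>At a point of \<open>\<Gamma>\<close> over which \<open>h < z \<bullet> w\<close>, the function \<open>hyp_linear w h\<close> tends to infinity. The proof
  multiplies by the denominator: the resulting condition is closed and excludes those points.\<close>
lemma compact_sublevel:
  assumes "closed T" "T \<subseteq> UNIV \<times> {\<alpha>..\<beta>}"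
    and out: "\<And>P. P \<in> \<Gamma> \<Longrightarrow> P \<in> T \<Longrightarrow> h < fst P \<bullet> w"
  shows "compact (M \<inter> T \<inter> {P. hyp_linear w h (fst P) \<le> c})"
proof -
  define R where "R = {P::complex \<times> real. 2 * (fst P \<bullet> w) - h * (1 + fst P \<bullet> fst P) \<le> c * (1 - fst P \<bullet> fst P)}"
  have "closed R" unfolding R_def by (intro closed_Collect_le continuous_intros)
  have "P \<in> M" if "P \<in> closure M" "P \<in> T" "P \<in> R" for P
  proof (rule ccontr)
    assume "P \<notin> M"
    then have "P \<in> \<Gamma>" using that closure_M by blast
    moreover have "fst P \<bullet> fst P = 1" using fst_on_circle[OF \<open>P \<in> \<Gamma>\<close>] by (simp add: dot_square_norm)
    ultimately show False using out[of P] that by (simp add: R_def)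
  qed
  moreover have eq: "P \<in> {P. hyp_linear w h (fst P) \<le> c} \<longleftrightarrow> P \<in> R" if "P \<in> M" for P
    using hyp_linear_le_iff[OF fst_in_ball[OF that]] by (simp add: R_def)
  ultimately have "M \<inter> T \<inter> {P. hyp_linear w h (fst P) \<le> c} = closure M \<inter> (T \<inter> R)"
    using closure_subset[of M] eq by blast
  also have "\<dots> = closure M \<inter> (T \<inter> R) \<inter> (cball 0 1 \<times> {\<alpha>..\<beta>})"
  proof -
    have "closure M \<subseteq> cball 0 1 \<times> UNIV"
    proof (rule closure_minimal)
      show "M \<subseteq> cball 0 1 \<times> UNIV" using M by force
      show "closed (cball (0::complex) 1 \<times> (UNIV::real set))" by (intro closed_Times) auto
    qed
    then show ?thesis using assms(2) by blast
  qed
  finally show ?thesis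
    using \<open>closed T\<close> \<open>closed R\<close> by (simp add: closed_Int_compact closed_Int compact_Times)
qed

text \<open>The function is \<open>f t = sin ((t - \<tau>) / 2)\<close>, which vanishes on the boundary of the slab and
  satisfies \<open>f + f'' > 0\<close> inside, and \<open>C\<close> is the negative of the exponential of a Busemann function. Then
  \<open>C f\<close> is negative inside the slab and zero on its boundary, so it would attain its minimum over \<open>M\<close>
  inside, where \<open>m = 0\<close> and \<open>C < 0\<close> contradict the minimum principle.\<close>
lemma empty_in_wide_slab:
  assumes "K = {}" and \<Gamma>0: "\<Gamma> \<inter> (UNIV \<times> {\<tau>..\<tau> + 2 * pi}) = {}"
  shows "M \<inter> (UNIV \<times> {\<tau><..<\<tau> + 2 * pi}) = {}"
proof (rule ccontr)
  assume "M \<inter> (UNIV \<times> {\<tau><..<\<tau> + 2 * pi}) \<noteq> {}"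
  then obtain P0 where "P0 \<in> M \<inter> (UNIV \<times> {\<tau><..<\<tau> + 2 * pi})" by blast
  then have P0: "P0 \<in> M" "snd P0 \<in> {\<tau><..<\<tau> + 2 * pi}" by (auto simp: mem_Times_iff)
  define N where "N = M \<inter> (UNIV \<times> {\<tau>..\<tau> + 2 * pi})"
  define f where "f = (\<lambda>t. sin ((t - \<tau>) / 2))"
  define f1 where "f1 = (\<lambda>t. cos ((t - \<tau>) / 2) / 2)"
  define f2 where "f2 = (\<lambda>t. - sin ((t - \<tau>) / 2) / 4)"
  define \<Phi> where "\<Phi> = (\<lambda>P. hyp_linear 1 1 (fst P) * f (snd P))"
  have fpos: "f t > 0" if "t \<in> {\<tau><..<\<tau> + 2 * pi}" for t
    unfolding f_def by (rule sin_gt_zero) (use that in auto)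
  have neg: "hyp_linear 1 1 z < 0" if "z \<in> ball 0 1" for z
  proof -
    have "2 * (z \<bullet> 1) - (1 + z \<bullet> z) = - ((z - 1) \<bullet> (z - 1))"
      by (simp add: inner_diff_left inner_diff_right inner_commute)
    moreover have "z \<noteq> 1" using that by auto
    ultimately have "2 * (z \<bullet> 1) - 1 * (1 + z \<bullet> z) < 0" by (simp del: inner_eq_zero_iff)
    then show ?thesis using inner_less_1[OF that] unfolding hyp_linear_def by (intro divide_neg_pos) auto
  qed
  have "compact N" unfolding N_def by (rule compact_slab[OF \<Gamma>0])
  moreover have "P0 \<in> N" using P0 by (auto simp: N_def mem_Times_iff)
  moreover have "continuous_on N \<Phi>" unfolding \<Phi>_def f_def
    by (rule continuous_barrier) (auto simp: N_def intro!: continuous_intros)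
  ultimately obtain P where P: "P \<in> N" and min: "\<And>Q. Q \<in> N \<Longrightarrow> \<Phi> P \<le> \<Phi> Q"
    using continuous_attains_inf[of N \<Phi>] by blast
  have PM: "P \<in> M" and Pt: "snd P \<in> {\<tau>..\<tau> + 2 * pi}" using P by (auto simp: N_def mem_Times_iff)
  have "\<Phi> P0 < 0" unfolding \<Phi>_def using neg[OF fst_in_ball[OF P0(1)]] fpos[OF P0(2)] by (rule mult_neg_pos)
  then have "\<Phi> P < 0" using min[OF \<open>P0 \<in> N\<close>] by simp
  have Pt': "snd P \<in> {\<tau><..<\<tau> + 2 * pi}"
  proof (rule ccontr)
    assume "\<not> ?thesis"
    then have "snd P = \<tau> \<or> snd P = \<tau> + 2 * pi" using Pt by auto
    then have "f (snd P) = 0" by (auto simp: f_def)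
    then show False using \<open>\<Phi> P < 0\<close> by (simp add: \<Phi>_def)
  qed
  have d1: "(f has_real_derivative f1 t) (at t)" and d2: "(f1 has_real_derivative f2 t) (at t)" for t
    unfolding f_def f1_def f2_def by (auto intro!: derivative_eq_intros)
  have "0 \<le> hyp_linear 1 1 (fst P) *
        (((hyp_linear 1 1 (fst P))\<^sup>2 + ((1::complex) \<bullet> 1 - 1\<^sup>2)) * f (snd P) * (f (snd P) + f2 (snd P))
          - 2 * ((1::complex) \<bullet> 1 - 1\<^sup>2) * (f1 (snd P))\<^sup>2)"
  proof (rule minimum_principle[OF PM _ d1 d2 fpos[OF Pt'], where W = "UNIV \<times> {\<tau><..<\<tau> + 2 * pi}"])
    show "P \<notin> K" using \<open>K = {}\<close> by simp
    show "open (UNIV \<times> {\<tau><..<\<tau> + 2 * pi} :: (complex \<times> real) set)" by (intro open_Times) auto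
    show "P \<in> UNIV \<times> {\<tau><..<\<tau> + 2 * pi}" using Pt' by (auto simp: mem_Times_iff)
    show "hyp_linear 1 1 (fst P) * f (snd P) \<le> hyp_linear 1 1 (fst Q) * f (snd Q)"
      if "Q \<in> M" "Q \<in> UNIV \<times> {\<tau><..<\<tau> + 2 * pi}" for Q
      using min[of Q] that by (auto simp: \<Phi>_def N_def mem_Times_iff)
  qed
  moreover have "f (snd P) + f2 (snd P) = 3 / 4 * f (snd P)" by (simp add: f_def f2_def)
  ultimately have "0 \<le> hyp_linear 1 1 (fst P) * ((hyp_linear 1 1 (fst P))\<^sup>2 * f (snd P) * (3 / 4 * f (snd P)))"
    by simp
  moreover have "(hyp_linear 1 1 (fst P))\<^sup>2 * f (snd P) * (3 / 4 * f (snd P)) > 0"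
    using neg[OF fst_in_ball[OF PM]] fpos[OF Pt'] by simp
  ultimately show False using neg[OF fst_in_ball[OF PM]] by (simp add: zero_le_mult_iff)
qed

text \<open>Every height outside the interval is interior to a slab of width \<open>2 \<pi>\<close> that misses \<open>\<Gamma>\<close>. In
  particular \<open>M\<close> cannot escape to infinity in the vertical direction.\<close>
lemma in_slab_of_boundary:
  assumes "K = {}" and \<Gamma>0: "\<Gamma> \<subseteq> UNIV \<times> {\<alpha>..\<beta>}"
  shows "M \<subseteq> UNIV \<times> {\<alpha>..\<beta>}"
proof
  fix P assume P: "P \<in> M"
  have "snd P \<le> \<beta>"
  proof (rule ccontr)
    assume "\<not> snd P \<le> \<beta>"
    define \<tau> where "\<tau> = max ((\<beta> + snd P) / 2) (snd P - pi)"
    have "(\<beta> + snd P) / 2 \<le> \<tau>" "snd P - pi \<le> \<tau>" by (simp_all add: \<tau>_def)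
    moreover have "\<tau> < snd P" using \<open>\<not> snd P \<le> \<beta>\<close> pi_gt_zero by (simp add: \<tau>_def)
    ultimately have "\<tau> > \<beta>" "\<tau> < snd P" "snd P < \<tau> + 2 * pi" using \<open>\<not> snd P \<le> \<beta>\<close> pi_gt_zero by auto
    moreover then have "\<Gamma> \<inter> (UNIV \<times> {\<tau>..\<tau> + 2 * pi}) = {}" using \<Gamma>0 by fastforce
    ultimately show False using empty_in_wide_slab[OF \<open>K = {}\<close>, of \<tau>] P by (auto simp: mem_Times_iff)
  qed
  moreover have "\<alpha> \<le> snd P"
  proof (rule ccontr)
    assume "\<not> \<alpha> \<le> snd P"
    define \<tau> where "\<tau> = min ((\<alpha> + snd P) / 2) (snd P + pi) - 2 * pi"
    have "\<tau> + 2 * pi \<le> (\<alpha> + snd P) / 2" "\<tau> + 2 * pi \<le> snd P + pi"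
      using min.cobounded1[of "(\<alpha> + snd P) / 2" "snd P + pi"] min.cobounded2[of "(\<alpha> + snd P) / 2" "snd P + pi"]
      unfolding \<tau>_def by linarith+
    moreover have "snd P < \<tau> + 2 * pi" using \<open>\<not> \<alpha> \<le> snd P\<close> pi_gt_zero by (simp add: \<tau>_def)
    ultimately have "\<tau> + 2 * pi < \<alpha>" "\<tau> < snd P" "snd P < \<tau> + 2 * pi" using \<open>\<not> \<alpha> \<le> snd P\<close> pi_gt_zero by auto
    moreover then have "\<Gamma> \<inter> (UNIV \<times> {\<tau>..\<tau> + 2 * pi}) = {}" using \<Gamma>0 by fastforce
    ultimately show False using empty_in_wide_slab[OF \<open>K = {}\<close>, of \<tau>] P by (auto simp: mem_Times_iff)
  qed
  ultimately show "P \<in> UNIV \<times> {\<alpha>..\<beta>}" by (auto simp: mem_Times_iff)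
qed

text \<open>The case \<open>f = 1\<close>: a negative minimum of \<open>C\<close> is impossible. Such a minimum would be attained because
  \<open>C\<close> tends to infinity at \<open>\<Gamma>\<close>.\<close>
lemma in_half_space_of_boundary:
  assumes "K = {}" and "\<Gamma> \<subseteq> UNIV \<times> {\<alpha>..\<beta>}"
    and out: "\<And>P. P \<in> \<Gamma> \<Longrightarrow> h < fst P \<bullet> w" and m: "h\<^sup>2 < w \<bullet> w"
    and P: "P \<in> M"
  shows "0 \<le> hyp_linear w h (fst P)"
proof (rule ccontr)
  assume neg: "\<not> 0 \<le> hyp_linear w h (fst P)"
  define c where "c = hyp_linear w h (fst P)"
  define N where "N = M \<inter> (UNIV \<times> {\<alpha>..\<beta>}) \<inter> {P. hyp_linear w h (fst P) \<le> c}"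
  have slab: "M \<subseteq> UNIV \<times> {\<alpha>..\<beta>}" by (rule in_slab_of_boundary[OF assms(1,2)])
  have "compact N" unfolding N_def
    by (rule compact_sublevel[of _ \<alpha> \<beta>]) (use out in \<open>auto intro!: closed_Times\<close>)
  moreover have "P \<in> N" using P slab by (auto simp: N_def c_def)
  moreover have "continuous_on N (\<lambda>P. hyp_linear w h (fst P) * 1)"
    by (rule continuous_barrier) (auto simp: N_def)
  ultimately obtain P1 where P1: "P1 \<in> N" and
    min: "\<And>Q. Q \<in> N \<Longrightarrow> hyp_linear w h (fst P1) * 1 \<le> hyp_linear w h (fst Q) * 1"
    using continuous_attains_inf[of N] by blast
  define C where "C = hyp_linear w h (fst P1)"
  have "P1 \<in> M" and C: "C \<le> c" using P1 by (auto simp: N_def C_def)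
  have d: "((\<lambda>t. 1) has_real_derivative 0) (at t)" "((\<lambda>t. 0) has_real_derivative 0) (at t)" for t :: real
    by (auto intro!: derivative_eq_intros)
  have "0 \<le> hyp_linear w h (fst P1) * (((hyp_linear w h (fst P1))\<^sup>2 + (w \<bullet> w - h\<^sup>2)) * 1 * (1 + 0) - 2 * (w \<bullet> w - h\<^sup>2) * 0\<^sup>2)"
  proof (rule minimum_principle[OF \<open>P1 \<in> M\<close> _ d, where W = UNIV])
    show "hyp_linear w h (fst P1) * 1 \<le> hyp_linear w h (fst Q) * 1" if "Q \<in> M" for Q
      using min[of Q] that C slab by (cases "hyp_linear w h (fst Q) \<le> c") (auto simp: N_def C_def)
  qed (use \<open>K = {}\<close> in auto)
  then have "0 \<le> C * (C\<^sup>2 + (w \<bullet> w - h\<^sup>2))" by (simp add: C_def)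
  moreover have "C\<^sup>2 + (w \<bullet> w - h\<^sup>2) > 0" using m by (simp add: add_nonneg_pos)
  moreover have "C < 0" using C neg by (simp add: c_def)
  ultimately show False by (simp add: zero_le_mult_iff)
qed

end

text \<open>For \<open>f = cos\<close> the claimed estimate reads \<open>0 < 2 m (sin s)\<^sup>2\<close>, but \<open>cos\<close> vanishes at
  \<open>\<plusminus> \<pi> / 2\<close>. The perturbation \<open>s sin s\<close> makes \<open>f\<close> positive there. It also makes \<open>f + f''\<close> positive,
  which is harmful at \<open>s = 0\<close>, where \<open>f'\<close> vanishes, and this is corrected by \<open>cos (3 s)\<close>: in total
  \<open>f + f'' = \<epsilon> cos s (26 - 32 (cos s)\<^sup>2)\<close>. Where this is nonnegative, \<open>|sin s|\<close> is bounded
  below and \<open>f + f'' \<le> 52 \<epsilon> f\<close>, so a small \<open>\<epsilon>\<close> suffices as long as \<open>C f\<close> is bounded.\<close>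
lemma slab_profile:
  fixes B m :: real
  assumes "m > 0"
  obtains f f1 f2 :: "real \<Rightarrow> real" where
    "\<And>s. (f has_real_derivative f1 s) (at s)" "\<And>s. (f1 has_real_derivative f2 s) (at s)"
    "\<And>s. \<bar>s\<bar> \<le> pi / 2 \<Longrightarrow> 0 < f s" "\<And>s. \<bar>s\<bar> \<le> pi / 2 \<Longrightarrow> f s \<le> 2"
    "\<And>s C. \<bar>s\<bar> \<le> pi / 2 \<Longrightarrow> 0 < C \<Longrightarrow> C * f s \<le> B \<Longrightarrow>
       (C\<^sup>2 + m) * f s * (f s + f2 s) < 2 * m * (f1 s)\<^sup>2"
proof -
  define \<epsilon> where "\<epsilon> = min (1 / 30) (m / (1300 * (B\<^sup>2 + 4 * m)))"
  have pos: "B\<^sup>2 + 4 * m > 0" using assms by (simp add: add_nonneg_pos)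
  have \<epsilon>: "\<epsilon> > 0" "\<epsilon> \<le> 1 / 30" "1300 * (B\<^sup>2 + 4 * m) * \<epsilon> \<le> m"
  proof -
    show "\<epsilon> > 0" using assms pos by (simp add: \<epsilon>_def)
    show "\<epsilon> \<le> 1 / 30" unfolding \<epsilon>_def by (rule min.cobounded1)
    have "\<epsilon> \<le> m / (1300 * (B\<^sup>2 + 4 * m))" unfolding \<epsilon>_def by (rule min.cobounded2)
    then show "1300 * (B\<^sup>2 + 4 * m) * \<epsilon> \<le> m" using pos by (simp add: pos_le_divide_eq mult.commute)
  qed
  define f where "f = (\<lambda>s. cos s + \<epsilon> * (s * sin s + cos (3 * s)))"
  define f1 where "f1 = (\<lambda>s. - sin s + \<epsilon> * (sin s + s * cos s - 3 * sin (3 * s)))"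
  define f2 where "f2 = (\<lambda>s. - cos s + \<epsilon> * (2 * cos s - s * sin s - 9 * cos (3 * s)))"
  have d1: "(f has_real_derivative f1 s) (at s)" for s
    unfolding f_def f1_def by (auto intro!: derivative_eq_intros simp: algebra_simps)
  have d2: "(f1 has_real_derivative f2 s) (at s)" for s
    unfolding f1_def f2_def by (auto intro!: derivative_eq_intros simp: algebra_simps)
  have cos3: "cos (3 * s) = 4 * cos s ^ 3 - 3 * cos s" for s :: real by (rule cos_treble_cos)
  have c0: "cos s \<ge> 0" if "\<bar>s\<bar> \<le> pi / 2" for s using that by (intro cos_ge_zero) auto
  have ss: "0 \<le> s * sin s" "s * sin s \<le> 2" if "\<bar>s\<bar> \<le> pi / 2" for s
  proof -
    have "0 \<le> s * sin s \<and> s * sin s \<le> 2" if "0 \<le> s" "s \<le> pi / 2" for s :: real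
    proof
      have "sin s \<ge> 0" using that by (intro sin_ge_zero) auto
      then show "0 \<le> s * sin s" using that by simp
      have "s * sin s \<le> s * 1" using that by (intro mult_left_mono) auto
      then show "s * sin s \<le> 2" using that pi_less_4 by linarith
    qed
    from this[of s] this[of "-s"] that show "0 \<le> s * sin s" "s * sin s \<le> 2" by (cases "s \<ge> 0"; simp)+
  qed
  have lower: "cos s / 2 + \<epsilon> * (s * sin s) \<le> f s" if "\<bar>s\<bar> \<le> pi / 2" for s
  proof -
    have "0 \<le> 4 * cos s ^ 3" using c0[OF that] by simp
    then have "\<epsilon> * (- 3 * cos s) \<le> \<epsilon> * cos (3 * s)" unfolding cos3 using \<epsilon> by (intro mult_left_mono) auto
    moreover have "\<epsilon> * cos s \<le> 1 / 30 * cos s" using c0[OF that] \<epsilon> by (intro mult_right_mono) auto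
    ultimately show ?thesis using c0[OF that] unfolding f_def by (simp add: algebra_simps)
  qed
  have fpos: "f s > 0" if "\<bar>s\<bar> \<le> pi / 2" for s
  proof (cases "cos s = 0")
    case True
    then have "sin s \<noteq> 0" using sin_cos_squared_add[of s] by auto
    moreover have "s \<noteq> 0" using True by auto
    ultimately have "s * sin s > 0" using ss(1)[OF that] by (simp add: less_le)
    then have "\<epsilon> * (s * sin s) > 0" using \<epsilon> by simp
    then show ?thesis using lower[OF that] True by linarith
  next
    case False
    then have "cos s > 0" using c0[OF that] by simp
    moreover have "0 \<le> \<epsilon> * (s * sin s)" using ss(1)[OF that] \<epsilon> by simp
    ultimately show ?thesis using lower[OF that] by linarith
  qed
  have fle: "f s \<le> 2" if "\<bar>s\<bar> \<le> pi / 2" for s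
  proof -
    have "\<epsilon> * (s * sin s + cos (3 * s)) \<le> \<epsilon> * 3"
    proof (rule mult_left_mono)
      show "s * sin s + cos (3 * s) \<le> 3" using ss(2)[OF that] cos_le_one[of "3 * s"] by linarith
    qed (use \<epsilon> in simp)
    then show ?thesis using \<epsilon>(2) cos_le_one[of s] unfolding f_def by linarith
  qed
  have sum: "f s + f2 s = \<epsilon> * (cos s * (26 - 32 * (cos s)\<^sup>2))" for s
    unfolding f_def f2_def cos3 by (simp add: algebra_simps power2_eq_square power3_eq_cube)
  have est: "(C\<^sup>2 + m) * f s * (f s + f2 s) < 2 * m * (f1 s)\<^sup>2"
    if s: "\<bar>s\<bar> \<le> pi / 2" and C: "0 < C" and B: "C * f s \<le> B" for s C
  proof (cases "26 < 32 * (cos s)\<^sup>2")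
    case True
    then have "cos s \<noteq> 0" by auto
    then have "cos s > 0" using c0[OF s] by simp
    then have "f s + f2 s < 0" unfolding sum using True \<epsilon> by (intro mult_pos_neg) auto
    moreover have "(C\<^sup>2 + m) * f s > 0" using assms fpos[OF s] by (simp add: add_nonneg_pos)
    ultimately have "(C\<^sup>2 + m) * f s * (f s + f2 s) < 0" by (rule mult_pos_neg[rotated])
    also have "0 \<le> 2 * m * (f1 s)\<^sup>2" using assms by simp
    finally show ?thesis .
  next
    case False
    have "0 \<le> \<epsilon> * (s * sin s)" using ss(1)[OF s] \<epsilon> by simp
    then have cc: "cos s \<le> 2 * f s" using lower[OF s] by linarith
    have "f s + f2 s \<le> \<epsilon> * (2 * f s * 26)"
      unfolding sum using \<epsilon> cc c0[OF s] False by (intro mult_left_mono mult_mono) auto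
    then have "(C\<^sup>2 + m) * f s * (f s + f2 s) \<le> (C\<^sup>2 + m) * f s * (\<epsilon> * (2 * f s * 26))"
      using assms fpos[OF s] by (intro mult_left_mono) auto
    also have "\<dots> = 52 * \<epsilon> * ((C * f s)\<^sup>2 + m * (f s)\<^sup>2)" by (simp add: algebra_simps power2_eq_square)
    also have "\<dots> \<le> 52 * \<epsilon> * (B\<^sup>2 + m * 4)"
    proof -
      have "(C * f s)\<^sup>2 \<le> B\<^sup>2" using B C fpos[OF s] by (intro power_mono) auto
      moreover have "(f s)\<^sup>2 \<le> 2\<^sup>2" using fle[OF s] fpos[OF s] by (intro power_mono) auto
      then have "m * (f s)\<^sup>2 \<le> m * 4" using assms by (intro mult_left_mono) auto
      ultimately show ?thesis using \<epsilon> by (intro mult_left_mono) auto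
    qed
    also have "\<dots> < 2 * m * (1 / 25)"
    proof -
      have "25 * (52 * \<epsilon> * (B\<^sup>2 + m * 4)) = 1300 * (B\<^sup>2 + 4 * m) * \<epsilon>" by simp
      then show ?thesis using \<epsilon>(3) assms by linarith
    qed
    also have "\<dots> \<le> 2 * m * (f1 s)\<^sup>2"
    proof -
      have "(sin s)\<^sup>2 \<ge> (2 / 5)\<^sup>2" using False sin_cos_squared_add[of s] by (simp add: power2_eq_square)
      then have s25: "\<bar>sin s\<bar> \<ge> 2 / 5" using abs_le_square_iff[of "2 / 5" "sin s"] by simp
      have "\<bar>s * cos s\<bar> \<le> 2 * 1" unfolding abs_mult using s pi_less_4 by (intro mult_mono) auto
      then have "\<bar>sin s + s * cos s - 3 * sin (3 * s)\<bar> \<le> 6"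
        using abs_sin_le_one[of s] abs_sin_le_one[of "3 * s"] by linarith
      then have "\<bar>\<epsilon> * (sin s + s * cos s - 3 * sin (3 * s))\<bar> \<le> 1 / 30 * 6"
        unfolding abs_mult using \<epsilon> by (intro mult_mono) auto
      then have "\<bar>f1 s\<bar> \<ge> 1 / 5" unfolding f1_def using s25 by linarith
      then have "(f1 s)\<^sup>2 \<ge> (1 / 5)\<^sup>2" using abs_le_square_iff[of "1 / 5" "f1 s"] by simp
      then show ?thesis using assms by (simp add: power2_eq_square)
    qed
    finally show ?thesis .
  qed
  show ?thesis by (rule that[OF d1 d2 fpos fle est])
qed

context minimal_set begin

text \<open>The function \<open>C\<close> is a multiple of the hyperbolic sine of the distance to a geodesic
  that separates \<open>\<nu>\<close> from the projection of \<open>\<Gamma>\<close>, and it tends to infinity at \<open>\<Gamma>\<close>. By \<open>in_half_space_of_boundary\<close> it is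
  positive on \<open>M\<close>. If \<open>M\<close> had a point \<open>P0\<close>, the product of \<open>C\<close> with the function \<open>f\<close> of
  \<open>slab_profile\<close>, chosen for the bound \<open>2 C P0\<close>, would attain a minimum over \<open>M\<close>, which the minimum principle
  forbids.\<close>
lemma empty_if_boundary_misses_vertical_line:
  assumes "K = {}" and slab: "\<Gamma> \<subseteq> UNIV \<times> {t0..t0 + pi}"
    and "cmod \<nu> = 1" and \<delta>: "\<delta> > 0" "\<And>P. P \<in> \<Gamma> \<Longrightarrow> fst P \<bullet> \<nu> \<le> 1 - \<delta>"
  shows "M = {}"
proof (rule ccontr)
  assume "M \<noteq> {}"
  then obtain P0 where P0: "P0 \<in> M" by blast
  define \<delta>' where "\<delta>' = min \<delta> 1"
  \<comment> \<open>Two nested half-planes: nonnegativity for the smaller one gives strict positivity for the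
    larger one.\<close>
  define h where "h = - 1 + \<delta>' / 3"
  define h' where "h' = - 1 + \<delta>' / 2"
  define w where "w = - \<nu>"
  have \<delta>': "\<delta>' > 0" "\<delta>' \<le> 1" "\<delta>' \<le> \<delta>" using \<delta> by (auto simp: \<delta>'_def)
  have ww: "w \<bullet> w = 1" using \<open>cmod \<nu> = 1\<close> by (simp add: w_def dot_square_norm)
  define m where "m = w \<bullet> w - h\<^sup>2"
  have hh: "h\<^sup>2 < 1" "h'\<^sup>2 < 1" "h < h'"
    using \<delta>' by (auto simp: h_def h'_def abs_square_less_1)
  then have m: "m > 0" by (simp add: m_def ww)
  have out: "h' < fst P \<bullet> w" "h < fst P \<bullet> w" if "P \<in> \<Gamma>" for P
    using \<delta>(2)[OF that] \<delta>' by (simp_all add: w_def h_def h'_def)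
  have Cpos: "hyp_linear w h (fst P) > 0" if "P \<in> M" for P
  proof -
    have "0 \<le> hyp_linear w h' (fst P)"
      by (rule in_half_space_of_boundary[OF \<open>K = {}\<close> slab out(1) _ that]) (use hh ww in auto)
    moreover have "hyp_linear w h (fst P) - hyp_linear w h' (fst P) = (h' - h) * (1 + fst P \<bullet> fst P) / (1 - fst P \<bullet> fst P)"
      by (simp add: hyp_linear_def diff_divide_distrib[symmetric] algebra_simps)
    moreover have "\<dots> > 0" using hh inner_less_1[OF fst_in_ball[OF that]]
      by (intro divide_pos_pos mult_pos_pos) (auto intro: add_pos_nonneg)
    ultimately show ?thesis by linarith
  qed
  define tm where "tm = t0 + pi / 2"
  obtain g g1 g2 where g: "\<And>s. (g has_real_derivative g1 s) (at s)" "\<And>s. (g1 has_real_derivative g2 s) (at s)"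
    "\<And>s. \<bar>s\<bar> \<le> pi / 2 \<Longrightarrow> 0 < g s" "\<And>s. \<bar>s\<bar> \<le> pi / 2 \<Longrightarrow> g s \<le> 2"
    and est: "\<And>s C. \<bar>s\<bar> \<le> pi / 2 \<Longrightarrow> 0 < C \<Longrightarrow> C * g s \<le> 2 * hyp_linear w h (fst P0) \<Longrightarrow>
       (C\<^sup>2 + m) * g s * (g s + g2 s) < 2 * m * (g1 s)\<^sup>2"
    using slab_profile[OF m] by blast
  define f f1 f2 where "f = (\<lambda>t. g (t - tm))" and "f1 = (\<lambda>t. g1 (t - tm))" and "f2 = (\<lambda>t. g2 (t - tm))"
  have d1: "(f has_real_derivative f1 t) (at t)" and d2: "(f1 has_real_derivative f2 t) (at t)" for t
    using DERIV_shift[of g "g1 (t - tm)" t "- tm"] DERIV_shift[of g1 "g2 (t - tm)" t "- tm"] g(1,2)[of "t - tm"]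
    unfolding f_def f1_def f2_def by simp_all
  have slabM: "M \<subseteq> UNIV \<times> {t0..t0 + pi}" by (rule in_slab_of_boundary[OF \<open>K = {}\<close> slab])
  have tt: "\<bar>snd P - tm\<bar> \<le> pi / 2" if "P \<in> M" for P
  proof -
    have "snd P \<in> {t0..t0 + pi}" using slabM that by (metis mem_Times_iff subsetD)
    then show ?thesis unfolding tm_def abs_le_iff by (simp add: field_simps)
  qed
  have fc: "continuous_on UNIV f" using d1 by (meson DERIV_isCont continuous_at_imp_continuous_on)
  define \<Phi> where "\<Phi> = (\<lambda>P. hyp_linear w h (fst P) * f (snd P))"
  have fpos: "0 < f (snd P)" "f (snd P) \<le> 2" if "P \<in> M" for P
    using g(3,4)[OF tt[OF that]] by (auto simp: f_def)
  have "compact {t0..t0 + pi}" "{t0..t0 + pi} \<noteq> {}" by auto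
  from continuous_attains_inf[OF this continuous_on_subset[OF fc subset_UNIV]]
  obtain t1 where t1: "t1 \<in> {t0..t0 + pi}" "\<And>t. t \<in> {t0..t0 + pi} \<Longrightarrow> f t1 \<le> f t" by blast
  have "\<bar>t1 - tm\<bar> \<le> pi / 2" using t1(1) unfolding tm_def abs_le_iff by (simp add: field_simps)
  from g(3)[OF this] have ft1: "f t1 > 0" by (simp add: f_def)
  define c where "c = \<Phi> P0 / f t1"
  define N where "N = M \<inter> (UNIV \<times> {t0..t0 + pi}) \<inter> {P. hyp_linear w h (fst P) \<le> c}"
  have "compact N" unfolding N_def
    by (rule compact_sublevel[of _ t0 "t0 + pi"]) (use out in \<open>auto intro!: closed_Times\<close>)
  have inN: "P \<in> N" if "P \<in> M" "\<Phi> P \<le> \<Phi> P0" for P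
  proof -
    have "hyp_linear w h (fst P) * f t1 \<le> \<Phi> P"
      unfolding \<Phi>_def using Cpos[OF that(1)] t1(2)[of "snd P"] slabM that(1)
      by (intro mult_left_mono) (auto simp: mem_Times_iff)
    then have "hyp_linear w h (fst P) \<le> c" using that(2) ft1 by (simp add: c_def pos_le_divide_eq)
    then show ?thesis using that slabM by (auto simp: N_def)
  qed
  have "continuous_on N \<Phi>" unfolding \<Phi>_def
    by (rule continuous_barrier[OF fc]) (auto simp: N_def)
  then obtain P where P: "P \<in> N" and minN: "\<And>Q. Q \<in> N \<Longrightarrow> \<Phi> P \<le> \<Phi> Q"
    using continuous_attains_inf[of N \<Phi>] \<open>compact N\<close> inN[OF P0] by blast
  have PM: "P \<in> M" using P by (simp add: N_def)
  have min: "\<Phi> P \<le> \<Phi> Q" if "Q \<in> M" for Q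
    using minN[of Q] minN[OF inN[OF P0]] inN[OF that] by (cases "\<Phi> Q \<le> \<Phi> P0") auto
  have "0 \<le> hyp_linear w h (fst P) *
        (((hyp_linear w h (fst P))\<^sup>2 + (w \<bullet> w - h\<^sup>2)) * f (snd P) * (f (snd P) + f2 (snd P))
          - 2 * (w \<bullet> w - h\<^sup>2) * (f1 (snd P))\<^sup>2)"
    by (rule minimum_principle[OF PM _ d1 d2 fpos(1)[OF PM], where W = UNIV])
      (use min \<open>K = {}\<close> in \<open>auto simp: \<Phi>_def\<close>)
  then have "2 * m * (f1 (snd P))\<^sup>2 \<le> ((hyp_linear w h (fst P))\<^sup>2 + m) * f (snd P) * (f (snd P) + f2 (snd P))"
    using Cpos[OF PM] unfolding m_def[symmetric] by (simp add: zero_le_mult_iff)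
  moreover have "hyp_linear w h (fst P) * f (snd P) \<le> 2 * hyp_linear w h (fst P0)"
  proof -
    have "hyp_linear w h (fst P0) * f (snd P0) \<le> hyp_linear w h (fst P0) * 2"
      using Cpos[OF P0] fpos(2)[OF P0] by (intro mult_left_mono) auto
    then show ?thesis using min[OF P0] by (simp add: \<Phi>_def)
  qed
  ultimately show False
    using est[OF tt[OF PM] Cpos[OF PM]] by (simp add: f_def f1_def f2_def)
qed

end

section \<open>Sliding catenoids\<close>

text \<open>The hyperbolic cosine of the hyperbolic distance from \<open>c\<close> to \<open>z\<close>.\<close>
definition cosh_dist :: "complex \<Rightarrow> complex \<Rightarrow> real" where
  "cosh_dist c z = 1 + 2 * ((z - c) \<bullet> (z - c)) / ((1 - z \<bullet> z) * (1 - c \<bullet> c))"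

lemma cosh_dist_hyp_linear:
  assumes "c \<in> ball 0 1" "z \<in> ball 0 1"
  shows "hyp_linear (- (2 / (1 - c \<bullet> c)) *\<^sub>R c) (- (1 + c \<bullet> c) / (1 - c \<bullet> c)) z = cosh_dist c z"
proof -
  define u v where "u = 1 - z \<bullet> z" and "v = 1 - c \<bullet> c"
  have uv: "u > 0" "v > 0" using assms[THEN inner_less_1] by (simp_all add: u_def v_def)
  have zz: "z \<bullet> z = 1 - u" and cc: "c \<bullet> c = 1 - v" by (simp_all add: u_def v_def)
  have d: "(z - c) \<bullet> (z - c) = 2 - u - v - 2 * (z \<bullet> c)"
    by (simp add: inner_diff_left inner_diff_right zz cc inner_commute[of c z])
  show ?thesis
    unfolding hyp_linear_def cosh_dist_def d inner_scaleR_right zz cc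
    using uv by (simp add: field_simps)
qed

lemma cosh_dist_signature:
  fixes c :: complex
  assumes "c \<in> ball 0 1"
  defines "w \<equiv> - (2 / (1 - c \<bullet> c)) *\<^sub>R c" and "h \<equiv> - (1 + c \<bullet> c) / (1 - c \<bullet> c)"
  shows "w \<bullet> w - h\<^sup>2 = - 1"
    and "\<And>\<zeta>. \<zeta> \<bullet> \<zeta> = 1 \<Longrightarrow> h < \<zeta> \<bullet> w"
proof -
  define v where "v = 1 - c \<bullet> c"
  have v: "v > 0" using inner_less_1[OF assms(1)] by (simp add: v_def)
  have cc: "c \<bullet> c = 1 - v" by (simp add: v_def)
  show "w \<bullet> w - h\<^sup>2 = - 1"
    unfolding w_def h_def inner_scaleR_right inner_scaleR_left cc
    using v by (simp add: field_simps power2_eq_square)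
  fix \<zeta> :: complex assume "\<zeta> \<bullet> \<zeta> = 1"
  then have "(\<zeta> - c) \<bullet> (\<zeta> - c) = 2 - v - 2 * (\<zeta> \<bullet> c)"
    by (simp add: inner_diff_left inner_diff_right cc inner_commute[of c \<zeta>])
  moreover have "\<zeta> \<noteq> c" using \<open>\<zeta> \<bullet> \<zeta> = 1\<close> v cc by auto
  then have "(\<zeta> - c) \<bullet> (\<zeta> - c) > 0" by simp
  ultimately have "2 * (\<zeta> \<bullet> c) < 2 - v" by simp
  then have "2 * (\<zeta> \<bullet> c) / v < (2 - v) / v" using v by (rule divide_strict_right_mono)
  moreover have "h = - ((2 - v) / v)" using v by (simp add: h_def cc minus_divide_left)
  moreover have "\<zeta> \<bullet> w = - (2 * (\<zeta> \<bullet> c) / v)" by (simp add: w_def cc)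
  ultimately show "h < \<zeta> \<bullet> w" by linarith
qed

lemma cosh_dist_le_iff:
  assumes "c \<in> ball 0 1" "z \<in> ball 0 1"
  shows "cosh_dist c z \<le> b \<longleftrightarrow> 2 * ((z - c) \<bullet> (z - c)) \<le> (b - 1) * ((1 - z \<bullet> z) * (1 - c \<bullet> c))"
proof -
  have "(1 - z \<bullet> z) * (1 - c \<bullet> c) > 0" using assms[THEN inner_less_1] by simp
  then have "2 * ((z - c) \<bullet> (z - c)) / ((1 - z \<bullet> z) * (1 - c \<bullet> c)) \<le> b - 1
      \<longleftrightarrow> 2 * ((z - c) \<bullet> (z - c)) \<le> (b - 1) * ((1 - z \<bullet> z) * (1 - c \<bullet> c))"
    by (rule pos_divide_le_eq)
  then show ?thesis by (auto simp: cosh_dist_def)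
qed

text \<open>A hyperbolic ball of fixed radius has Euclidean size comparable with the Euclidean distance of its
  centre to the unit circle.\<close>
lemma cosh_ball_euclidean_size:
  assumes "c \<in> ball 0 1" "z \<in> ball 0 1" "cosh_dist c z \<le> b" "b \<ge> 1"
  shows "cmod (z - c) \<le> 4 * b * (1 - cmod c)"
proof (rule ccontr)
  define \<eta> d where "\<eta> = 1 - cmod c" and "d = cmod (z - c)"
  assume "\<not> cmod (z - c) \<le> 4 * b * (1 - cmod c)"
  then have d: "d > 4 * b * \<eta>" by (simp add: d_def \<eta>_def)
  have \<eta>: "\<eta> > 0" using assms(1) by (simp add: \<eta>_def)
  have zc: "1 - cmod z \<le> \<eta> + d"
    using norm_triangle_ineq4[of z "z - c"] by (simp add: \<eta>_def d_def)
  have z1: "1 - z \<bullet> z \<le> 2 * (\<eta> + d)"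
  proof -
    have "1 - z \<bullet> z = (1 - cmod z) * (1 + cmod z)" by (simp add: dot_square_norm power2_eq_square algebra_simps)
    also have "\<dots> \<le> (\<eta> + d) * 2" using assms(2) zc \<eta> by (intro mult_mono) (auto simp: d_def)
    finally show ?thesis by simp
  qed
  have c1: "1 - c \<bullet> c \<le> 2 * \<eta>"
  proof -
    have "1 - c \<bullet> c = (1 - cmod c) * (1 + cmod c)" by (simp add: dot_square_norm power2_eq_square algebra_simps)
    also have "\<dots> \<le> \<eta> * 2" using assms(1) by (intro mult_mono) (auto simp: \<eta>_def)
    finally show ?thesis by simp
  qed
  have "2 * d\<^sup>2 \<le> (b - 1) * ((1 - z \<bullet> z) * (1 - c \<bullet> c))"
    using assms(3) cosh_dist_le_iff[OF assms(1,2)] by (simp add: d_def dot_square_norm)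
  also have "\<dots> \<le> (b - 1) * ((2 * (\<eta> + d)) * (2 * \<eta>))"
    using assms(4) z1 c1 inner_less_1[OF assms(1)] inner_less_1[OF assms(2)] \<eta>
    by (intro mult_left_mono mult_mono) (auto simp: d_def)
  finally have 1: "d\<^sup>2 \<le> 2 * (b - 1) * (\<eta> * \<eta> + \<eta> * d)" by (simp add: algebra_simps)
  have "\<eta> \<le> 4 * b * \<eta>" using assms(4) \<eta> by (simp add: mult_le_cancel_right1)
  then have "\<eta> < d" "d > 0" using d \<eta> by linarith+
  then have "\<eta> * \<eta> \<le> \<eta> * d" using \<eta> by (intro mult_left_mono) auto
  then have "2 * (b - 1) * (\<eta> * \<eta> + \<eta> * d) \<le> 2 * (b - 1) * (2 * (\<eta> * d))" using assms(4) by (intro mult_left_mono) auto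
  with 1 have "d * d \<le> (4 * (b - 1) * \<eta>) * d" by (simp add: power2_eq_square algebra_simps)
  then have "d \<le> 4 * (b - 1) * \<eta>" using \<open>d > 0\<close> by (rule mult_right_le_imp_le)
  moreover have "4 * (b - 1) * \<eta> < 4 * b * \<eta>" using \<eta> by simp
  ultimately show False using d by linarith
qed

lemma closed_projection_interval:
  fixes A :: "(complex \<times> real) set"
  assumes "closed A"
  shows "closed {z. \<exists>t\<in>{t1..t2}. (z, t) \<in> A}"
proof -
  have "closed ((\<lambda>p::real \<times> complex. (snd p, fst p)) -` A)"
    by (intro closed_vimage assms continuous_intros)
  from closed_compact_projection[OF compact_Icc[of t1 t2] this]
  show ?thesis by (simp add: Bex_def)
qed


context minimal_set begin

text \<open>If, over the window, \<open>M\<close> stays outside the ball of radius \<open>arcosh C1\<close> about \<open>c\<close>, it does not touch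
  this ball either. Otherwise \<open>cosh_dist c z * cos (a (t - tc))\<close>, with \<open>tc\<close> the middle of the window, is at most
  \<open>C1\<close> somewhere on \<open>M\<close>. By the choice of \<open>C0\<close> it exceeds \<open>C1\<close> on the rim of the larger ball, so a
  minimum is attained in the interior of the window and of the larger ball. There the minimum
  principle bounds \<open>(C\<^sup>2 - 1) (a\<^sup>2 - 1) f\<^sup>2\<close> by \<open>2 f'\<^sup>2\<close>, which the choice of \<open>C1\<close> excludes.\<close>

lemma no_contact_with_catenoid:
  assumes c: "c \<in> ball 0 1" and t12: "t1 < t2" and a: "a > 1" "a * (t2 - t1) < pi"
    and c0: "c0 = cos (a * ((t2 - t1) / 2))" and C1: "C1 > 1" "(C1\<^sup>2 - 1) * (a\<^sup>2 - 1) * c0\<^sup>2 > 2 * a\<^sup>2"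
    and C0: "C0 * c0 > C1"
    and ends: "\<And>z. z \<in> ball 0 1 \<Longrightarrow> cosh_dist c z \<le> C0 \<Longrightarrow> (z, t1) \<notin> M \<and> (z, t2) \<notin> M"
    and bdry: "\<And>z t. z \<in> ball 0 1 \<Longrightarrow> cosh_dist c z \<le> C0 \<Longrightarrow> t \<in> {t1..t2} \<Longrightarrow> (z, t) \<notin> K"
    and outside: "\<And>z t. (z, t) \<in> M \<Longrightarrow> t \<in> {t1..t2} \<Longrightarrow> C1 \<le> cosh_dist c z"
    and P0: "P0 \<in> M" "snd P0 \<in> {t1..t2}"
  shows "C1 < cosh_dist c (fst P0)"
proof (rule ccontr)
  assume near: "\<not> C1 < cosh_dist c (fst P0)"
  define tc where "tc = (t1 + t2) / 2"
  define f f1 f2 where "f = (\<lambda>t. cos (a * (t - tc)))" and "f1 = (\<lambda>t. - a * sin (a * (t - tc)))"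
    and "f2 = (\<lambda>t. - a\<^sup>2 * cos (a * (t - tc)))"
  have d1: "(f has_real_derivative f1 t) (at t)" and d2: "(f1 has_real_derivative f2 t) (at t)" for t
    unfolding f_def f1_def f2_def by (auto intro!: derivative_eq_intros simp: power2_eq_square)
  have arg: "a * ((t2 - t1) / 2) < pi / 2" "0 \<le> a * ((t2 - t1) / 2)" using a t12 by auto
  have c0pos: "c0 > 0" unfolding c0 by (rule cos_gt_zero_pi) (use arg in auto)
  have fge: "c0 \<le> f t" if "t \<in> {t1..t2}" for t
  proof -
    have "\<bar>t - tc\<bar> \<le> (t2 - t1) / 2" using that unfolding tc_def abs_le_iff by (simp add: field_simps)
    then have "\<bar>a * (t - tc)\<bar> \<le> a * ((t2 - t1) / 2)" using a by (simp add: abs_mult)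
    then have "cos (a * ((t2 - t1) / 2)) \<le> cos \<bar>a * (t - tc)\<bar>"
      by (intro cos_monotone_0_pi_le) (use arg in auto)
    then show ?thesis by (simp add: c0 f_def)
  qed
  have fle: "f t \<le> 1" for t by (simp add: f_def)
  define w h where "w = - (2 / (1 - c \<bullet> c)) *\<^sub>R c" and "h = - (1 + c \<bullet> c) / (1 - c \<bullet> c)"
  have hl: "hyp_linear w h z = cosh_dist c z" if "z \<in> ball 0 1" for z
    unfolding w_def h_def by (rule cosh_dist_hyp_linear[OF c that])
  have m: "w \<bullet> w - h\<^sup>2 = - 1" unfolding w_def h_def by (rule cosh_dist_signature(1)[OF c])
  define T where "T = (UNIV::complex set) \<times> {t1..t2}"
  define N where "N = M \<inter> T \<inter> {P. hyp_linear w h (fst P) \<le> C0}"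
  define \<Phi> where "\<Phi> = (\<lambda>P. hyp_linear w h (fst P) * f (snd P))"
  have c01: "c0 \<le> 1" by (simp add: c0)
  have "C1 \<le> C0"
  proof -
    have "C0 > 0" using C0 C1 c0pos by (smt (verit) mult_nonpos_nonneg)
    then have "C0 * c0 \<le> C0 * 1" using c01 by (intro mult_left_mono) auto
    then show ?thesis using C0 by simp
  qed
  have "compact N" unfolding N_def
  proof (rule compact_sublevel)
    show "closed T" unfolding T_def by (intro closed_Times) auto
    show "T \<subseteq> UNIV \<times> {t1..t2}" by (simp add: T_def)
    show "h < fst P \<bullet> w" if "P \<in> \<Gamma>" for P
      unfolding h_def w_def by (rule cosh_dist_signature(2)[OF c])
        (use fst_on_circle[OF that] in \<open>simp add: dot_square_norm\<close>)
  qed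
  moreover have N0: "P0 \<in> N"
    using P0 near \<open>C1 \<le> C0\<close> hl[OF fst_in_ball[OF P0(1)]] by (auto simp: N_def T_def mem_Times_iff)
  moreover have "continuous_on N \<Phi>" unfolding \<Phi>_def f_def
    by (rule continuous_barrier) (auto simp: N_def intro!: continuous_intros)
  ultimately obtain P where P: "P \<in> N" and min: "\<And>Q. Q \<in> N \<Longrightarrow> \<Phi> P \<le> \<Phi> Q"
    using continuous_attains_inf[of N \<Phi>] by blast
  define C t where "C = hyp_linear w h (fst P)" and "t = snd P"
  have PM: "P \<in> M" and tT: "t \<in> {t1..t2}" using P by (auto simp: N_def T_def t_def mem_Times_iff)
  have Cd: "C = cosh_dist c (fst P)" using hl[OF fst_in_ball[OF PM]] by (simp add: C_def)
  have C1C: "C1 \<le> C" unfolding Cd using outside[of "fst P" "snd P"] PM tT by (simp add: t_def)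
  have fP: "f t > 0" using fge[OF tT] c0pos by simp
  have "\<Phi> P \<le> C1"
  proof -
    have "\<Phi> P \<le> \<Phi> P0" by (rule min[OF N0])
    also have "\<dots> \<le> C1 * 1" unfolding \<Phi>_def
    proof (rule mult_mono)
      show "hyp_linear w h (fst P0) \<le> C1" using near hl[OF fst_in_ball[OF P0(1)]] by simp
      show "0 \<le> f (snd P0)" using fge[OF P0(2)] c0pos by simp
    qed (use C1 fle in auto)
    finally show ?thesis by simp
  qed
  have "C < C0"
  proof (rule ccontr)
    assume "\<not> C < C0"
    then have "C0 * c0 \<le> C * f t" using fge[OF tT] c0pos C1C C1 by (intro mult_mono) auto
    then show False using \<open>\<Phi> P \<le> C1\<close> C0 by (simp add: \<Phi>_def C_def t_def)
  qed
  define W where "W = (hyp_linear w h -` {..<C0} \<inter> ball 0 1) \<times> {t1<..<t2}"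
  have "open (hyp_linear w h -` {..<C0} \<inter> ball 0 1)"
    using continuous_open_preimage[OF hyp_linear_continuous open_ball open_lessThan]
    by (simp add: Int_commute)
  then have "open W" unfolding W_def by (intro open_Times) auto
  have t_inner: "t \<in> {t1<..<t2}"
  proof -
    have "P = (fst P, t)" by (simp add: t_def)
    with ends[OF fst_in_ball[OF PM]] \<open>C < C0\<close> PM have "t \<noteq> t1" "t \<noteq> t2" by (auto simp: Cd)
    then show ?thesis using tT by auto
  qed
  have "0 \<le> hyp_linear w h (fst P) *
        (((hyp_linear w h (fst P))\<^sup>2 + (w \<bullet> w - h\<^sup>2)) * f (snd P) * (f (snd P) + f2 (snd P))
          - 2 * (w \<bullet> w - h\<^sup>2) * (f1 (snd P))\<^sup>2)"
  proof (rule minimum_principle[OF PM _ d1 d2 _ \<open>open W\<close>])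
    show "P \<notin> K" using bdry[OF fst_in_ball[OF PM] _ tT] \<open>C < C0\<close> by (simp add: Cd t_def)
    show "0 < f (snd P)" using fP by (simp add: t_def)
    show "P \<in> W" using t_inner \<open>C < C0\<close> fst_in_ball[OF PM] by (simp add: W_def t_def C_def mem_Times_iff)
    show "hyp_linear w h (fst P) * f (snd P) \<le> hyp_linear w h (fst Q) * f (snd Q)" if "Q \<in> M" "Q \<in> W" for Q
      using min[of Q] that by (auto simp: \<Phi>_def N_def T_def W_def mem_Times_iff)
  qed
  then have "0 \<le> (C\<^sup>2 - 1) * f t * (f t + f2 t) + 2 * (f1 t)\<^sup>2"
    using C1C C1 unfolding C_def[symmetric] t_def[symmetric] m by (simp add: zero_le_mult_iff)
  also have "f t + f2 t = - (a\<^sup>2 - 1) * f t" by (simp add: f_def f2_def algebra_simps)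
  finally have "(C\<^sup>2 - 1) * (a\<^sup>2 - 1) * (f t)\<^sup>2 \<le> 2 * (f1 t)\<^sup>2" by (simp add: power2_eq_square algebra_simps)
  also have "\<dots> = 2 * (a\<^sup>2 * (sin (a * (t - tc)))\<^sup>2)" by (simp add: f1_def power_mult_distrib)
  also have "\<dots> \<le> 2 * (a\<^sup>2 * 1)"
    by (intro mult_left_mono) (auto simp: abs_square_le_1)
  finally have "(C\<^sup>2 - 1) * (a\<^sup>2 - 1) * (f t)\<^sup>2 \<le> 2 * a\<^sup>2" by simp
  moreover have "(C1\<^sup>2 - 1) * (a\<^sup>2 - 1) * c0\<^sup>2 \<le> (C\<^sup>2 - 1) * (a\<^sup>2 - 1) * (f t)\<^sup>2"
  proof (intro mult_mono)
    show "C1\<^sup>2 - 1 \<le> C\<^sup>2 - 1" using C1C C1 by (simp add: power_mono)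
    show "c0\<^sup>2 \<le> (f t)\<^sup>2" using fge[OF tT] c0pos by (intro power_mono) auto
    have "1\<^sup>2 \<le> a\<^sup>2" using a by (intro power_mono) auto
    then show "0 \<le> a\<^sup>2 - 1" by simp
    have "1\<^sup>2 \<le> C\<^sup>2" using C1 C1C by (intro power_mono) auto
    then show "0 \<le> C\<^sup>2 - 1" by simp
    with \<open>0 \<le> a\<^sup>2 - 1\<close> show "0 \<le> (C\<^sup>2 - 1) * (a\<^sup>2 - 1)" by simp
  qed auto
  ultimately show False using C1 by linarith
qed

text \<open>Continuity method: along the path of centres \<open>c\<close> there would be a first ball that meets \<open>M\<close>. All
  points of \<open>M\<close> over the window lie outside it or on its rim, so the hypothesis \<open>step\<close> applies to it.\<close>

lemma sliding_catenoids:
  fixes c :: "real \<Rightarrow> complex"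
  assumes c: "continuous_on {0..1} c" "\<And>\<sigma>. \<sigma> \<in> {0..1} \<Longrightarrow> c \<sigma> \<in> ball 0 1" and "C1 > 1"
    and start: "\<And>z t. (z, t) \<in> M \<Longrightarrow> t \<in> {t1..t2} \<Longrightarrow> C1 < cosh_dist (c 0) z"
    and step: "\<And>\<sigma> P. \<sigma> \<in> {0..1} \<Longrightarrow>
       (\<And>z t. (z, t) \<in> M \<Longrightarrow> t \<in> {t1..t2} \<Longrightarrow> C1 \<le> cosh_dist (c \<sigma>) z) \<Longrightarrow>
       P \<in> M \<Longrightarrow> snd P \<in> {t1..t2} \<Longrightarrow> C1 < cosh_dist (c \<sigma>) (fst P)"
    and P: "P \<in> M" "snd P \<in> {t1..t2}"
  shows "C1 < cosh_dist (c 1) (fst P)"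
proof -
  define B where "B = {\<sigma> \<in> {0..1}. \<exists>z t. (z, t) \<in> M \<and> t \<in> {t1..t2} \<and> cosh_dist (c \<sigma>) z \<le> C1}"
  define D where "D = {0..1::real} \<times> (closure M \<inter> (cball 0 1 \<times> {t1..t2}))"
  \<comment> \<open>\<open>poly \<le> 0\<close> is the condition \<open>cosh_dist \<le> C1\<close> without denominators, which makes sense up to the
    unit circle and fails on it.\<close>
  define poly where "poly = (\<lambda>(\<sigma>::real, P::complex \<times> real). 2 * ((fst P - c \<sigma>) \<bullet> (fst P - c \<sigma>))
      - (C1 - 1) * ((1 - fst P \<bullet> fst P) * (1 - c \<sigma> \<bullet> c \<sigma>)))"
  have "compact D" unfolding D_def by (intro compact_Times closed_Int_compact) auto
  have cD: "continuous_on D (\<lambda>x. c (fst x))"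
    by (rule continuous_on_compose2[OF c(1)]) (auto simp: D_def intro!: continuous_intros)
  have "continuous_on D poly"
    unfolding poly_def case_prod_beta by (intro continuous_intros cD)
  then have "closedin (top_of_set D) (D \<inter> poly -` {..0})" by (intro continuous_closedin_preimage) auto
  then have "compact (D \<inter> poly -` {..0})" using \<open>compact D\<close> closedin_compact by blast
  then have "compact (fst ` (D \<inter> poly -` {..0}))"
    by (rule compact_continuous_image[rotated]) (auto intro!: continuous_intros)
  moreover have "fst ` (D \<inter> poly -` {..0}) = B"
  proof (intro equalityI subsetI)
    fix \<sigma> assume "\<sigma> \<in> fst ` (D \<inter> poly -` {..0})"
    then obtain Q where Q: "\<sigma> \<in> {0..1}" "Q \<in> closure M" "snd Q \<in> {t1..t2}" "poly (\<sigma>, Q) \<le> 0"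
      by (auto simp: D_def)
    have cs: "c \<sigma> \<in> ball 0 1" by (rule c(2)[OF Q(1)])
    have "Q \<in> M"
    proof (rule ccontr)
      assume "Q \<notin> M"
      then have "Q \<in> \<Gamma>" using Q(2) closure_M by blast
      then have "cmod (fst Q) = 1" using fst_on_circle[of Q] by simp
      then have "fst Q \<bullet> fst Q = 1" by (simp add: dot_square_norm)
      then have "(fst Q - c \<sigma>) \<bullet> (fst Q - c \<sigma>) \<le> 0" using Q(4) by (simp add: poly_def)
      then have "fst Q = c \<sigma>" by (metis eq_iff_diff_eq_0 inner_gt_zero_iff not_less)
      then show False using cs \<open>cmod (fst Q) = 1\<close> by simp
    qed
    then have "cosh_dist (c \<sigma>) (fst Q) \<le> C1"
      using Q(4) cosh_dist_le_iff[OF cs fst_in_ball] by (simp add: poly_def)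
    then show "\<sigma> \<in> B" using Q \<open>Q \<in> M\<close> unfolding B_def by (auto intro!: exI[of _ "fst Q"] exI[of _ "snd Q"])
  next
    fix \<sigma> assume "\<sigma> \<in> B"
    then obtain z t where zt: "\<sigma> \<in> {0..1}" "(z, t) \<in> M" "t \<in> {t1..t2}" "cosh_dist (c \<sigma>) z \<le> C1"
      by (auto simp: B_def)
    have z: "z \<in> ball 0 1" using fst_in_ball[OF zt(2)] by simp
    have "poly (\<sigma>, (z, t)) \<le> 0" using zt cosh_dist_le_iff[OF c(2)[OF zt(1)] z] by (simp add: poly_def)
    moreover have "(\<sigma>, (z, t)) \<in> D" using zt z closure_subset by (auto simp: D_def)
    ultimately show "\<sigma> \<in> fst ` (D \<inter> poly -` {..0})" by force
  qed
  ultimately have "compact B" by simp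
  have "B = {}"
  proof (rule ccontr)
    assume "B \<noteq> {}"
    then obtain \<sigma> where \<sigma>: "\<sigma> \<in> B" and first: "\<And>\<sigma>'. \<sigma>' \<in> B \<Longrightarrow> \<sigma> \<le> \<sigma>'"
      using compact_attains_inf[OF \<open>compact B\<close>] by blast
    obtain z t where zt: "\<sigma> \<in> {0..1}" "(z, t) \<in> M" "t \<in> {t1..t2}" "cosh_dist (c \<sigma>) z \<le> C1"
      using \<sigma> by (auto simp: B_def)
    have "\<sigma> \<noteq> 0" using start[OF zt(2,3)] zt(4) by auto
    then have "\<sigma> > 0" using zt(1) by auto
    have "C1 \<le> cosh_dist (c \<sigma>) z'" if z': "(z', t') \<in> M" "t' \<in> {t1..t2}" for z' t'
    proof (rule ccontr)
      assume less: "\<not> C1 \<le> cosh_dist (c \<sigma>) z'"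
      have zb: "z' \<in> ball 0 1" using fst_in_ball[OF z'(1)] by simp
      have "continuous_on {0..1} (\<lambda>\<sigma>. cosh_dist (c \<sigma>) z')"
        unfolding cosh_dist_def
        by (intro continuous_intros c(1)) (use c(2) inner_less_1 zb in force)
      then have "((\<lambda>\<sigma>. cosh_dist (c \<sigma>) z') \<longlongrightarrow> cosh_dist (c \<sigma>) z') (at \<sigma> within {0..1})"
        using zt(1) by (simp add: continuous_on_def)
      then have "\<forall>\<^sub>F \<sigma>' in at \<sigma> within {0..1}. cosh_dist (c \<sigma>') z' < C1"
        using less by (intro order_tendstoD(2)) auto
      then obtain d where d: "d > 0" "\<And>\<sigma>'. \<sigma>' \<in> {0..1} \<Longrightarrow> \<sigma>' \<noteq> \<sigma> \<Longrightarrow> dist \<sigma>' \<sigma> < d \<Longrightarrow> cosh_dist (c \<sigma>') z' < C1"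
        unfolding eventually_at by blast
      define \<sigma>' where "\<sigma>' = max 0 (\<sigma> - d / 2)"
      have "\<sigma>' \<in> {0..1}" "\<sigma>' < \<sigma>" "dist \<sigma>' \<sigma> < d"
        using \<open>\<sigma> > 0\<close> zt(1) d(1) by (auto simp: \<sigma>'_def dist_real_def)
      then have "\<sigma>' \<in> B" using d(2)[of \<sigma>'] z' unfolding B_def by force
      then show False using first[of \<sigma>'] \<open>\<sigma>' < \<sigma>\<close> by simp
    qed
    from step[OF zt(1) this, where P = "(z, t)"] zt show False by simp
  qed
  then have "(1::real) \<notin> B" by simp
  then show ?thesis using P unfolding B_def by (metis (no_types, lifting) atLeastAtMost_iff linorder_not_less mem_Collect_eq order_refl prod.collapse zero_le_one)
qed

text \<open>At the vertical line over \<open>\<omega>\<close> the curve \<open>\<Gamma>\<close> has a point inside the window, while arbitrarily close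
  vertical segments miss \<open>\<Gamma>\<close>. Near such a segment there are no points of \<open>M\<close>, and balls with centres
  there can be moved to a point of \<open>M\<close> near \<open>(\<omega>, e)\<close>. All centres stay so close to \<open>\<omega>\<close> that the balls
  meet neither \<open>K\<close> nor the part of \<open>M\<close> at the two ends of the window.\<close>

lemma no_free_end:
  assumes \<omega>: "cmod \<omega> = 1" and t12: "t2 - t1 < pi" and e: "e \<in> {t1<..<t2}"
    and end_point: "(\<omega>, e) \<in> closure M" and ends: "(\<omega>, t1) \<notin> \<Gamma>" "(\<omega>, t2) \<notin> \<Gamma>"
    and bdry: "\<And>t. t \<in> {t1..t2} \<Longrightarrow> (\<omega>, t) \<notin> closure K"
    and free: "\<And>r. r > 0 \<Longrightarrow> \<exists>\<zeta>. cmod \<zeta> = 1 \<and> dist \<omega> \<zeta> < r \<and> (\<forall>t\<in>{t1..t2}. (\<zeta>, t) \<notin> \<Gamma>)"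
  shows False
proof -
  have "t1 < t2" using e by auto
  \<comment> \<open>Any \<open>a\<close> strictly between \<open>1\<close> and \<open>\<pi> / (t2 - t1)\<close> makes \<open>cos (a (t - tc))\<close> positive on the
    window, with minimum \<open>c0\<close>.\<close>
  define b where "b = pi / (t2 - t1)"
  define a where "a = (1 + b) / 2"
  have "b > 1" using t12 \<open>t1 < t2\<close> by (simp add: b_def)
  then have a: "a > 1" "a < b" by (auto simp: a_def)
  then have a': "a * (t2 - t1) < pi" using \<open>t1 < t2\<close> by (simp add: b_def pos_less_divide_eq)
  define c0 where "c0 = cos (a * ((t2 - t1) / 2))"
  have "0 \<le> a * ((t2 - t1) / 2)" "a * ((t2 - t1) / 2) < pi / 2" using a a' \<open>t1 < t2\<close> by auto
  then have c0: "c0 > 0" unfolding c0_def by (intro cos_gt_zero_pi) auto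
  have a2: "a\<^sup>2 - 1 > 0" using a(1) by simp
  define x where "x = 2 * a\<^sup>2 / ((a\<^sup>2 - 1) * c0\<^sup>2) + 1"
  have x: "x > 0" using a2 c0 unfolding x_def by (intro add_nonneg_pos divide_nonneg_pos mult_pos_pos) auto
  define C1 where "C1 = 1 + x"
  have C1: "C1 > 1" "(C1\<^sup>2 - 1) * (a\<^sup>2 - 1) * c0\<^sup>2 > 2 * a\<^sup>2"
  proof -
    show "C1 > 1" using x by (simp add: C1_def)
    have p: "(a\<^sup>2 - 1) * c0\<^sup>2 > 0" using a2 c0 by simp
    have "2 * a\<^sup>2 = (x - 1) * ((a\<^sup>2 - 1) * c0\<^sup>2)" using a2 c0 by (simp add: x_def)
    also have "\<dots> < (C1\<^sup>2 - 1) * ((a\<^sup>2 - 1) * c0\<^sup>2)"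
    proof (rule mult_strict_right_mono[OF _ p])
      have "C1\<^sup>2 - 1 = 2 * x + x\<^sup>2" by (simp add: C1_def power2_eq_square algebra_simps)
      moreover have "x\<^sup>2 \<ge> 0" by simp
      ultimately show "x - 1 < C1\<^sup>2 - 1" using x by linarith
    qed
    finally show "(C1\<^sup>2 - 1) * (a\<^sup>2 - 1) * c0\<^sup>2 > 2 * a\<^sup>2" by (simp add: mult.assoc)
  qed
  define C0 where "C0 = C1 / c0 + C1"
  have C0: "C0 * c0 > C1" "C1 \<le> C0" "C0 \<ge> 1"
  proof -
    have "C1 / c0 > 0" using c0 C1(1) by simp
    then show "C1 \<le> C0" "C0 \<ge> 1" using C1(1) by (simp_all add: C0_def)
    have "C1 * c0 > 0" using c0 C1(1) by simp
    then show "C0 * c0 > C1" using c0 by (simp add: C0_def distrib_right)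
  qed
  have not_closure: "(\<zeta>, t) \<notin> closure M" if "cmod \<zeta> = 1" "(\<zeta>, t) \<notin> \<Gamma>" for \<zeta> t
    using that closure_M fst_in_ball[of "(\<zeta>, t)"] by auto
  define bad where "bad = {z. \<exists>t\<in>{t1..t2}. (z, t) \<in> closure K} \<union> {z. \<exists>t\<in>{t1..t1}. (z, t) \<in> closure M}
      \<union> {z. \<exists>t\<in>{t2..t2}. (z, t) \<in> closure M}"
  have "closed bad" unfolding bad_def by (intro closed_Un closed_projection_interval) auto
  moreover have "\<omega> \<notin> bad" using bdry ends not_closure \<omega> by (auto simp: bad_def)
  ultimately have "open (- bad)" "\<omega> \<in> - bad" by auto
  then obtain r where r: "r > 0" "ball \<omega> r \<subseteq> - bad" by (rule openE)
  \<comment> \<open>A ball about a centre at distance \<open>\<rho>\<close> from \<open>\<omega>\<close> lies within distance \<open>A \<rho>\<close> of \<open>\<omega>\<close>.\<close>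
  define A where "A = 4 * C0 + 1"
  have A: "A > 1" using C0 by (simp add: A_def)
  define \<rho> where "\<rho> = r / A"
  have \<rho>: "\<rho> > 0" using r A by (simp add: \<rho>_def)
  obtain \<zeta> where \<zeta>: "cmod \<zeta> = 1" "dist \<omega> \<zeta> < \<rho> / 2" and \<zeta>_free: "\<forall>t\<in>{t1..t2}. (\<zeta>, t) \<notin> \<Gamma>"
    using free[of "\<rho> / 2"] \<rho> by auto
  define met where "met = {z. \<exists>t\<in>{t1..t2}. (z, t) \<in> closure M}"
  have "closed met" unfolding met_def by (rule closed_projection_interval) simp
  moreover have "\<zeta> \<notin> met" using \<zeta>_free not_closure \<zeta>(1) by (auto simp: met_def)
  ultimately have "open (- met)" "\<zeta> \<in> - met" by auto
  then obtain r1 where r1: "r1 > 0" "ball \<zeta> r1 \<subseteq> - met" by (rule openE)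
  obtain P where P: "P \<in> M" "dist (\<omega>, e) P < min \<rho> (min (e - t1) (t2 - e))"
  proof -
    have "min \<rho> (min (e - t1) (t2 - e)) > 0" using \<rho> e by auto
    from closure_approachable[THEN iffD1, OF end_point, rule_format, OF this]
    show ?thesis using that by (auto simp: dist_commute)
  qed
  have P1: "dist \<omega> (fst P) < \<rho>" "snd P \<in> {t1..t2}"
  proof -
    show "dist \<omega> (fst P) < \<rho>" using P(2) dist_fst_le[of "(\<omega>, e)" P] by simp
    have "dist e (snd P) < min (e - t1) (t2 - e)" using P(2) dist_snd_le[of "(\<omega>, e)" P] by simp
    then show "snd P \<in> {t1..t2}" by (auto simp: dist_real_def abs_less_iff)
  qed
  define \<eta> where "\<eta> = min (1 / 2) (min (\<rho> / 4) (r1 / (2 * A)))"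
  have \<eta>: "0 < \<eta>" "\<eta> \<le> 1 / 2" "\<eta> \<le> \<rho> / 4" "\<eta> \<le> r1 / (2 * A)"
    using \<rho> r1 A unfolding \<eta>_def by (auto intro: min.coboundedI1 min.coboundedI2)
  define z0 where "z0 = (1 - \<eta>) *\<^sub>R \<zeta>"
  have z0: "cmod z0 = 1 - \<eta>" using \<eta> \<zeta> by (simp add: z0_def)
  have "z0 - \<zeta> = (- \<eta>) *\<^sub>R \<zeta>" by (simp add: z0_def algebra_simps)
  then have z0\<zeta>: "cmod (z0 - \<zeta>) = \<eta>" using \<eta> \<zeta> by simp
  have z0\<omega>: "dist \<omega> z0 < \<rho>"
    using dist_triangle[of \<omega> z0 \<zeta>] \<zeta>(2) z0\<zeta> \<eta> by (simp add: dist_norm norm_minus_commute)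
  \<comment> \<open>A straight segment will do as path, since Euclidean balls about \<open>\<omega>\<close> are convex.\<close>
  define c where "c = (\<lambda>\<sigma>. (1 - \<sigma>) *\<^sub>R z0 + \<sigma> *\<^sub>R fst P)"
  have c_in: "c \<sigma> \<in> ball 0 1 \<inter> ball \<omega> \<rho>" if "\<sigma> \<in> {0..1}" for \<sigma>
  proof -
    have "convex (ball 0 1 \<inter> ball \<omega> \<rho>)" by (intro convex_Int convex_ball)
    moreover have "z0 \<in> ball 0 1 \<inter> ball \<omega> \<rho>" using z0 z0\<omega> \<eta> by simp
    moreover have "fst P \<in> ball 0 1 \<inter> ball \<omega> \<rho>" using P1(1) fst_in_ball[OF P(1)] by simp
    ultimately show ?thesis unfolding c_def using that by (intro convexD_alt) auto
  qed
  have size: "dist \<xi> z < A * dist \<xi> p + s" if "cmod \<xi> = 1" "p \<in> ball 0 1" "z \<in> ball 0 1" "cosh_dist p z \<le> C0" "s > 0" for p z \<xi> s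
  proof -
    have "cmod (z - p) \<le> 4 * C0 * (1 - cmod p)"
      by (rule cosh_ball_euclidean_size) (use that C0 in auto)
    also have "\<dots> \<le> 4 * C0 * dist \<xi> p"
      using norm_triangle_ineq2[of \<xi> p] that(1) C0 by (intro mult_left_mono) (auto simp: dist_norm)
    finally have "dist p z \<le> 4 * C0 * dist \<xi> p" by (simp add: dist_norm norm_minus_commute)
    with dist_triangle[of \<xi> z p] \<open>s > 0\<close> show ?thesis by (simp add: A_def distrib_right)
  qed
  have near: "z \<in> ball \<omega> r" if "\<sigma> \<in> {0..1}" "z \<in> ball 0 1" "cosh_dist (c \<sigma>) z \<le> C0" for \<sigma> z
  proof -
    have "A * dist \<omega> (c \<sigma>) < A * \<rho>" using c_in[OF that(1)] A by (intro mult_strict_left_mono) auto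
    then have "A * dist \<omega> (c \<sigma>) < r" using A by (simp add: \<rho>_def)
    then show ?thesis
      using size[OF \<omega>, of "c \<sigma>" z "r - A * dist \<omega> (c \<sigma>)"] c_in[OF that(1)] that(2,3) by simp
  qed
  have "C1 < cosh_dist (c 1) (fst P)"
  proof (rule sliding_catenoids[OF _ _ C1(1)])
    show "continuous_on {0..1} c" unfolding c_def by (intro continuous_intros)
    show "c \<sigma> \<in> ball 0 1" if "\<sigma> \<in> {0..1}" for \<sigma> using c_in[OF that] by simp
    show "C1 < cosh_dist (c 0) z" if zt: "(z, t) \<in> M" "t \<in> {t1..t2}" for z t
    proof (rule ccontr)
      assume "\<not> C1 < cosh_dist (c 0) z"
      then have "cosh_dist (c 0) z \<le> C0" using C0 by simp
      moreover have "c 0 = z0" by (simp add: c_def)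
      moreover have "z0 \<in> ball 0 1" using z0 \<eta> by simp
      moreover have "A * dist \<zeta> z0 \<le> r1 / 2"
      proof -
        have "A * dist \<zeta> z0 \<le> A * (r1 / (2 * A))" using z0\<zeta> \<eta>(4) A by (intro mult_left_mono) (auto simp: dist_norm norm_minus_commute)
        then show ?thesis using A by simp
      qed
      ultimately have "dist \<zeta> z < r1"
        using size[OF \<zeta>(1), of z0 z "r1 / 2"] fst_in_ball[OF zt(1)] r1(1) by simp
      then have "z \<notin> met" using r1(2) by auto
      moreover have "z \<in> met" unfolding met_def using zt closure_subset[of M] by blast
      ultimately show False by simp
    qed
    show "C1 < cosh_dist (c \<sigma>) (fst Q)" if \<sigma>: "\<sigma> \<in> {0..1}"
      and out: "\<And>z t. (z, t) \<in> M \<Longrightarrow> t \<in> {t1..t2} \<Longrightarrow> C1 \<le> cosh_dist (c \<sigma>) z"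
      and Q: "Q \<in> M" "snd Q \<in> {t1..t2}" for \<sigma> Q
    proof (rule no_contact_with_catenoid[OF _ \<open>t1 < t2\<close> a(1) a' c0_def C1 C0(1) _ _ out Q])
      show "c \<sigma> \<in> ball 0 1" using c_in[OF \<sigma>] by simp
      show "(z, t1) \<notin> M \<and> (z, t2) \<notin> M" if "z \<in> ball 0 1" "cosh_dist (c \<sigma>) z \<le> C0" for z
      proof -
        have "z \<notin> bad" using near[OF \<sigma> that] r(2) by blast
        then show ?thesis using closure_subset[of M] unfolding bad_def by auto
      qed
      show "(z, t) \<notin> K" if "z \<in> ball 0 1" "cosh_dist (c \<sigma>) z \<le> C0" "t \<in> {t1..t2}" for z t
      proof -
        have "z \<notin> bad" using near[OF \<sigma> that(1,2)] r(2) by blast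
        then show ?thesis using closure_subset[of K] that(3) unfolding bad_def by blast
      qed
    qed
  qed (use P(1) P1(2) in auto)
  moreover have "cosh_dist (c 1) (fst P) = 1" by (simp add: c_def cosh_dist_def)
  ultimately show False using C1(1) by simp
qed

end

section \<open>Null-homologous loops in the cylinder\<close>

lemma cis_eq_iff: "cis a = cis b \<longleftrightarrow> (\<exists>n::int. a = b + 2 * pi * n)"
  using sin_cos_eq_iff[of a b] by (auto simp: complex_eq_iff)

lemma circle_lift:
  fixes f :: "'a::real_normed_vector \<Rightarrow> complex"
  assumes "continuous_on S f" "contractible S" "\<And>x. x \<in> S \<Longrightarrow> cmod (f x) = 1"
  obtains \<theta> where "continuous_on S \<theta>" "\<And>x. x \<in> S \<Longrightarrow> f x = cis (\<theta> x)"
proof -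
  have "f x \<noteq> 0" if "x \<in> S" for x using assms(3)[OF that] by auto
  then obtain h where h: "continuous_on S h" "\<And>x. x \<in> S \<Longrightarrow> f x = exp (h x)"
    using continuous_logarithm_on_contractible[OF assms(1,2)] by blast
  show ?thesis
  proof
    show "continuous_on S (\<lambda>x. Im (h x))" by (intro continuous_intros h)
    fix x assume x: "x \<in> S"
    then have "exp (Re (h x)) = 1" using assms(3)[OF x] h(2)[OF x] by simp
    then show "f x = cis (Im (h x))" using h(2)[OF x] by (simp add: exp_eq_polar)
  qed
qed

definition angle_variation :: "(real \<Rightarrow> complex) \<Rightarrow> real" where
  "angle_variation f = (THE d. \<exists>\<theta>. continuous_on {0..1} \<theta> \<and> (\<forall>s\<in>{0..1}. f s = cis (\<theta> s)) \<and> d = \<theta> 1 - \<theta> 0)"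

text \<open>Two lifts differ by a continuous function with values in the multiples of \<open>2 \<pi>\<close>, that is, by a
  constant.\<close>
lemma angle_variation_eq:
  assumes \<theta>: "continuous_on {0..1} \<theta>" "\<And>s. s \<in> {0..1} \<Longrightarrow> f s = cis (\<theta> s)"
  shows "angle_variation f = \<theta> 1 - \<theta> 0"
  unfolding angle_variation_def
proof (rule the_equality)
  show "\<exists>\<theta>'. continuous_on {0..1} \<theta>' \<and> (\<forall>s\<in>{0..1}. f s = cis (\<theta>' s)) \<and> \<theta> 1 - \<theta> 0 = \<theta>' 1 - \<theta>' 0"
    using \<theta> by blast
  fix d assume "\<exists>\<theta>'. continuous_on {0..1} \<theta>' \<and> (\<forall>s\<in>{0..1}. f s = cis (\<theta>' s)) \<and> d = \<theta>' 1 - \<theta>' 0"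
  then obtain \<theta>' where \<theta>': "continuous_on {0..1} \<theta>'" "\<And>s. s \<in> {0..1} \<Longrightarrow> f s = cis (\<theta>' s)" and d: "d = \<theta>' 1 - \<theta>' 0"
    by blast
  define k where "k = (\<lambda>s. \<theta> s - \<theta>' s)"
  have mult: "\<exists>n::int. k s = 2 * pi * n" if "s \<in> {0..1}" for s
    using \<theta>(2)[OF that] \<theta>'(2)[OF that] cis_eq_iff[of "\<theta> s" "\<theta>' s"] by (auto simp: k_def)
  have "k constant_on {0..1}"
  proof (rule continuous_discrete_range_constant)
    show "continuous_on {0..1} k" unfolding k_def by (intro continuous_intros \<theta> \<theta>')
    fix x :: real assume x: "x \<in> {0..1}"
    have "2 * pi \<le> norm (k y - k x)" if y: "y \<in> {0..1}" "k y \<noteq> k x" for y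
    proof -
      obtain n n' :: int where n: "k x = 2 * pi * n" "k y = 2 * pi * n'" using mult x y(1) by blast
      then have "n' \<noteq> n" using y(2) by auto
      then have "\<bar>real_of_int (n' - n)\<bar> \<ge> 1" by linarith
      moreover have "k y - k x = 2 * pi * real_of_int (n' - n)" by (simp add: n algebra_simps)
      then have "norm (k y - k x) = 2 * pi * \<bar>real_of_int (n' - n)\<bar>" by (simp add: abs_mult)
      ultimately show ?thesis by (simp only:) simp
    qed
    then show "\<exists>e>0. \<forall>y. y \<in> {0..1} \<and> k y \<noteq> k x \<longrightarrow> e \<le> norm (k y - k x)"
      by (intro exI[of _ "2 * pi"]) auto
  qed auto
  then have "k 1 = k 0" unfolding constant_on_def by force
  then show "d = \<theta> 1 - \<theta> 0" by (simp add: k_def d)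
qed

text \<open>Points of the standard simplex by two of their coordinates; the values \<open>v = 0\<close> give the
  standard 1-simplex, parametrized by \<open>u\<close>.\<close>
definition simplex_point :: "real \<Rightarrow> real \<Rightarrow> nat \<Rightarrow> real" where
  "simplex_point u v = (\<lambda>i. if i = 0 then 1 - u - v else if i = 1 then u else if i = 2 then v else 0)"

lemma simplex_point_in:
  assumes "0 \<le> u" "0 \<le> v" "u + v \<le> 1"
  shows "simplex_point u v \<in> standard_simplex 2"
    and "v = 0 \<Longrightarrow> simplex_point u v \<in> standard_simplex 1"
  using assms unfolding standard_simplex_def simplex_point_def
  by (auto simp: numeral_2_eq_2)

lemma simplical_face_simplex_point:
  "simplical_face 0 (simplex_point s 0) = simplex_point (1 - s) s"
  "simplical_face 1 (simplex_point s 0) = simplex_point 0 s"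
  "simplical_face 2 (simplex_point s 0) = simplex_point s 0"
  unfolding simplical_face_def simplex_point_def by (auto simp: fun_eq_iff)

text \<open>The linear extension to chains of a real-valued function on simplices.\<close>
definition chain_weight :: "('c \<Rightarrow> real) \<Rightarrow> ('c \<Rightarrow>\<^sub>0 int) \<Rightarrow> real" where
  "chain_weight w c = (\<Sum>x\<in>Poly_Mapping.keys c. of_int (Poly_Mapping.lookup c x) * w x)"

lemma chain_weight_superset:
  assumes "finite A" "Poly_Mapping.keys c \<subseteq> A"
  shows "chain_weight w c = (\<Sum>x\<in>A. of_int (Poly_Mapping.lookup c x) * w x)"
  unfolding chain_weight_def
  by (rule sum.mono_neutral_left[OF assms]) (auto simp: in_keys_iff)

lemma chain_weight_add: "chain_weight w (a + b) = chain_weight w a + chain_weight w b"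
proof -
  define A where "A = Poly_Mapping.keys a \<union> Poly_Mapping.keys b"
  have A: "finite A" "Poly_Mapping.keys a \<subseteq> A" "Poly_Mapping.keys b \<subseteq> A" "Poly_Mapping.keys (a + b) \<subseteq> A"
    unfolding A_def using keys_add[of a b] by auto
  show ?thesis
    unfolding chain_weight_superset[OF A(1,2)] chain_weight_superset[OF A(1,3)] chain_weight_superset[OF A(1,4)]
    by (simp add: lookup_add distrib_right sum.distrib)
qed

lemma chain_weight_0: "chain_weight w 0 = 0"
  by (simp add: chain_weight_def)

lemma chain_weight_sum: "chain_weight w (sum f I) = (\<Sum>i\<in>I. chain_weight w (f i))"
  by (induction I rule: infinite_finite_induct) (auto simp: chain_weight_0 chain_weight_add)

lemma chain_weight_cmul: "chain_weight w (frag_cmul k c) = of_int k * chain_weight w c"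
proof -
  have "chain_weight w (frag_cmul k c) = (\<Sum>x\<in>Poly_Mapping.keys c. of_int (Poly_Mapping.lookup (frag_cmul k c) x) * w x)"
    by (rule chain_weight_superset[OF finite_keys keys_cmul])
  then show ?thesis by (simp add: chain_weight_def sum_distrib_left mult.assoc)
qed

lemma chain_weight_of: "chain_weight w (frag_of x) = w x"
  by (simp add: chain_weight_def)

definition edge_variation :: "((nat \<Rightarrow> real) \<Rightarrow> complex \<times> real) \<Rightarrow> real" where
  "edge_variation \<tau> = angle_variation (\<lambda>s. fst (\<tau> (simplex_point s 0)))"

text \<open>The triangle is contractible, so the angle has a lift on all of it, and the variations of the lift along
  the three edges cancel.\<close>
lemma edge_variation_boundary:
  assumes "singular_simplex 2 (top_of_set H2R_infinity) \<sigma>"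
  shows "chain_weight edge_variation (\<Sum>k\<le>2. frag_cmul ((-1) ^ k) (frag_of (singular_face 2 k \<sigma>))) = 0"
proof -
  define T where "T = {p::real \<times> real. 0 \<le> fst p \<and> 0 \<le> snd p \<and> fst p + snd p \<le> 1}"
  define f where "f = (\<lambda>p. fst (\<sigma> (simplex_point (fst p) (snd p))))"
  have "convex T"
  proof (rule convexI)
    fix x y :: "real \<times> real" and u v :: real
    assume x: "x \<in> T" "y \<in> T" and u: "0 \<le> u" "0 \<le> v" "u + v = 1"
    have "u * (fst x + snd x) + v * (fst y + snd y) \<le> u * 1 + v * 1"
      using x u by (intro add_mono mult_left_mono) (auto simp: T_def)
    moreover have "u * fst x + v * fst y + (u * snd x + v * snd y) = u * (fst x + snd x) + v * (fst y + snd y)"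
      by (simp add: algebra_simps)
    ultimately have "u * fst x + v * fst y + (u * snd x + v * snd y) \<le> 1" using u by linarith
    then show "u *\<^sub>R x + v *\<^sub>R y \<in> T" using x u by (auto simp: T_def)
  qed
  then have "contractible T" by (rule convex_imp_contractible)
  have \<sigma>: "continuous_map (subtopology (powertop_real UNIV) (standard_simplex 2)) (top_of_set H2R_infinity) \<sigma>"
    using assms by (simp add: singular_simplex_def)
  have comp: "continuous_map (top_of_set T) euclideanreal (\<lambda>p. simplex_point (fst p) (snd p) i)" for i
    unfolding simplex_point_def continuous_map_iff_continuous
    by (cases "i = 0"; cases "i = 1"; cases "i = 2") (auto intro!: continuous_intros)
  have "continuous_map (top_of_set T) (subtopology (powertop_real UNIV) (standard_simplex 2)) (\<lambda>p. simplex_point (fst p) (snd p))"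
    unfolding continuous_map_in_subtopology continuous_map_componentwise_UNIV
    using comp simplex_point_in(1) by (auto simp: T_def)
  from continuous_map_compose[OF this \<sigma>]
  have c: "continuous_map (top_of_set T) (top_of_set H2R_infinity) (\<lambda>p. \<sigma> (simplex_point (fst p) (snd p)))"
    by (simp add: o_def)
  then have "continuous_on T (\<lambda>p. \<sigma> (simplex_point (fst p) (snd p)))"
    and im: "\<And>p. p \<in> T \<Longrightarrow> \<sigma> (simplex_point (fst p) (snd p)) \<in> H2R_infinity"
    by (auto simp: continuous_map_in_subtopology)
  then have "continuous_on T f" unfolding f_def by (intro continuous_intros)
  moreover have "cmod (f p) = 1" if "p \<in> T" for p using im[OF that] by (auto simp: f_def mem_Times_iff)
  ultimately obtain \<theta> where \<theta>: "continuous_on T \<theta>" "\<And>p. p \<in> T \<Longrightarrow> f p = cis (\<theta> p)"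
    using circle_lift[OF _ \<open>contractible T\<close>] by blast
  have face: "edge_variation (singular_face 2 k \<sigma>) = \<theta> (q 1) - \<theta> (q 0)"
    if k: "k \<le> 2" and q: "continuous_on {0..1} q" "\<And>s. s \<in> {0..1} \<Longrightarrow> q s \<in> T"
      and eq: "\<And>s. simplical_face k (simplex_point s 0) = simplex_point (fst (q s)) (snd (q s))"
    for k and q :: "real \<Rightarrow> real \<times> real"
    unfolding edge_variation_def
  proof (rule angle_variation_eq)
    show "continuous_on {0..1} (\<lambda>s. \<theta> (q s))"
      by (rule continuous_on_compose2[OF \<theta>(1) q(1)]) (use q in auto)
    fix s :: real assume s: "s \<in> {0..1}"
    have "simplex_point s 0 \<in> standard_simplex 1" using s by (intro simplex_point_in(2)) auto
    then have "singular_face 2 k \<sigma> (simplex_point s 0) = \<sigma> (simplex_point (fst (q s)) (snd (q s)))"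
      by (simp add: singular_face_def eq)
    then show "fst (singular_face 2 k \<sigma> (simplex_point s 0)) = cis (\<theta> (q s))"
      using \<theta>(2)[OF q(2)[OF s]] by (simp add: f_def)
  qed
  have "edge_variation (singular_face 2 0 \<sigma>) = \<theta> (0, 1) - \<theta> (1, 0)"
  proof -
    have "continuous_on {0..1} (\<lambda>s::real. (1 - s, s))" by (intro continuous_intros)
    from face[where k = 0, OF _ this] show ?thesis by (simp add: T_def simplical_face_simplex_point simplical_face_simplex_point[unfolded One_nat_def])
  qed
  moreover have "edge_variation (singular_face 2 1 \<sigma>) = \<theta> (0, 1) - \<theta> (0, 0)"
  proof -
    have "continuous_on {0..1} (\<lambda>s::real. (0, s))" by (intro continuous_intros)
    from face[where k = 1, OF _ this] show ?thesis by (simp add: T_def simplical_face_simplex_point simplical_face_simplex_point[unfolded One_nat_def])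
  qed
  moreover have "edge_variation (singular_face 2 2 \<sigma>) = \<theta> (1, 0) - \<theta> (0, 0)"
  proof -
    have "continuous_on {0..1} (\<lambda>s::real. (s, 0))" by (intro continuous_intros)
    from face[where k = 2, OF _ this] show ?thesis by (simp add: T_def simplical_face_simplex_point simplical_face_simplex_point[unfolded One_nat_def])
  qed
  moreover have "{..2::nat} = {0, 1, 2}" by auto
  ultimately show ?thesis
    unfolding chain_weight_sum chain_weight_cmul chain_weight_of by simp
qed

text \<open>By \<open>edge_variation_boundary\<close> the variation of the angle is a cocycle, so it vanishes on a loop that
  bounds a chain.\<close>
lemma null_homologous_loop_lift:
  fixes g :: "real \<Rightarrow> complex \<times> real"
  assumes "null_homologous_loop H2R_infinity g"
  obtains \<theta> where "continuous_on {0..1} \<theta>" "\<And>s. s \<in> {0..1} \<Longrightarrow> fst (g s) = cis (\<theta> s)" "\<theta> 1 = \<theta> 0"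
proof -
  have g: "path g" "path_image g \<subseteq> H2R_infinity"
    and hom: "homologous_rel 1 (top_of_set H2R_infinity) {} (frag_of (path_simplex g)) 0"
    using assms by (auto simp: null_homologous_loop_def)
  have "continuous_on {0..1} (\<lambda>s. fst (g s))" using g(1) unfolding path_def by (intro continuous_intros)
  moreover have "contractible {0..1::real}" by (intro convex_imp_contractible) auto
  moreover have "cmod (fst (g s)) = 1" if "s \<in> {0..1}" for s
  proof -
    have "g s \<in> H2R_infinity" using g(2) that by (auto simp: path_image_def)
    then show ?thesis by (auto simp: mem_Times_iff)
  qed
  ultimately obtain \<theta> where \<theta>: "continuous_on {0..1} \<theta>" "\<And>s. s \<in> {0..1} \<Longrightarrow> fst (g s) = cis (\<theta> s)"
    using circle_lift by blast
  obtain d where d: "singular_chain 2 (top_of_set H2R_infinity) d" and "chain_boundary 2 d = frag_of (path_simplex g)"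
  proof -
    obtain d where "singular_chain (Suc 1) (top_of_set H2R_infinity) d"
      "(chain_boundary (Suc 1) d, frag_of (path_simplex g) - 0) \<in> mod_subset 1 (subtopology (top_of_set H2R_infinity) {})"
      using hom unfolding homologous_rel_def singular_relboundary_def by blast
    then have "singular_chain 2 (top_of_set H2R_infinity) d" "chain_boundary 2 d = frag_of (path_simplex g)"
      unfolding mod_subset_empty by (simp_all add: numeral_2_eq_2)
    then show ?thesis by (rule that)
  qed
  then have "edge_variation (path_simplex g) = chain_weight edge_variation (chain_boundary 2 d)"
    by (simp add: chain_weight_of)
  also have "\<dots> = 0"
    unfolding chain_boundary_def frag_extend_def
    using d edge_variation_boundary
    by (auto simp: chain_weight_sum chain_weight_cmul singular_chain_def intro!: sum.neutral)
  finally have "edge_variation (path_simplex g) = 0" .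
  moreover have "edge_variation (path_simplex g) = \<theta> 1 - \<theta> 0"
    unfolding edge_variation_def
  proof (rule angle_variation_eq[OF \<theta>(1)])
    fix s :: real assume s: "s \<in> {0..1}"
    have "simplex_point s 0 \<in> standard_simplex 1" using s by (intro simplex_point_in(2)) auto
    then have "path_simplex g (simplex_point s 0) = g s" by (simp add: path_simplex_def simplex_point_def)
    then show "fst (path_simplex g (simplex_point s 0)) = cis (\<theta> s)" using \<theta>(2)[OF s] by simp
  qed
  ultimately show ?thesis using that[OF \<theta>] by simp
qed

text \<open>The line lies over the maximum \<open>m\<close> of the lifted angle. The set \<open>E\<close> collects the heights at
  which the lift equals \<open>m\<close>, and \<open>Z\<close> those at which it is \<open>m - 2 \<pi> k\<close> with \<open>k \<ge> 1\<close>; they are disjoint because the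
  curve is simple. Just beyond the maximum only the sheets with \<open>k \<ge> 1\<close> contribute, and these come close
  only to points of \<open>Z\<close>.\<close>
lemma extreme_vertical_line:
  fixes g :: "real \<Rightarrow> complex \<times> real"
  assumes "simple_path g"
    and \<theta>: "continuous_on {0..1} \<theta>" "\<And>s. s \<in> {0..1} \<Longrightarrow> fst (g s) = cis (\<theta> s)" "\<theta> 1 = \<theta> 0"
  obtains \<omega> E Z where "cmod \<omega> = 1" "compact E" "compact Z" "E \<noteq> {}" "E \<inter> Z = {}"
    "\<And>t. (\<omega>, t) \<in> path_image g \<longleftrightarrow> t \<in> E \<union> Z"
    "\<And>t1 t2 r. {t1..t2} \<inter> Z = {} \<Longrightarrow> r > 0 \<Longrightarrow>
       \<exists>\<zeta>. cmod \<zeta> = 1 \<and> dist \<omega> \<zeta> < r \<and> (\<forall>t\<in>{t1..t2}. (\<zeta>, t) \<notin> path_image g)"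
proof -
  have g: "continuous_on {0..1} g" using assms(1) by (simp add: simple_path_def path_def)
  obtain sm where sm: "sm \<in> {0..1}" and max: "\<And>s. s \<in> {0..1} \<Longrightarrow> \<theta> s \<le> \<theta> sm"
    using continuous_attains_sup[OF _ _ \<theta>(1)] by auto
  define m \<omega> where "m = \<theta> sm" and "\<omega> = cis m"
  have ct: "continuous_on {0..1} (\<lambda>s. snd (g s))" by (intro continuous_intros g)
  have compact_sub: "compact {s \<in> {0..1}. \<theta> s \<in> A \<and> cis (\<theta> s) \<in> B \<and> snd (g s) \<in> C}" if "closed A" "closed B" "closed C" for A B C
  proof -
    have "closedin (top_of_set {0..1}) ({0..1} \<inter> (\<lambda>s. (\<theta> s, cis (\<theta> s), snd (g s))) -` (A \<times> B \<times> C))"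
      using that by (intro continuous_closedin_preimage closed_Times continuous_intros \<theta>(1) ct)
    moreover have "{0..1} \<inter> (\<lambda>s. (\<theta> s, cis (\<theta> s), snd (g s))) -` (A \<times> B \<times> C)
        = {s \<in> {0..1}. \<theta> s \<in> A \<and> cis (\<theta> s) \<in> B \<and> snd (g s) \<in> C}" by auto
    ultimately show ?thesis using closedin_compact[of "{0..1::real}"] by simp
  qed
  \<comment> \<open>Over \<open>\<omega>\<close> the lift is \<open>m\<close> or at most \<open>m - 2 \<pi>\<close>. The threshold \<open>m - \<pi>\<close> separates the two, also for
    angles slightly beyond \<open>m\<close>.\<close>
  define SE SZ where "SE = {s \<in> {0..1}. \<theta> s \<in> {m} \<and> cis (\<theta> s) \<in> UNIV \<and> snd (g s) \<in> UNIV}"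
    and "SZ = {s \<in> {0..1}. \<theta> s \<in> {..m - pi} \<and> cis (\<theta> s) \<in> {\<omega>} \<and> snd (g s) \<in> UNIV}"
  define E Z where "E = (\<lambda>s. snd (g s)) ` SE" and "Z = (\<lambda>s. snd (g s)) ` SZ"
  have gs: "g s = (cis (\<theta> s), snd (g s))" if "s \<in> {0..1}" for s
    using \<theta>(2)[OF that] by (simp add: prod_eq_iff)
  have below: "\<theta> s \<le> m - pi" if "s \<in> {0..1}" "cis (\<theta> s) = cis (m + \<delta>)" "\<theta> s \<noteq> m + \<delta>" "0 \<le> \<delta>" "\<delta> < pi" for s \<delta>
  proof -
    from that(2) obtain n :: int where n: "\<theta> s = m + \<delta> + 2 * pi * n" unfolding cis_eq_iff by blast
    have "n \<noteq> 0" using n that(3) by auto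
    moreover have "\<not> n \<ge> 1"
    proof
      assume "n \<ge> 1"
      then have "2 * pi * 1 \<le> 2 * pi * real_of_int n" by (intro mult_left_mono) auto
      then show False using max[OF that(1)] n that(4) pi_gt_zero unfolding m_def by linarith
    qed
    ultimately have "n \<le> -1" by linarith
    then have "2 * pi * real_of_int n \<le> 2 * pi * (-1)" by (intro mult_left_mono) auto
    then show ?thesis using n that(5) by linarith
  qed
  show ?thesis
  proof
    show "cmod \<omega> = 1" by (simp add: \<omega>_def)
    have "compact SE" "compact SZ" unfolding SE_def SZ_def by (intro compact_sub; simp)+
    then show "compact E" "compact Z" unfolding E_def Z_def
      by (auto intro!: compact_continuous_image continuous_on_subset[OF ct] simp: SE_def SZ_def)
    show "E \<noteq> {}" using sm by (auto simp: E_def SE_def m_def)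
    show "E \<inter> Z = {}"
    proof (rule ccontr)
      assume "E \<inter> Z \<noteq> {}"
      then obtain s s' where s: "s \<in> SE" "s' \<in> SZ" "snd (g s) = snd (g s')" by (auto simp: E_def Z_def)
      then have "g s = g s'" using gs[of s] gs[of s'] by (auto simp: SE_def SZ_def \<omega>_def)
      then have "s = s' \<or> s = 0 \<and> s' = 1 \<or> s = 1 \<and> s' = 0"
        using assms(1) s unfolding simple_path_def loop_free_def by (auto simp: SE_def SZ_def)
      then have "\<theta> s = \<theta> s'" using \<theta>(3) by auto
      then show False using s pi_gt_zero by (auto simp: SE_def SZ_def)
    qed
    show "(\<omega>, t) \<in> path_image g \<longleftrightarrow> t \<in> E \<union> Z" for t
    proof
      assume "(\<omega>, t) \<in> path_image g"
      then obtain s where s: "s \<in> {0..1}" "g s = (\<omega>, t)" by (auto simp: path_image_def)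
      then have st: "cis (\<theta> s) = \<omega>" "snd (g s) = t" using gs[of s] by auto
      show "t \<in> E \<union> Z"
      proof (cases "\<theta> s = m")
        case True
        then have "s \<in> SE" using s by (simp add: SE_def)
        then show ?thesis using st(2) unfolding E_def by blast
      next
        case False
        then have "s \<in> SZ" using s st below[of s 0] by (simp add: SZ_def \<omega>_def)
        then show ?thesis using st(2) unfolding Z_def by blast
      qed
    next
      assume "t \<in> E \<union> Z"
      then obtain s where s: "s \<in> {0..1}" "cis (\<theta> s) = \<omega>" "snd (g s) = t"
        by (auto simp: E_def Z_def SE_def SZ_def \<omega>_def)
      then have "g s = (\<omega>, t)" using gs[of s] by simp
      then show "(\<omega>, t) \<in> path_image g" using s(1) unfolding path_image_def by force
    qed
    fix t1 t2 r :: real assume Z: "{t1..t2} \<inter> Z = {}" and r: "r > 0"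
    define S' where "S' = {s \<in> {0..1}. \<theta> s \<in> {..m - pi} \<and> cis (\<theta> s) \<in> UNIV \<and> snd (g s) \<in> {t1..t2}}"
    have "compact S'" unfolding S'_def by (intro compact_sub) auto
    then have "compact ((\<lambda>s. cis (\<theta> s)) ` S')"
      by (intro compact_continuous_image continuous_intros continuous_on_subset[OF \<theta>(1)]) (auto simp: S'_def)
    then have "closed ((\<lambda>s. cis (\<theta> s)) ` S')" by (rule compact_imp_closed)
    moreover have "\<omega> \<notin> (\<lambda>s. cis (\<theta> s)) ` S'"
    proof
      assume "\<omega> \<in> (\<lambda>s. cis (\<theta> s)) ` S'"
      then obtain s where "s \<in> S'" "cis (\<theta> s) = \<omega>" by auto
      then have "snd (g s) \<in> {t1..t2} \<inter> Z" by (auto simp: S'_def Z_def SZ_def)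
      then show False using Z by simp
    qed
    ultimately have "open (- (\<lambda>s. cis (\<theta> s)) ` S')" "\<omega> \<in> - (\<lambda>s. cis (\<theta> s)) ` S'" by auto
    then obtain e where e: "e > 0" "ball \<omega> e \<subseteq> - (\<lambda>s. cis (\<theta> s)) ` S'" by (rule openE)
    have "continuous_on UNIV cis" by (rule continuous_on_cis[OF continuous_on_id])
    then obtain d where d: "d > 0" "\<And>x. dist x m < d \<Longrightarrow> dist (cis x) (cis m) < min r e"
      unfolding continuous_on_iff using r e(1) by (metis UNIV_I min_less_iff_conj)
    define \<delta> where "\<delta> = min 1 d / 2"
    have \<delta>: "\<delta> > 0" "\<delta> < d" "\<delta> < pi" using d(1) pi_gt3 by (auto simp: \<delta>_def)
    define \<zeta> where "\<zeta> = cis (m + \<delta>)"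
    have \<zeta>: "dist \<omega> \<zeta> < min r e"
      using d(2)[of "m + \<delta>"] \<delta> by (simp add: \<omega>_def \<zeta>_def dist_real_def dist_commute)
    have "(\<zeta>, t) \<notin> path_image g" if t: "t \<in> {t1..t2}" for t
    proof
      assume "(\<zeta>, t) \<in> path_image g"
      then obtain s where s: "s \<in> {0..1}" "g s = (\<zeta>, t)" by (auto simp: path_image_def)
      then have cs: "cis (\<theta> s) = cis (m + \<delta>)" "snd (g s) = t" using gs[of s] by (auto simp: \<zeta>_def)
      have "\<theta> s \<noteq> m + \<delta>" using max[OF s(1)] \<delta>(1) by (simp add: m_def)
      then have "\<theta> s \<le> m - pi" using below[OF s(1) cs(1)] \<delta> by simp
      then have "s \<in> S'" using s(1) cs t by (simp add: S'_def)
      then have "\<zeta> \<in> (\<lambda>s. cis (\<theta> s)) ` S'" using cs by (force simp: \<zeta>_def)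
      moreover have "\<zeta> \<in> ball \<omega> e" using \<zeta> by simp
      ultimately show False using e(2) by blast
    qed
    then show "\<exists>\<zeta>. cmod \<zeta> = 1 \<and> dist \<omega> \<zeta> < r \<and> (\<forall>t\<in>{t1..t2}. (\<zeta>, t) \<notin> path_image g)"
      using \<zeta> by (intro exI[of _ \<zeta>]) (auto simp: \<zeta>_def)
  qed
qed

text \<open>Descend from \<open>e\<close> to the first point \<open>y\<close> of \<open>Z\<close>, or to \<open>l\<close>, and step back a little: the lowest point of
  \<open>E\<close> in \<open>{y..e}\<close> is strictly above \<open>y\<close>.\<close>
lemma isolating_bound_below:
  fixes E Z :: "real set"
  assumes "compact E" "compact Z" "E \<inter> Z = {}" "e \<in> E" "l < e" "l \<notin> E"
  obtains t1 where "l < t1" "t1 < e" "t1 \<notin> E" "{t1..e} \<inter> Z = {}"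
proof -
  define Y where "Y = insert l (Z \<inter> {l..e})"
  have Y: "compact Y" unfolding Y_def by (intro compact_insert compact_Int_closed assms) auto
  obtain y where y: "y \<in> Y" "\<And>z. z \<in> Y \<Longrightarrow> z \<le> y"
    using compact_attains_sup[OF Y] unfolding Y_def by blast
  have "y \<notin> E" "y \<le> e" "l \<le> y" using y(1) assms by (auto simp: Y_def)
  then have "y < e" using assms(4) by (cases "y = e") auto
  define X where "X = E \<inter> {y..e}"
  have X: "compact X" unfolding X_def by (intro compact_Int_closed assms) auto
  obtain x where x: "x \<in> X" "\<And>z. z \<in> X \<Longrightarrow> x \<le> z"
  proof -
    have "e \<in> X" using \<open>e \<in> E\<close> \<open>y < e\<close> by (simp add: X_def)
    then show ?thesis using compact_attains_inf[OF X] that by blast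
  qed
  have "y < x" using x(1) \<open>y \<notin> E\<close> by (cases "y = x") (auto simp: X_def)
  show ?thesis
  proof
    show "l < (y + x) / 2" using \<open>y < x\<close> \<open>l \<le> y\<close> by simp
    show "(y + x) / 2 < e" using \<open>y < x\<close> x(1) by (auto simp: X_def)
    show "(y + x) / 2 \<notin> E"
    proof
      assume "(y + x) / 2 \<in> E"
      then have "(y + x) / 2 \<in> X" using \<open>y < x\<close> x(1) by (auto simp: X_def)
      then show False using x(2)[of "(y + x) / 2"] \<open>y < x\<close> by simp
    qed
    show "{(y + x) / 2..e} \<inter> Z = {}"
    proof (rule ccontr)
      assume "{(y + x) / 2..e} \<inter> Z \<noteq> {}"
      then obtain z where z: "(y + x) / 2 \<le> z" "z \<le> e" "z \<in> Z" by auto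
      then have "z \<in> Y" using \<open>y < x\<close> \<open>l \<le> y\<close> by (auto simp: Y_def)
      then show False using y(2)[of z] z \<open>y < x\<close> by simp
    qed
  qed
qed

lemma isolating_bound_above:
  fixes E Z :: "real set"
  assumes "compact E" "compact Z" "E \<inter> Z = {}" "e \<in> E" "e < u" "u \<notin> E"
  obtains t2 where "e < t2" "t2 < u" "t2 \<notin> E" "{e..t2} \<inter> Z = {}"
proof -
  obtain t where t: "- u < t" "t < - e" "t \<notin> uminus ` E" "{t..- e} \<inter> uminus ` Z = {}"
    by (rule isolating_bound_below[of "uminus ` E" "uminus ` Z" "- e" "- u"])
      (use assms in \<open>auto simp: compact_negations image_iff\<close>)
  show ?thesis
  proof
    show "- t \<notin> E" using t(3) by (auto simp: image_iff)
    show "{e..- t} \<inter> Z = {}"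
    proof (rule ccontr)
      assume "{e..- t} \<inter> Z \<noteq> {}"
      then obtain z where "e \<le> z" "z \<le> - t" "z \<in> Z" by auto
      then have "- z \<in> {t..- e} \<inter> uminus ` Z" by auto
      then show False using t(4) by simp
    qed
  qed (use t in auto)
qed

section \<open>Boundary points of surfaces\<close>

lemma chartE:
  assumes "chart S U \<phi>"
  obtains V \<psi> where "openin S U" "openin (top_of_set half_plane) V"
    "homeomorphic_maps (subtopology S U) (top_of_set V) \<phi> \<psi>"
    "\<phi> ` U = V" "\<And>y. y \<in> U \<Longrightarrow> \<psi> (\<phi> y) = y" "\<And>v. v \<in> V \<Longrightarrow> \<psi> v \<in> U \<and> \<phi> (\<psi> v) = v"
    "continuous_map (top_of_set V) S \<psi>" "continuous_map (subtopology S U) (top_of_set V) \<phi>"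
proof -
  obtain V where V: "openin S U" "openin (top_of_set half_plane) V" "homeomorphic_map (subtopology S U) (top_of_set V) \<phi>"
    using assms unfolding chart_def by blast
  obtain \<psi> where \<psi>: "homeomorphic_maps (subtopology S U) (top_of_set V) \<phi> \<psi>"
    using V(3) homeomorphic_map_maps by blast
  have U: "topspace (subtopology S U) = U" using openin_subset[OF V(1)] by (auto simp: inf_absorb2)
  have inv: "\<And>y. y \<in> U \<Longrightarrow> \<psi> (\<phi> y) = y" and \<phi>\<psi>: "\<And>v. v \<in> V \<Longrightarrow> \<phi> (\<psi> v) = v"
    and c: "continuous_map (top_of_set V) (subtopology S U) \<psi>" "continuous_map (subtopology S U) (top_of_set V) \<phi>"
    using \<psi> U by (auto simp: homeomorphic_maps_def)
  have \<psi>U: "\<psi> v \<in> U" if "v \<in> V" for v using c(1) that U by (auto simp: continuous_map_def Pi_iff)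
  have \<phi>U: "\<phi> ` U = V" using homeomorphic_imp_surjective_map[OF V(3)] U by simp
  show ?thesis
    by (rule that[OF V(1,2) \<psi> \<phi>U inv _ _ c(2)]) (use \<psi>U \<phi>\<psi> c(1) in \<open>auto simp: continuous_map_in_subtopology\<close>)
qed

text \<open>If the point were in the open half-plane for \<open>\<phi>\<close>, the transition map to \<open>\<phi>'\<close> would map a plane
  neighbourhood onto an open set of the plane that touches the boundary line and lies in the half-plane.\<close>
lemma boundary_point_in_every_chart:
  assumes ch: "chart S U \<phi>" "chart S U' \<phi>'" and y: "y \<in> U" "y \<in> U'" and bd: "snd (\<phi>' y) = 0"
  shows "snd (\<phi> y) = 0"
proof (rule ccontr)
  assume "snd (\<phi> y) \<noteq> 0"
  obtain V \<psi> where V: "openin S U" "openin (top_of_set half_plane) V" "\<phi> ` U = V"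
    "\<And>y. y \<in> U \<Longrightarrow> \<psi> (\<phi> y) = y" "\<And>v. v \<in> V \<Longrightarrow> \<psi> v \<in> U \<and> \<phi> (\<psi> v) = v"
    and \<psi>: "continuous_map (top_of_set V) S \<psi>"
    using chartE[OF ch(1)] by metis
  obtain V' \<psi>' where V': "openin S U'" "openin (top_of_set half_plane) V'" "\<phi>' ` U' = V'"
    "\<And>y. y \<in> U' \<Longrightarrow> \<psi>' (\<phi>' y) = y"
    and \<phi>': "continuous_map (subtopology S U') (top_of_set V') \<phi>'"
    using chartE[OF ch(2)] by metis
  have hp: "V \<subseteq> half_plane" "V' \<subseteq> half_plane" using openin_imp_subset[OF V(2)] openin_imp_subset[OF V'(2)] by auto
  define D where "D = {v \<in> V. \<psi> v \<in> U'}"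
  have "openin (top_of_set V) D" unfolding D_def
    using \<psi> V'(1) by (auto simp: continuous_map_def)
  then have "openin (top_of_set half_plane) D" using V(2) openin_trans by blast
  then obtain T where T: "open T" "D = half_plane \<inter> T" by (auto simp: openin_open)
  define B where "B = {x. 0 < snd x} \<inter> T"
  have "open B" unfolding B_def using T(1) by (intro open_Int open_Collect_less continuous_intros) auto
  have BD: "B \<subseteq> D" unfolding T(2) B_def by (auto simp: half_plane_def)
  have \<phi>y: "\<phi> y \<in> D" using y V by (auto simp: D_def)
  then have "snd (\<phi> y) \<ge> 0" unfolding T(2) by (auto simp: half_plane_def)
  then have "\<phi> y \<in> B" using \<phi>y \<open>snd (\<phi> y) \<noteq> 0\<close> unfolding B_def T(2) by auto
  have "continuous_map (top_of_set B) S \<psi>"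
    by (rule continuous_map_from_subtopology_mono[OF \<psi>]) (use BD in \<open>auto simp: D_def\<close>)
  then have "continuous_map (top_of_set B) (subtopology S U') \<psi>"
    using BD by (auto simp: continuous_map_in_subtopology D_def)
  then have "continuous_map (top_of_set B) (top_of_set V') (\<phi>' \<circ> \<psi>)" using \<phi>' by (rule continuous_map_compose)
  then have cont: "continuous_on B (\<phi>' \<circ> \<psi>)" and im: "(\<phi>' \<circ> \<psi>) ` B \<subseteq> V'"
    by (auto simp: continuous_map_in_subtopology)
  have "inj_on (\<phi>' \<circ> \<psi>) B"
  proof (rule inj_onI)
    fix a b assume ab: "a \<in> B" "b \<in> B" "(\<phi>' \<circ> \<psi>) a = (\<phi>' \<circ> \<psi>) b"
    have "\<psi> a \<in> U'" "\<psi> b \<in> U'" "a \<in> V" "b \<in> V" using ab BD by (auto simp: D_def)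
    then have "\<psi> a = \<psi> b" using V'(4) ab(3) by (metis comp_apply)
    then show "a = b" using V(5) \<open>a \<in> V\<close> \<open>b \<in> V\<close> by metis
  qed
  with cont \<open>open B\<close> have "open ((\<phi>' \<circ> \<psi>) ` B)" by (rule invariance_of_domain)
  moreover have "\<phi>' y \<in> (\<phi>' \<circ> \<psi>) ` B" using \<open>\<phi> y \<in> B\<close> V(4)[OF y(1)] by force
  ultimately obtain e where e: "e > 0" "ball (\<phi>' y) e \<subseteq> (\<phi>' \<circ> \<psi>) ` B" by (rule openE)
  have "\<phi>' y + (0, - e / 2) \<in> ball (\<phi>' y) e" using e(1) by (simp add: dist_norm norm_Pair)
  then have "\<phi>' y + (0, - e / 2) \<in> half_plane" using e(2) im hp by blast
  then show False using bd e(1) by (simp add: half_plane_def)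
qed

lemma surface_boundary_open_embedding:
  assumes emb: "embedding_map S T i" and op: "openin T (i ` topspace S)" and s: "s \<in> surface_boundary S"
  shows "i s \<in> surface_boundary T"
proof -
  obtain U \<phi> where ch: "chart S U \<phi>" and sU: "s \<in> U" "snd (\<phi> s) = 0"
    using s unfolding surface_boundary_def by blast
  obtain V \<psi> where V: "openin S U" "openin (top_of_set half_plane) V"
    and hom: "homeomorphic_maps (subtopology S U) (top_of_set V) \<phi> \<psi>"
    using chartE[OF ch] by metis
  have US: "U \<subseteq> topspace S" using openin_subset[OF V(1)] .
  have hi: "homeomorphic_map S (subtopology T (i ` topspace S)) i" using emb by (simp add: embedding_map_def)
  then obtain j where ij: "homeomorphic_maps S (subtopology T (i ` topspace S)) i j"
    using homeomorphic_map_maps by blast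
  have iU: "i ` U \<subseteq> i ` topspace S" using US by blast
  have topT: "i ` topspace S \<subseteq> topspace T" using openin_subset[OF op] .
  have "homeomorphic_maps (subtopology S U) (subtopology (subtopology T (i ` topspace S)) (i ` U)) i j"
    by (rule homeomorphic_maps_subtopologies[OF ij]) (use US topT in auto)
  then have "homeomorphic_maps (subtopology S U) (subtopology T (i ` U)) i j"
    using iU by (simp add: subtopology_subtopology inf_absorb2)
  then have "homeomorphic_maps (subtopology T (i ` U)) (subtopology S U) j i"
    by (rule homeomorphic_maps_sym[THEN iffD1])
  then have "homeomorphic_maps (subtopology T (i ` U)) (top_of_set V) (\<phi> \<circ> j) (i \<circ> \<psi>)"
    using hom homeomorphic_maps_compose by blast
  moreover have "openin T (i ` U)"
  proof -
    have "openin (subtopology T (i ` topspace S)) (i ` U)"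
      using homeomorphic_map_openness[OF hi US] V(1) by simp
    then show ?thesis using op openin_trans_full by blast
  qed
  ultimately have "chart T (i ` U) (\<phi> \<circ> j)"
    unfolding chart_def using V(2) homeomorphic_maps_imp_map by blast
  moreover have "j (i s) = s" using ij US sU by (auto simp: homeomorphic_maps_def)
  ultimately show ?thesis using sU unfolding surface_boundary_def
    by (auto intro!: exI[of _ "i ` U"] exI[of _ "\<phi> \<circ> j"])
qed

text \<open>A closed path has two parameters for its base point; a shift by half a period makes
  any given point an interior one.\<close>
lemma closed_path_interior_parameter:
  assumes "simple_path g" "pathfinish g = pathstart g" "q \<in> path_image g"
  obtains g' s where "simple_path g'" "path_image g' = path_image g" "0 < s" "s < 1" "g' s = q"
proof -
  obtain s where s: "s \<in> {0..1}" "g s = q" using assms(3) by (auto simp: path_image_def)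
  show ?thesis
  proof (cases "0 < s \<and> s < 1")
    case True
    then show ?thesis using that[OF assms(1) refl] s by blast
  next
    case False
    then have "q = g 1" using s assms(2) by (auto simp: pathfinish_def pathstart_def not_less)
    then have "shiftpath (1 / 2) g (1 / 2) = q" by (simp add: shiftpath_def)
    then show ?thesis
      by (intro that[of "shiftpath (1 / 2) g" "1 / 2"] simple_path_shiftpath path_image_shiftpath assms) auto
  qed
qed

text \<open>Near \<open>i (g s)\<close> the chart maps the arc injectively into the boundary line, so by invariance of
  domain in dimension one its image contains an interval about the image of the point. All boundary points near \<open>i (g s)\<close> are
  mapped into this interval.\<close>
lemma boundary_arc_is_neighbourhood:
  assumes emb: "embedding_map (top_of_set \<Gamma>) T i" and bd: "i ` \<Gamma> \<subseteq> surface_boundary T"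
    and g: "simple_path g" "path_image g = \<Gamma>" and s: "0 < s" "s < 1"
  obtains N where "openin T N" "i (g s) \<in> N" "N \<inter> surface_boundary T \<subseteq> i ` \<Gamma>"
proof -
  define q where "q = g s"
  have q: "q \<in> \<Gamma>" using g(2) s by (auto simp: q_def path_image_def)
  then obtain U \<phi> where ch: "chart T U \<phi>" and qU: "i q \<in> U" "snd (\<phi> (i q)) = 0"
    using bd unfolding surface_boundary_def by blast
  obtain V \<psi> where V: "openin T U" "openin (top_of_set half_plane) V" "\<phi> ` U = V"
    "\<And>y. y \<in> U \<Longrightarrow> \<psi> (\<phi> y) = y" and \<phi>: "continuous_map (subtopology T U) (top_of_set V) \<phi>"
    using chartE[OF ch] by metis
  have flat: "snd (\<phi> y) = 0" if "y \<in> U" "y \<in> surface_boundary T" for y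
  proof -
    from that(2) obtain U' \<phi>' where "chart T U' \<phi>'" "y \<in> U'" "snd (\<phi>' y) = 0"
      unfolding surface_boundary_def by blast
    then show ?thesis using boundary_point_in_every_chart[OF ch] that(1) by blast
  qed
  have UT: "U \<subseteq> topspace T" using openin_subset[OF V(1)] .
  have hi: "homeomorphic_map (top_of_set \<Gamma>) (subtopology T (i ` \<Gamma>)) i" using emb by (simp add: embedding_map_def)
  have i: "continuous_map (top_of_set \<Gamma>) T i" and i_inj: "inj_on i \<Gamma>"
    using homeomorphic_imp_continuous_map[OF hi] homeomorphic_imp_injective_map[OF hi]
    by (auto simp: continuous_map_in_subtopology)
  have "continuous_map (top_of_set {0..1}) (top_of_set \<Gamma>) g"
    using g by (auto simp: continuous_map_in_subtopology simple_path_def path_def path_image_def)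
  from continuous_map_compose[OF this i] have ig: "continuous_map (top_of_set {0..1}) T (i \<circ> g)" .
  define J where "J = {r \<in> {0..1}. (i \<circ> g) r \<in> U}"
  have "openin (top_of_set {0..1}) J" using ig V(1) by (auto simp: continuous_map_def J_def)
  then obtain O' where O': "open O'" "J = {0..1} \<inter> O'" by (auto simp: openin_open)
  define I where "I = {0<..<1} \<inter> O'"
  have I: "open I" "I \<subseteq> J" "I \<subseteq> {0<..<1}" unfolding I_def O'(2) using O'(1) by auto
  have sJ: "s \<in> J" using s qU by (auto simp: J_def q_def)
  then have sI: "s \<in> I" using s unfolding I_def O'(2) by auto
  have "continuous_map (top_of_set I) T (i \<circ> g)"
    by (rule continuous_map_from_subtopology_mono[OF ig]) (use I(3) in auto)
  then have "continuous_map (top_of_set I) (subtopology T U) (i \<circ> g)"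
    using I(2) by (auto simp: continuous_map_in_subtopology J_def)
  from continuous_map_compose[OF this \<phi>]
  have \<eta>0: "continuous_on I (\<lambda>r. \<phi> (i (g r)))" by (auto simp: continuous_map_in_subtopology o_def)
  define \<eta> where "\<eta> = (\<lambda>r. fst (\<phi> (i (g r))))"
  have g\<Gamma>: "g r \<in> \<Gamma>" if "r \<in> I" for r using that I(3) g(2) by (auto simp: path_image_def)
  have snd0: "snd (\<phi> (i (g r))) = 0" if "r \<in> I" for r
    using flat[of "i (g r)"] that I(2) bd g\<Gamma>[OF that] by (auto simp: J_def)
  have "continuous_on I \<eta>" unfolding \<eta>_def by (intro continuous_intros \<eta>0)
  moreover have "inj_on \<eta> I"
  proof (rule inj_onI)
    fix a b assume ab: "a \<in> I" "b \<in> I" "\<eta> a = \<eta> b"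
    then have "\<phi> (i (g a)) = \<phi> (i (g b))" using snd0 by (simp add: \<eta>_def prod_eq_iff)
    moreover have "i (g a) \<in> U" "i (g b) \<in> U" using ab I(2) by (auto simp: J_def)
    ultimately have "i (g a) = i (g b)" using V(4) by metis
    then have "g a = g b" using i_inj g\<Gamma> ab by (meson inj_onD)
    moreover have "a \<in> {0<..<1}" "b \<in> {0<..<1}" using ab I(3) by blast+
    then have "a \<in> {0..1}" "b \<in> {0..1}" "a \<noteq> 0" "b \<noteq> 0" by auto
    ultimately show "a = b" using g(1)[unfolded simple_path_def loop_free_def] by blast
  qed
  ultimately have "open (\<eta> ` I)" using invariance_of_domain \<open>open I\<close> by blast
  moreover have "\<eta> s \<in> \<eta> ` I" using sI by blast
  ultimately obtain e where e: "e > 0" "ball (\<eta> s) e \<subseteq> \<eta> ` I" by (rule openE)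
  define N where "N = {y \<in> U. \<phi> y \<in> ball (\<phi> (i q)) e}"
  show ?thesis
  proof
    have "openin (top_of_set V) (V \<inter> ball (\<phi> (i q)) e)" by auto
    then have "openin (subtopology T U) {y \<in> topspace (subtopology T U). \<phi> y \<in> V \<inter> ball (\<phi> (i q)) e}"
      using \<phi> by (simp only: continuous_map_def)
    moreover have "{y \<in> topspace (subtopology T U). \<phi> y \<in> V \<inter> ball (\<phi> (i q)) e} = N"
      using UT V(3) by (auto simp: N_def)
    ultimately show "openin T N" using V(1) openin_trans_full by metis
    show "i (g s) \<in> N" using qU e by (simp add: N_def q_def)
    show "N \<inter> surface_boundary T \<subseteq> i ` \<Gamma>"
    proof
      fix y assume y: "y \<in> N \<inter> surface_boundary T"
      then have "y \<in> U" "snd (\<phi> y) = 0" "dist (\<phi> (i q)) (\<phi> y) < e" using flat by (auto simp: N_def)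
      then have "fst (\<phi> y) \<in> ball (\<eta> s) e"
        using dist_fst_le[of "\<phi> (i q)" "\<phi> y"] by (simp add: \<eta>_def q_def)
      then obtain r where r: "r \<in> I" "\<eta> r = fst (\<phi> y)" using e(2) by (metis imageE subsetD)
      then have "\<phi> (i (g r)) = \<phi> y" using snd0 \<open>snd (\<phi> y) = 0\<close> by (simp add: \<eta>_def prod_eq_iff)
      then have "i (g r) = y" using V(4) \<open>y \<in> U\<close> r(1) I(2) by (metis (no_types, lifting) J_def comp_apply mem_Collect_eq subsetD)
      then show "y \<in> i ` \<Gamma>" using g\<Gamma>[OF r(1)] by blast
    qed
  qed
qed

text \<open>By properness of \<open>case_sum X id\<close>, an accumulation point on \<open>\<Gamma>\<close> of the finite boundary would be an
  accumulation point in \<open>T\<close> itself. But near a point of \<open>\<Gamma>\<close> the boundary of \<open>T\<close> consists of points of \<open>\<Gamma>\<close>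
  only.\<close>
lemma finite_boundary_avoids_ideal_boundary:
  fixes S :: "'a topology" and X :: "'a \<Rightarrow> complex \<times> real"
  assumes cont: "continuous_surface_with S X \<Gamma>" and X: "X ` topspace S \<subseteq> H2R"
    and \<Gamma>: "\<Gamma> \<subseteq> H2R_infinity" and g: "simple_path g" "pathfinish g = pathstart g" "path_image g = \<Gamma>"
    and q: "q \<in> \<Gamma>"
  shows "q \<notin> closure (X ` surface_boundary S)"
proof
  assume cl: "q \<in> closure (X ` surface_boundary S)"
  obtain T :: "('a + complex \<times> real) topology" where
    topT: "topspace T = topspace S <+> \<Gamma>" and surf: "topological_surface T"
    and embl: "embedding_map S T Inl" and embr: "embedding_map (top_of_set \<Gamma>) T Inr"
    and bd: "Inr ` \<Gamma> \<subseteq> surface_boundary T"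
    and proper: "proper_map T (top_of_set H2R_closure) (case_sum X id)"
    using cont unfolding continuous_surface_with_def by blast
  have bdS: "surface_boundary S \<subseteq> topspace S"
    unfolding surface_boundary_def chart_def by (auto dest: openin_subset)
  have "compact \<Gamma>" using g by (metis compact_simple_path_image)
  have "homeomorphic_map (top_of_set \<Gamma>) (subtopology T (Inr ` \<Gamma>)) Inr" using embr by (simp add: embedding_map_def)
  then have "continuous_map (top_of_set \<Gamma>) T Inr"
    using homeomorphic_imp_continuous_map continuous_map_in_subtopology by blast
  then have "compactin T (Inr ` \<Gamma>)"
    by (rule image_compactin[rotated]) (use \<open>compact \<Gamma>\<close> in \<open>simp add: compactin_subtopology\<close>)
  then have "closedin T (Inr ` \<Gamma>)"
    using surf compactin_imp_closedin by (auto simp: topological_surface_def)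
  then have "openin T (topspace T - Inr ` \<Gamma>)" by (rule openin_diff[OF openin_topspace])
  moreover have "topspace T - Inr ` \<Gamma> = Inl ` topspace S" unfolding topT by auto
  ultimately have opl: "openin T (Inl ` topspace S)" by simp
  have bdl: "Inl ` surface_boundary S \<subseteq> surface_boundary T"
    using surface_boundary_open_embedding[OF embl opl] by blast
  define B where "B = T closure_of (Inl ` surface_boundary S)"
  have "closed_map T (top_of_set H2R_closure) (case_sum X id)" using proper by (simp add: proper_map_def)
  then have "closedin (top_of_set H2R_closure) (case_sum X id ` B)"
    unfolding B_def closed_map_def using closedin_closure_of by blast
  moreover have "closed H2R_closure" by (intro closed_Times) auto
  ultimately have "closed (case_sum X id ` B)" using closedin_closed_trans by blast
  moreover have "X ` surface_boundary S \<subseteq> case_sum X id ` B"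
  proof -
    have "Inl ` surface_boundary S \<subseteq> B" unfolding B_def
      by (rule closure_of_subset) (use bdS topT in auto)
    then show ?thesis by force
  qed
  ultimately have "q \<in> case_sum X id ` B" using cl closure_minimal by blast
  then obtain y where y: "y \<in> B" "q = case_sum X id y" by blast
  have "y \<in> topspace T" using y(1) closure_of_subset_topspace[of T "Inl ` surface_boundary S"] unfolding B_def by blast
  have "y = Inr q"
  proof (cases y)
    case (Inl p)
    then have "p \<in> topspace S" using \<open>y \<in> topspace T\<close> topT by auto
    then have "q \<in> H2R" using X y(2) Inl by auto
    then show ?thesis using q \<Gamma> by (auto simp: mem_Times_iff)
  qed (use y(2) in simp)
  obtain g' s where g': "simple_path g'" "path_image g' = path_image g" "0 < s" "s < 1" "g' s = q"
    using closed_path_interior_parameter[OF g(1,2)] q g(3) by metis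
  obtain N where N: "openin T N" "Inr q \<in> N" "N \<inter> surface_boundary T \<subseteq> Inr ` \<Gamma>"
    using boundary_arc_is_neighbourhood[OF embr bd g'(1) _ g'(3,4)] g'(2,5) g(3) by metis
  have "\<exists>z. z \<in> Inl ` surface_boundary S \<and> z \<in> N"
    using y(1) \<open>y = Inr q\<close> N(1,2) unfolding B_def in_closure_of by blast
  then show False using N(3) bdl by blast
qed

section \<open>Nonexistence\<close>

text \<open>Properness makes \<open>M\<close> closed in \<open>\<bbbH>\<^sup>2 \<times> \<real>\<close>; all other limits of points of \<open>M\<close> lie at infinity, hence
  on \<open>\<Gamma>\<close>.\<close>
lemma minimal_set_of_surface:
  assumes M: "properly_immersed_minimal_surface S A X"
    and as: "asymptotic_boundary (X ` topspace S) = \<Gamma>"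
  shows "minimal_set (X ` topspace S) (X ` surface_boundary S) \<Gamma>"
proof -
  define M where "M = X ` topspace S"
  have imm: "minimal_immersion S A X" and cont: "continuous_map S (top_of_set H2R) X"
    and proper: "proper_map S (top_of_set H2R) X"
    using assms(1) unfolding properly_immersed_minimal_surface_def by auto
  have MH: "M \<subseteq> H2R" using continuous_map_image_subset_topspace[OF cont] unfolding M_def by simp
  have "closed_map S (top_of_set H2R) X" using proper by (simp add: proper_map_def)
  then have "closedin (top_of_set H2R) M" unfolding M_def closed_map_def by blast
  then obtain F where F: "closed F" "M = H2R \<inter> F" by (auto simp: closedin_closed)
  have cl: "closure M \<subseteq> M \<union> \<Gamma>"
  proof
    fix P assume P: "P \<in> closure M"
    have "closure M \<subseteq> cball 0 1 \<times> UNIV"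
    proof (rule closure_minimal)
      show "M \<subseteq> cball 0 1 \<times> UNIV" using MH by force
      show "closed (cball (0::complex) 1 \<times> (UNIV::real set))" by (intro closed_Times) auto
    qed
    then have "fst P \<in> cball 0 1" using P by (auto simp: mem_Times_iff)
    then consider "fst P \<in> ball 0 1" | "fst P \<in> sphere 0 1" by fastforce
    then show "P \<in> M \<union> \<Gamma>"
    proof cases
      case 1
      then have "P \<in> H2R" by (auto simp: mem_Times_iff)
      moreover have "P \<in> F" using P F closure_minimal[of M F] by blast
      ultimately show ?thesis using F(2) by blast
    next
      case 2
      then have "P \<in> H2R_infinity" by (auto simp: mem_Times_iff)
      moreover obtain \<sigma> where "\<forall>n. \<sigma> n \<in> M" "\<sigma> \<longlonglongrightarrow> P"
        using P unfolding closure_sequential by blast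
      ultimately have "P \<in> asymptotic_boundary M" unfolding asymptotic_boundary_def by blast
      then show ?thesis using as by (simp add: M_def)
    qed
  qed
  show ?thesis
    unfolding M_def[symmetric]
  proof
    show "M \<subseteq> H2R" by (rule MH)
    show "\<Gamma> \<subseteq> H2R_infinity" using as by (auto simp: asymptotic_boundary_def)
    show "closure M \<subseteq> M \<union> \<Gamma>" by (rule cl)
    fix P w h f f1 f2 W
    assume P: "P \<in> M" "P \<notin> X ` surface_boundary S" and
      d: "\<And>t. (f has_real_derivative f1 t) (at t)" "\<And>t. (f1 has_real_derivative f2 t) (at t)" and
      pos: "f (snd P) > 0" and W: "open W" "P \<in> W" and
      min: "\<And>Q. Q \<in> M \<Longrightarrow> Q \<in> W \<Longrightarrow> hyp_linear w h (fst P) * f (snd P) \<le> hyp_linear w h (fst Q) * f (snd Q)"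
    obtain p where p: "p \<in> topspace S" "P = X p" using P(1) by (auto simp: M_def)
    show "0 \<le> hyp_linear w h (fst P) *
        (((hyp_linear w h (fst P))\<^sup>2 + (w \<bullet> w - h\<^sup>2)) * f (snd P) * (f (snd P) + f2 (snd P))
          - 2 * (w \<bullet> w - h\<^sup>2) * (f1 (snd P))\<^sup>2)"
      unfolding p(2)
    proof (rule minimal_surface_minimum[OF imm p(1) _ d _ W(1)])
      show "p \<notin> surface_boundary S" using P(2) p(2) by blast
      show "f (snd (X p)) > 0" using pos p(2) by simp
      show "X p \<in> W" using W(2) p(2) by simp
      show "hyp_linear w h (fst (X p)) * f (snd (X p)) \<le> hyp_linear w h (fst (X q)) * f (snd (X q))"
        if "q \<in> topspace S" "X q \<in> W" for q
        using min[of "X q"] that p(2) by (simp add: M_def)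
    qed
  qed
qed

text \<open>In a closed slab of width \<open>\<pi>\<close>, a point of \<open>Z\<close> on one side of \<open>e\<close> bounds the window on that side
  strictly inside the slab, which leaves room on the other side: a window of height \<open>\<pi>\<close> then ends outside
  the slab, hence outside \<open>E\<close>.\<close>
lemma no_minimal_set:
  assumes Jordan: "null_homologous_Jordan_curve H2R_infinity \<Gamma>"
    and set: "minimal_set M K \<Gamma>" and KM: "K \<subseteq> M"
    and attained: "\<Gamma> \<subseteq> closure M"
    and bdry: "\<And>q. q \<in> \<Gamma> \<Longrightarrow> q \<notin> closure K"
    and slab: "\<Gamma> \<subseteq> sphere 0 1 \<times> {t0<..<t0 + pi} \<or> \<Gamma> \<subseteq> sphere 0 1 \<times> {t0..t0 + pi} \<and> K = {}"
  shows False
proof -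
  interpret minimal_set M K \<Gamma> by (rule set)
  obtain g where g: "simple_path g" "path_image g = \<Gamma>" "null_homologous_loop H2R_infinity g"
    using Jordan unfolding null_homologous_Jordan_curve_def by blast
  obtain \<theta> where \<theta>: "continuous_on {0..1} \<theta>" "\<And>s. s \<in> {0..1} \<Longrightarrow> fst (g s) = cis (\<theta> s)" "\<theta> 1 = \<theta> 0"
    using null_homologous_loop_lift[OF g(3)] by blast
  obtain \<omega> E Z where \<omega>: "cmod \<omega> = 1" and EZ: "compact E" "compact Z" "E \<inter> Z = {}" and "E \<noteq> {}"
    and line: "\<And>t. (\<omega>, t) \<in> \<Gamma> \<longleftrightarrow> t \<in> E \<union> Z"
    and free: "\<And>t1 t2 r. {t1..t2} \<inter> Z = {} \<Longrightarrow> r > 0 \<Longrightarrow>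
       \<exists>\<zeta>. cmod \<zeta> = 1 \<and> dist \<omega> \<zeta> < r \<and> (\<forall>t\<in>{t1..t2}. (\<zeta>, t) \<notin> \<Gamma>)"
    using extreme_vertical_line[OF g(1) \<theta>] unfolding g(2) by metis
  obtain e where e: "e \<in> E" using \<open>E \<noteq> {}\<close> by blast
  have in_slab: "\<Gamma> \<subseteq> UNIV \<times> {t0..t0 + pi}" using slab by force
  have window: False if lu: "l < e" "e < u" "l \<notin> E" "u \<notin> E" "u \<le> l + pi" for l u
  proof -
    obtain t1 where t1: "l < t1" "t1 < e" "t1 \<notin> E" "{t1..e} \<inter> Z = {}"
      using isolating_bound_below[OF EZ e lu(1,3)] by blast
    obtain t2 where t2: "e < t2" "t2 < u" "t2 \<notin> E" "{e..t2} \<inter> Z = {}"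
      using isolating_bound_above[OF EZ e lu(2,4)] by blast
    have "{t1..t2} = {t1..e} \<union> {e..t2}" using t1 t2 by auto
    then have Z0: "{t1..t2} \<inter> Z = {}" using t1(4) t2(4) by blast
    show False
    proof (rule no_free_end[OF \<omega>])
      show "t2 - t1 < pi" "e \<in> {t1<..<t2}" using t1 t2 lu by auto
      show "(\<omega>, e) \<in> closure M" using line[of e] e attained by blast
      have "t1 \<in> {t1..t2}" "t2 \<in> {t1..t2}" using t1 t2 by auto
      then show "(\<omega>, t1) \<notin> \<Gamma>" "(\<omega>, t2) \<notin> \<Gamma>" using Z0 t1(3) t2(3) line by blast+
      show "(\<omega>, t) \<notin> closure K" for t
      proof
        assume K: "(\<omega>, t) \<in> closure K"
        then have "(\<omega>, t) \<in> closure M" using closure_mono[OF KM] by blast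
        moreover have "(\<omega>, t) \<notin> M" using fst_in_ball[of "(\<omega>, t)"] \<omega> by auto
        ultimately have "(\<omega>, t) \<in> \<Gamma>" using closure_M by blast
        then show False using bdry K by blast
      qed
      show "\<exists>\<zeta>. cmod \<zeta> = 1 \<and> dist \<omega> \<zeta> < r \<and> (\<forall>t\<in>{t1..t2}. (\<zeta>, t) \<notin> \<Gamma>)" if "r > 0" for r
        by (rule free[OF Z0 that])
    qed
  qed
  show False
  proof (cases "\<Gamma> \<subseteq> sphere 0 1 \<times> {t0<..<t0 + pi}")
    case True
    have "t \<in> {t0<..<t0 + pi}" if "t \<in> E" for t using True line[of t] that by auto
    then show False using window[of t0 "t0 + pi"] e by auto
  next
    case False
    then have "K = {}" using slab by blast
    have EZ_slab: "t \<in> {t0..t0 + pi}" if "t \<in> E \<union> Z" for t using in_slab line[of t] that by auto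
    show False
    proof (cases "Z = {}")
      case True
      then obtain \<zeta> where \<zeta>: "cmod \<zeta> = 1" "\<And>t. t \<in> {t0..t0 + pi} \<Longrightarrow> (\<zeta>, t) \<notin> \<Gamma>"
        using free[of t0 "t0 + pi" 1] by auto
      have "compact \<Gamma>" using g(1,2) by (metis compact_simple_path_image)
      moreover have "\<Gamma> \<noteq> {}" using line[of e] e by blast
      moreover have "continuous_on \<Gamma> (\<lambda>P. fst P \<bullet> \<zeta>)" by (intro continuous_intros)
      ultimately obtain P where P: "P \<in> \<Gamma>" "\<And>Q. Q \<in> \<Gamma> \<Longrightarrow> fst Q \<bullet> \<zeta> \<le> fst P \<bullet> \<zeta>"
        using continuous_attains_sup by metis
      have "fst P \<bullet> \<zeta> < 1"
      proof -
        have "cmod (fst P) = 1" using fst_on_circle[OF P(1)] by simp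
        then have unit: "fst P \<bullet> fst P = 1" "\<zeta> \<bullet> \<zeta> = 1" using \<zeta>(1) by (simp_all add: dot_square_norm)
        have "(fst P - \<zeta>) \<bullet> (fst P - \<zeta>) = 2 - 2 * (fst P \<bullet> \<zeta>)"
          unfolding inner_diff_left inner_diff_right unit inner_commute[of \<zeta> "fst P"] by simp
        moreover have "fst P \<noteq> \<zeta>"
        proof
          assume "fst P = \<zeta>"
          then have "(\<zeta>, snd P) \<in> \<Gamma>" using P(1) by auto
          moreover have "snd P \<in> {t0..t0 + pi}" using in_slab P(1) by (auto simp: mem_Times_iff)
          ultimately show False using \<zeta>(2) by blast
        qed
        then have "(fst P - \<zeta>) \<bullet> (fst P - \<zeta>) > 0" by simp
        ultimately show ?thesis by simp
      qed
      then have "M = {}"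
        by (intro empty_if_boundary_misses_vertical_line[OF \<open>K = {}\<close> in_slab \<zeta>(1), of "1 - fst P \<bullet> \<zeta>"])
          (use P(2) in auto)
      then show False using attained \<open>\<Gamma> \<noteq> {}\<close> by simp
    next
      case False
      then obtain z where z: "z \<in> Z" by blast
      then have "z \<notin> E" "z \<noteq> e" using EZ(3) e by auto
      show False
      proof (cases "z < e")
        case True
        obtain l where l: "z < l" "l < e" "l \<notin> E"
          using isolating_bound_below[OF EZ e True \<open>z \<notin> E\<close>] by blast
        have "z \<ge> t0" "e \<le> t0 + pi" using EZ_slab z e by auto
        moreover have "l + pi \<notin> E"
        proof
          assume "l + pi \<in> E"
          then have "l + pi \<le> t0 + pi" using EZ_slab[of "l + pi"] by simp
          then show False using l \<open>z \<ge> t0\<close> by simp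
        qed
        ultimately show False using window[of l "l + pi"] l by simp
      next
        case False
        then have "e < z" using \<open>z \<noteq> e\<close> by simp
        obtain u where u: "e < u" "u < z" "u \<notin> E"
          using isolating_bound_above[OF EZ e \<open>e < z\<close> \<open>z \<notin> E\<close>] by blast
        have "z \<le> t0 + pi" "t0 \<le> e" using EZ_slab z e by auto
        moreover have "u - pi \<notin> E"
        proof
          assume "u - pi \<in> E"
          then have "t0 \<le> u - pi" using EZ_slab[of "u - pi"] by simp
          then show False using u \<open>z \<le> t0 + pi\<close> by simp
        qed
        ultimately show False using window[of "u - pi" u] u by simp
      qed
    qed
  qed
qed

lemma asymptotic_boundary_subset_closure: "asymptotic_boundary M \<subseteq> closure M"
proof
  fix q assume "q \<in> asymptotic_boundary M"
  then obtain \<sigma> where "range \<sigma> \<subseteq> M" "\<sigma> \<longlonglongrightarrow> q" unfolding asymptotic_boundary_def by blast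
  then show "q \<in> closure M" unfolding closure_sequential by (intro exI[of _ \<sigma>]) auto
qed

theorem corollary2p1:
  fixes \<Gamma> :: "(complex \<times> real) set"
  assumes "null_homologous_Jordan_curve H2R_infinity \<Gamma>"
  shows
    "((\<exists>t0::real. \<Gamma> \<subseteq> sphere 0 1 \<times> {t0<..<t0 + pi}) \<longrightarrow>
        \<not> (\<exists>(S :: 'a topology) A X.
             properly_immersed_minimal_surface S A X \<and>
             asymptotic_boundary (X ` topspace S) = \<Gamma> \<and>
             continuous_surface_with S X \<Gamma>) \<and>
        \<not> (\<exists>(S :: 'a topology) A X.
             properly_immersed_minimal_surface S A X \<and> complete_surface S X \<and>
             asymptotic_boundary (X ` topspace S) = \<Gamma>)) \<and>
     ((\<exists>t0::real. \<Gamma> \<subseteq> sphere 0 1 \<times> {t0..t0 + pi}) \<and>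
      \<not> (\<exists>(t0::real) w. w < pi \<and> \<Gamma> \<subseteq> sphere 0 1 \<times> {t0..t0 + w}) \<longrightarrow>
        \<not> (\<exists>(S :: 'a topology) A X.
             properly_immersed_minimal_surface S A X \<and> complete_surface S X \<and>
             asymptotic_boundary (X ` topspace S) = \<Gamma> \<and>
             continuous_surface_with S X \<Gamma>))"
proof -
  obtain g where g: "simple_path g" "pathfinish g = pathstart g" "path_image g = \<Gamma>"
    and g_inf: "path_image g \<subseteq> H2R_infinity"
    using assms unfolding null_homologous_Jordan_curve_def null_homologous_loop_def by blast
  have no_surface: False
    if S: "properly_immersed_minimal_surface S A X" "asymptotic_boundary (X ` topspace S) = \<Gamma>"
      and bdry: "complete_surface S X \<or> continuous_surface_with S X \<Gamma>"
      and slab: "\<Gamma> \<subseteq> sphere 0 1 \<times> {t0<..<t0 + pi}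
        \<or> \<Gamma> \<subseteq> sphere 0 1 \<times> {t0..t0 + pi} \<and> complete_surface S X"
    for S :: "'a topology" and A X t0
  proof (rule no_minimal_set[OF assms minimal_set_of_surface[OF S]])
    have empty: "X ` surface_boundary S = {}" if "complete_surface S X"
      using that by (simp add: complete_surface_def)
    show "X ` surface_boundary S \<subseteq> X ` topspace S"
      unfolding surface_boundary_def chart_def using openin_subset by fast
    show "\<Gamma> \<subseteq> closure (X ` topspace S)"
      using asymptotic_boundary_subset_closure S(2) by metis
    show "\<Gamma> \<subseteq> sphere 0 1 \<times> {t0<..<t0 + pi}
        \<or> \<Gamma> \<subseteq> sphere 0 1 \<times> {t0..t0 + pi} \<and> X ` surface_boundary S = {}"
      using slab empty by blast
    have "X ` topspace S \<subseteq> H2R"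
      using S(1) continuous_map_image_subset_topspace[of S "top_of_set H2R" X]
      unfolding properly_immersed_minimal_surface_def by simp
    then show "q \<notin> closure (X ` surface_boundary S)" if "q \<in> \<Gamma>" for q
      using bdry finite_boundary_avoids_ideal_boundary[OF _ _ _ g that] g_inf g(3)
      by (cases "complete_surface S X") (simp_all add: empty)
  qed
  show ?thesis
    using no_surface by blast
qed

end
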